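(* There is a cache-oblivious algorithm which, given two sorted arrays $X[0..n_X-1]$ (with $X[0]\le X[1]\le\cdots\le X[n_X-1]$) and $Y[0..n_Y-1]$ (with $Y[0]\le\cdots\le Y[n_Y-1]$) of real numbers, each stored in consecutive memory locations, and an integer $k$ with $1\le k\le n_Xn_Y$, computes a $k$th smallest element of the matrix $A=X+Y$ defined by $A[j][i]=X[i]+Y[j]$ (i.e. an element of the multiset $\{X[i]+Y[j]\}$ that is $k$th in some non-decreasing ordering of it), using $O(n)$ time and $O(\textsc{Scan}(n))$ IOs, where $n=\max\{n_X,n_Y\}$.
   Context: IO-complexity is measured in the external-memory (two-level) model of Aggarwal and Vitter: a fast memory (cache) of $M$ words and an unbounded slow memory (disk), with data transferred in blocks of $B$ consecutive words; the IO-complexity is the number of block transfers. An algorithm is cache-oblivious if it does not use the parameters $M$ and $B$ (they appear only in the analysis); as usual in this model, an optimal block replacement strategy is assumed. $\textsc{Scan}(s)$ denotes the number of IOs needed to scan $s$ consecutive items, so $\textsc{Scan}(s)\le 1+\lceil s/B\rceil$. *)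

theory Defs
  imports Complex_Main "HOL-Library.Multiset" "HOL-Library.Extended_Nat"
begin

section \<open>A random-access machine with real arithmetic\<close>

text \<open>
  Algorithms are programs of a small imperative language. A program is a finite
  object, so it uses a fixed number of registers. There are registers for naturals
  and registers for reals, and an unbounded memory, addressed by naturals, each of
  whose words contains a natural or a real. Reals can only be added, subtracted,
  compared and moved; there is no conversion between reals and naturals.
  Since a program syntactically cannot refer to the cache size or the block size, and
  its semantics does not involve them, every program is cache-oblivious.
\<close>

datatype word = NatW nat | RealW real

record state =
  nreg :: "nat \<Rightarrow> nat"
  rreg :: "nat \<Rightarrow> real"
  mem :: "nat \<Rightarrow> word"

datatype nexp = NConst nat | NReg nat
  | NAdd nexp nexp | NSub nexp nexp | NMul nexp nexp | NDiv nexp nexp | NMod nexp nexp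

datatype rexp = RReg nat | RAdd rexp rexp | RSub rexp rexp

datatype bexp = NLess nexp nexp | RLess rexp rexp | BNot bexp | BAnd bexp bexp

datatype com =
    Skip
  | NAssign nat nexp
  | RAssign nat rexp
  | NLoad nat nexp
  | RLoad nat nexp
  | NStore nexp nexp
  | RStore nexp rexp
  | Seq com com
  | Cond bexp com com
  | While bexp com

text \<open>Subtraction of naturals is truncated; \<open>x div 0 = 0\<close> and \<open>x mod 0 = x\<close>.\<close>

primrec nval :: "nexp \<Rightarrow> state \<Rightarrow> nat" where
  "nval (NConst c) s = c"
| "nval (NReg x) s = nreg s x"
| "nval (NAdd e f) s = nval e s + nval f s"
| "nval (NSub e f) s = nval e s - nval f s"
| "nval (NMul e f) s = nval e s * nval f s"
| "nval (NDiv e f) s = nval e s div nval f s"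
| "nval (NMod e f) s = nval e s mod nval f s"

primrec rval :: "rexp \<Rightarrow> state \<Rightarrow> real" where
  "rval (RReg x) s = rreg s x"
| "rval (RAdd e f) s = rval e s + rval f s"
| "rval (RSub e f) s = rval e s - rval f s"

primrec bval :: "bexp \<Rightarrow> state \<Rightarrow> bool" where
  "bval (NLess e f) s \<longleftrightarrow> nval e s < nval f s"
| "bval (RLess e f) s \<longleftrightarrow> rval e s < rval f s"
| "bval (BNot b) s \<longleftrightarrow> \<not> bval b s"
| "bval (BAnd b c) s \<longleftrightarrow> bval b s \<and> bval c s"

text \<open>
  Naturals must fit into a machine word: every natural that is computed, also as an
  intermediate result, has to be at most \<open>W\<close>. A program exceeding this bound gets stuck.
\<close>

primrec nfits :: "nat \<Rightarrow> nexp \<Rightarrow> state \<Rightarrow> bool" where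
  "nfits W (NConst c) s \<longleftrightarrow> c \<le> W"
| "nfits W (NReg x) s \<longleftrightarrow> nreg s x \<le> W"
| "nfits W (NAdd e f) s \<longleftrightarrow> nfits W e s \<and> nfits W f s \<and> nval e s + nval f s \<le> W"
| "nfits W (NSub e f) s \<longleftrightarrow> nfits W e s \<and> nfits W f s"
| "nfits W (NMul e f) s \<longleftrightarrow> nfits W e s \<and> nfits W f s \<and> nval e s * nval f s \<le> W"
| "nfits W (NDiv e f) s \<longleftrightarrow> nfits W e s \<and> nfits W f s"
| "nfits W (NMod e f) s \<longleftrightarrow> nfits W e s \<and> nfits W f s"

primrec bfits :: "nat \<Rightarrow> bexp \<Rightarrow> state \<Rightarrow> bool" where
  "bfits W (NLess e f) s \<longleftrightarrow> nfits W e s \<and> nfits W f s"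
| "bfits W (RLess e f) s \<longleftrightarrow> True"
| "bfits W (BNot b) s \<longleftrightarrow> bfits W b s"
| "bfits W (BAnd b c) s \<longleftrightarrow> bfits W b s \<and> bfits W c s"

text \<open>
  Time is unit cost: one step per constructor of an evaluated expression and one
  step per executed command.
\<close>

primrec ncost :: "nexp \<Rightarrow> nat" where
  "ncost (NConst c) = 1"
| "ncost (NReg x) = 1"
| "ncost (NAdd e f) = 1 + ncost e + ncost f"
| "ncost (NSub e f) = 1 + ncost e + ncost f"
| "ncost (NMul e f) = 1 + ncost e + ncost f"
| "ncost (NDiv e f) = 1 + ncost e + ncost f"
| "ncost (NMod e f) = 1 + ncost e + ncost f"

primrec rcost :: "rexp \<Rightarrow> nat" where
  "rcost (RReg x) = 1"
| "rcost (RAdd e f) = 1 + rcost e + rcost f"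
| "rcost (RSub e f) = 1 + rcost e + rcost f"

primrec bcost :: "bexp \<Rightarrow> nat" where
  "bcost (NLess e f) = 1 + ncost e + ncost f"
| "bcost (RLess e f) = 1 + rcost e + rcost f"
| "bcost (BNot b) = 1 + bcost b"
| "bcost (BAnd b c) = 1 + bcost b + bcost c"

datatype access = Rd nat | Wr nat

text \<open>
  \<open>exec W P s t tr s'\<close>: with word bound \<open>W\<close>, program \<open>P\<close> started in state \<open>s\<close> terminates
  in state \<open>s'\<close> after \<open>t\<close> steps, and \<open>tr\<close> is the sequence of its memory accesses.
  Loading a word of the wrong sort gets stuck.
\<close>

inductive exec :: "nat \<Rightarrow> com \<Rightarrow> state \<Rightarrow> nat \<Rightarrow> access list \<Rightarrow> state \<Rightarrow> bool" for W :: nat where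
  Skip: "exec W Skip s 1 [] s"
| NAssign: "nfits W e s \<Longrightarrow>
    exec W (NAssign x e) s (1 + ncost e) [] (s\<lparr>nreg := (nreg s)(x := nval e s)\<rparr>)"
| RAssign: "exec W (RAssign x e) s (1 + rcost e) [] (s\<lparr>rreg := (rreg s)(x := rval e s)\<rparr>)"
| NLoad: "nfits W e s \<Longrightarrow> mem s (nval e s) = NatW v \<Longrightarrow>
    exec W (NLoad x e) s (1 + ncost e) [Rd (nval e s)] (s\<lparr>nreg := (nreg s)(x := v)\<rparr>)"
| RLoad: "nfits W e s \<Longrightarrow> mem s (nval e s) = RealW v \<Longrightarrow>
    exec W (RLoad x e) s (1 + ncost e) [Rd (nval e s)] (s\<lparr>rreg := (rreg s)(x := v)\<rparr>)"
| NStore: "nfits W e s \<Longrightarrow> nfits W f s \<Longrightarrow>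
    exec W (NStore e f) s (1 + ncost e + ncost f) [Wr (nval e s)]
      (s\<lparr>mem := (mem s)(nval e s := NatW (nval f s))\<rparr>)"
| RStore: "nfits W e s \<Longrightarrow>
    exec W (RStore e f) s (1 + ncost e + rcost f) [Wr (nval e s)]
      (s\<lparr>mem := (mem s)(nval e s := RealW (rval f s))\<rparr>)"
| Seq: "exec W P s t tr s' \<Longrightarrow> exec W Q s' t' tr' s'' \<Longrightarrow>
    exec W (Seq P Q) s (1 + t + t') (tr @ tr') s''"
| CondTrue: "bfits W b s \<Longrightarrow> bval b s \<Longrightarrow> exec W P s t tr s' \<Longrightarrow>
    exec W (Cond b P Q) s (1 + bcost b + t) tr s'"
| CondFalse: "bfits W b s \<Longrightarrow> \<not> bval b s \<Longrightarrow> exec W Q s t tr s' \<Longrightarrow>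
    exec W (Cond b P Q) s (1 + bcost b + t) tr s'"
| WhileFalse: "bfits W b s \<Longrightarrow> \<not> bval b s \<Longrightarrow> exec W (While b P) s (1 + bcost b) [] s"
| WhileTrue: "bfits W b s \<Longrightarrow> bval b s \<Longrightarrow> exec W P s t tr s' \<Longrightarrow>
    exec W (While b P) s' t' tr' s'' \<Longrightarrow>
    exec W (While b P) s (1 + bcost b + t + t') (tr @ tr') s''"

inductive_cases exec_elims:
  "exec W Skip s t tr s'"
  "exec W (NAssign x e) s t tr s'"
  "exec W (RAssign x r) s t tr s'"
  "exec W (NLoad x e) s t tr s'"
  "exec W (RLoad x e) s t tr s'"
  "exec W (NStore e f) s t tr s'"
  "exec W (RStore e r) s t tr s'"
  "exec W (Seq P Q) s t tr s'"
  "exec W (Cond b P Q) s t tr s'"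
inductive_cases exec_While_elim: "exec W (While b P) s t tr s'"

lemma exec_deterministic:
  assumes "exec W P s t tr s'" "exec W P s u vr s''"
  shows "u = t \<and> vr = tr \<and> s'' = s'"
  using assms
proof (induction arbitrary: u vr s'' rule: exec.induct)
  case (Seq P s t tr s1 Q t' tr' s2)
  from Seq.prems obtain t3 tr3 s3 t4 tr4 where
    *: "exec W P s t3 tr3 s3" "exec W Q s3 t4 tr4 s''" "u = 1 + t3 + t4" "vr = tr3 @ tr4"
    by (rule exec_elims) simp
  from Seq.IH(1)[OF *(1)] Seq.IH(2)[of t4 tr4 s''] * show ?case by simp
next
  case (CondTrue b s P t tr s1 Q)
  from CondTrue.prems obtain t3 where *: "exec W P s t3 vr s''" "u = 1 + bcost b + t3"
    by (rule exec_elims) (use CondTrue.hyps in simp_all)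
  from CondTrue.IH[OF *(1)] * show ?case by simp
next
  case (CondFalse b s Q t tr s1 P)
  from CondFalse.prems obtain t3 where *: "exec W Q s t3 vr s''" "u = 1 + bcost b + t3"
    by (rule exec_elims) (use CondFalse.hyps in simp_all)
  from CondFalse.IH[OF *(1)] * show ?case by simp
next
  case (WhileFalse b s P)
  from WhileFalse.prems show ?case
    by (rule exec_While_elim) (use WhileFalse.hyps in simp_all)
next
  case (WhileTrue b s P t tr s1 t' tr' s2)
  from WhileTrue.prems obtain t3 tr3 s3 t4 tr4 where
    *: "exec W P s t3 tr3 s3" "exec W (While b P) s3 t4 tr4 s''"
      "u = 1 + bcost b + t3 + t4" "vr = tr3 @ tr4"
    by (rule exec_While_elim) (use WhileTrue.hyps in simp_all)
  from WhileTrue.IH(1)[OF *(1)] WhileTrue.IH(2)[of t4 tr4 s''] * show ?case by simp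
qed (erule exec_elims; simp)+


section \<open>The external-memory model\<close>

text \<open>
  Memory is divided into blocks of \<open>B\<close> consecutive words; address \<open>a\<close> lies in block
  \<open>a div B\<close>. \<open>cache_run M B C D tr q\<close>: if the blocks in the cache are \<open>C\<close> and those in
  \<open>D\<close> have been modified since they were last on disk, then the accesses \<open>tr\<close> can be
  served with \<open>q\<close> block transfers by a cache of \<open>M\<close> words, leaving no modified block
  that has not been written back. The replacement strategy is the choice between the
  last three rules.
\<close>

inductive cache_run :: "nat \<Rightarrow> nat \<Rightarrow> nat set \<Rightarrow> nat set \<Rightarrow> access list \<Rightarrow> nat \<Rightarrow> bool"
  for M B :: nat where
  Finish: "cache_run M B C {} [] 0"
| Read: "a div B \<in> C \<Longrightarrow> cache_run M B C D tr q \<Longrightarrow> cache_run M B C D (Rd a # tr) q"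
| Write: "a div B \<in> C \<Longrightarrow> cache_run M B C (insert (a div B) D) tr q \<Longrightarrow>
    cache_run M B C D (Wr a # tr) q"
| Fetch: "b \<notin> C \<Longrightarrow> (card C + 1) * B \<le> M \<Longrightarrow> cache_run M B (insert b C) D tr q \<Longrightarrow>
    cache_run M B C D tr (q + 1)"
| Write_back: "b \<in> D \<Longrightarrow> cache_run M B C (D - {b}) tr q \<Longrightarrow> cache_run M B C D tr (q + 1)"
| Evict: "b \<in> C - D \<Longrightarrow> cache_run M B (C - {b}) D tr q \<Longrightarrow> cache_run M B C D tr q"

text \<open>
  The number of block transfers under an optimal replacement strategy, starting with an
  empty cache. It is \<open>\<infinity>\<close> if the accesses cannot be served at all (e.g. if \<open>M < B\<close>).
\<close>

definition io_cost :: "nat \<Rightarrow> nat \<Rightarrow> access list \<Rightarrow> enat" where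
  "io_cost M B tr = Inf {enat q | q. cache_run M B {} {} tr q}"

text \<open>The worst case is over the alignment of the items with respect to the blocks.\<close>

definition Scan :: "nat \<Rightarrow> nat \<Rightarrow> nat \<Rightarrow> enat" where
  "Scan M B n = (SUP a. io_cost M B (map Rd [a..<a + n]))"

lemma cache_run_scan:
  assumes "1 \<le> B" "B \<le> M" "a < e"
  shows "cache_run M B {a div B} {} (map Rd [a..<e]) ((e - 1) div B - a div B)"
  using assms(3)
proof (induction "e - a" arbitrary: a)
  case 0
  then show ?case by simp
next
  case (Suc d)
  have l: "[a..<e] = a # [Suc a..<e]" using Suc.prems by (simp add: upt_conv_Cons)
  show ?case
  proof (cases "Suc a = e")
    case True
    moreover have "cache_run M B {a div B} {} [Rd a] 0"
      by (intro cache_run.Read cache_run.Finish) simp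
    ultimately show ?thesis by (simp add: l True[symmetric])
  next
    case False
    with Suc.prems have lt: "Suc a < e" by simp
    have IH: "cache_run M B {Suc a div B} {} (map Rd [Suc a..<e]) ((e - 1) div B - Suc a div B)"
      using Suc lt by simp
    show ?thesis
    proof (cases "Suc a div B = a div B")
      case True
      with IH have "cache_run M B {a div B} {} (Rd a # map Rd [Suc a..<e]) ((e - 1) div B - a div B)"
        by (intro cache_run.Read) simp_all
      then show ?thesis by (simp only: l list.map)
    next
      case False
      then have S: "Suc a div B = Suc (a div B)"
        by (metis div_Suc)
      have "Suc a div B \<le> (e - 1) div B" using lt by (intro div_le_mono) simp
      then have q: "(e - 1) div B - a div B = ((e - 1) div B - Suc a div B) + 1"
        using S by simp
      have "cache_run M B {} {} (map Rd [Suc a..<e]) (((e - 1) div B - Suc a div B) + 1)"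
        by (rule cache_run.Fetch[of "Suc a div B"]) (simp, use assms in simp, rule IH)
      then have "cache_run M B {a div B} {} (map Rd [Suc a..<e]) ((e - 1) div B - a div B)"
        by (subst q) (rule cache_run.Evict[of "a div B"], simp_all only: Diff_cancel Diff_empty insertI1)
      then have "cache_run M B {a div B} {} (Rd a # map Rd [Suc a..<e]) ((e - 1) div B - a div B)"
        by (rule cache_run.Read[rotated]) simp
      then show ?thesis by (simp only: l list.map)
    qed
  qed
qed

lemma Scan_le:
  assumes "1 \<le> B" "B \<le> M"
  shows "Scan M B n \<le> enat (1 + nat \<lceil>real n / real B\<rceil>)"
  unfolding Scan_def
proof (rule SUP_least)
  fix a
  show "io_cost M B (map Rd [a..<a + n]) \<le> enat (1 + nat \<lceil>real n / real B\<rceil>)"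
  proof (cases "n = 0")
    case True
    have "cache_run M B {} {} (map Rd [a..<a + n]) 0" using True by (simp add: cache_run.Finish)
    then have "io_cost M B (map Rd [a..<a + n]) \<le> enat 0"
      unfolding io_cost_def by (intro Inf_lower) blast
    then show ?thesis by (simp add: zero_enat_def[symmetric])
  next
    case False
    let ?q = "(a + n - 1) div B - a div B"
    have "cache_run M B {} {} (map Rd [a..<a + n]) (?q + 1)"
      by (rule cache_run.Fetch[of "a div B"]) (use cache_run_scan[of B M a "a + n"] assms False in auto)
    then have *: "io_cost M B (map Rd [a..<a + n]) \<le> enat (?q + 1)"
      unfolding io_cost_def by (intro Inf_lower) blast
    let ?m = "nat \<lceil>real n / real B\<rceil>"
    have "real n / real B \<le> real ?m" by linarith
    moreover have "0 < real B" using assms by simp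
    ultimately have "real n \<le> real (?m * B)" by (simp only: pos_divide_le_eq of_nat_mult)
    then have "n \<le> ?m * B" by (simp only: of_nat_le_iff)
    then have "(a + n - 1) div B \<le> (a + ?m * B) div B" by (intro div_le_mono) simp
    also have "\<dots> = a div B + ?m" using assms by simp
    finally have "?q + 1 \<le> 1 + ?m" by simp
    with * show ?thesis by (meson enat_ord_simps(1) order_trans)
  qed
qed


section \<open>Selection in \<open>X + Y\<close>\<close>

definition stored_at :: "state \<Rightarrow> nat \<Rightarrow> real list \<Rightarrow> bool" where
  "stored_at s p xs \<longleftrightarrow> (\<forall>i < length xs. mem s (p + i) = RealW (xs ! i))"

definition sum_matrix :: "real list \<Rightarrow> real list \<Rightarrow> nat \<Rightarrow> nat \<Rightarrow> real" where
  "sum_matrix X Y j i = X ! i + Y ! j"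

definition entries :: "nat \<Rightarrow> nat \<Rightarrow> (nat \<Rightarrow> nat \<Rightarrow> real) \<Rightarrow> real multiset" where
  "entries rows cols A =
    image_mset (\<lambda>(j, i). A j i) (mset_set ({..<rows} \<times> {..<cols}))"

definition is_kth_smallest :: "nat \<Rightarrow> real multiset \<Rightarrow> real \<Rightarrow> bool" where
  "is_kth_smallest k S v \<longleftrightarrow>
    (\<exists>zs. mset zs = S \<and> sorted zs \<and> 1 \<le> k \<and> k \<le> length zs \<and> zs ! (k - 1) = v)"

end

(*
A program that keeps its data on a fixed number of interleaved stacks accesses memory through
as many fingers, each of which moves by O(1) words per step. As a cache of three blocks per
finger only has to reload when some finger has moved by a block, t steps cost O(1 + t/B) block
transfers. So it suffices to solve the problem in linear time on a machine with stacks.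

There, the matrix is padded to N x N for a power N of two and the odd rows and columns are
taken recursively (Mirzaian and Arjomandi). For two ranks k1 <= k2 with k2 - k1 = O(N), two
ranks of the sampled matrix, again O(N) apart, give elements enclosing those of ranks k1 and
k2 such that only O(N) entries lie strictly in between. These are collected by walking along
the staircase, and the wanted elements are selected among them in linear time, with the median
of medians of medians of three as pivot. The work at all sizes is a geometric sum.
*)

theory Submission imports Defs begin

section \<open>Fingers\<close>

text \<open>One rank does not survive the sampling: enclosing an element takes two elements of the
  sample, so a pair of ranks is carried throughout, equal at the start. Ranks that are
  \<open>c * N\<close> apart lead to ranks at most \<open>c * N / 4 + N\<close> apart in the sample
  of side \<open>N / 2\<close>, which is again at most \<open>c * (N / 2)\<close> once
  \<open>c\<close> is at least 4; here \<open>c = 8\<close>. Entries equal to a bound may be far too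
  many to collect, so only those strictly between the bounds are, and each bound stands for all its
  ties. Medians of three alone would make selection recurse on sizes \<open>n / 3\<close> and
  \<open>2 * n / 3\<close>, which is not linear; the second round of medians turns this into
  \<open>n / 9\<close> and about \<open>7 * n / 9\<close>. The language has neither recursion nor
  big words. Recursions become loops over explicit stacks, with rules about a loop that is still
  running, and additions are restricted because repeated doubling would outgrow every polynomial
  word bound. The IO bound is a multiple of \<open>Scan\<close>, so \<open>Scan\<close> itself has
  to be bounded from below.\<close>

primrec adr :: "access \<Rightarrow> nat" where
  "adr (Rd a) = a"
| "adr (Wr a) = a"

text \<open>Only movement counts in \<open>d\<close>. Accesses at a resting finger are free, because
  its block will be in the cache.\<close>

inductive fingers :: "nat \<Rightarrow> access list \<Rightarrow> (nat \<Rightarrow> nat) \<Rightarrow> (nat \<Rightarrow> nat) \<Rightarrow> nat \<Rightarrow> bool" for f where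
  nil: "fingers f [] g g 0"
| move: "j < f \<Longrightarrow> fingers f tr (g(j := a)) g' d \<Longrightarrow>
    fingers f tr g g' (nat \<bar>int a - int (g j)\<bar> + d)"
| access: "j < f \<Longrightarrow> adr c = g j \<Longrightarrow> fingers f tr g g' d \<Longrightarrow> fingers f (c # tr) g g' d"

lemma fingers_append:
  assumes "fingers f tr g g' d" "fingers f tr' g' g'' d'"
  shows "fingers f (tr @ tr') g g'' (d + d')"
  using assms
proof (induction rule: fingers.induct)
  case (move j tr g a g' d)
  from fingers.move[OF move(1) move.IH[OF move.prems]] show ?case by (simp add: add.assoc)
qed (auto intro: fingers.intros)

section \<open>Serving accesses at fingers with a cache\<close>

lemma cache_run_write_back_all:
  assumes "finite D" "cache_run M B C {} tr q"
  shows "cache_run M B C D tr (card D + q)"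
  using assms
proof (induction D rule: finite_induct)
  case (insert b D)
  then have "cache_run M B C (insert b D - {b}) tr (card D + q)" by simp
  then have "cache_run M B C (insert b D) tr (card D + q + 1)" by (rule cache_run.Write_back[rotated]) simp
  with insert show ?case by simp
qed simp

lemma cache_run_evict_all:
  assumes "finite C" "cache_run M B {} {} tr q"
  shows "cache_run M B C {} tr q"
  using assms
proof (induction C rule: finite_induct)
  case (insert b C)
  then have "cache_run M B (insert b C - {b}) {} tr q" by simp
  then show ?case by (rule cache_run.Evict[rotated]) simp
qed simp

lemma cache_run_fetch_all:
  assumes "finite C'" "cache_run M B (C \<union> C') {} tr q" "card (C \<union> C') * B \<le> M" "C \<inter> C' = {}" "finite C"
  shows "cache_run M B C {} tr (card C' + q)"
  using assms
proof (induction C' arbitrary: C rule: finite_induct)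
  case (insert b C')
  have "card (insert b C) \<le> card (C \<union> insert b C')" using insert by (intro card_mono) auto
  then have "card (insert b C) * B \<le> M" using insert.prems(2) by (meson mult_le_mono1 le_trans)
  moreover have "cache_run M B (insert b C) {} tr (card C' + q)"
    using insert by (intro insert.IH) auto
  ultimately have "cache_run M B C {} tr (card C' + q + 1)"
    using insert by (intro cache_run.Fetch[of b C]) auto
  with insert show ?case by simp
qed simp

text \<open>Every modified block is written back, everything is evicted for free, and the new blocks
  are fetched. Blocks common to \<open>C\<close> and \<open>C'\<close> are transferred as well,
  which only affects constants.\<close>

lemma cache_run_reload:
  assumes "finite C" "D \<subseteq> C" "finite C'" "card C' * B \<le> M" "cache_run M B C' {} tr q"
  shows "cache_run M B C D tr (card D + card C' + q)"
proof -
  have "cache_run M B {} {} tr (card C' + q)"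
    using assms by (intro cache_run_fetch_all) auto
  then have "cache_run M B C {} tr (card C' + q)" using assms(1) by (rule cache_run_evict_all[rotated])
  then show ?thesis
    using cache_run_write_back_all[of D] assms finite_subset by (metis add.assoc)
qed

text \<open>Both neighbours of the anchor's block are included, so that whatever the alignment a
  finger stays inside until it is more than \<open>B\<close> words away. At block 0 the left
  neighbour is truncated to the block itself.\<close>

definition window :: "nat \<Rightarrow> nat \<Rightarrow> (nat \<Rightarrow> nat) \<Rightarrow> nat set" where
  "window f B z = (\<Union>j<f. {z j div B - 1, z j div B, z j div B + 1})"

lemma finite_window: "finite (window f B z)"
  by (simp add: window_def)

lemma card_window: "card (window f B z) \<le> 3 * f"
proof -
  have "card (window f B z) \<le> (\<Sum>j<f. card {z j div B - 1, z j div B, z j div B + 1})"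
    unfolding window_def by (rule card_UN_le) simp
  also have "\<dots> \<le> (\<Sum>j<f. 3)" by (intro sum_mono) (simp add: card_insert_if)
  finally show ?thesis by simp
qed

lemma in_window:
  assumes "j < f" "\<bar>int a - int (z j)\<bar> \<le> int B" "1 \<le> B"
  shows "a div B \<in> window f B z"
proof -
  have "a \<le> z j + B" "z j \<le> a + B" using assms(2) by linarith+
  then have "a div B \<le> (z j + B) div B" "z j div B \<le> (a + B) div B" by (auto intro: div_le_mono)
  then have "a div B \<le> z j div B + 1" "z j div B \<le> a div B + 1" using assms(3) by auto
  then have "a div B \<in> {z j div B - 1, z j div B, z j div B + 1}" by auto
  then show ?thesis using assms(1) by (auto simp: window_def)
qed

text \<open>A finger is anchored at \<open>z j\<close>, and the blocks around the anchor are kept in the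
  cache. The whole cache is reloaded when a finger has moved by more than a block away
  from its anchor; this is paid for by the movement.\<close>

lemma cache_run_fingers:
  assumes "fingers f tr g g' d" "1 \<le> B" "3 * f * B \<le> M"
    and "D \<subseteq> window f B z" "\<And>j. j < f \<Longrightarrow> \<bar>int (g j) - int (z j)\<bar> \<le> int B"
  shows "\<exists>q m. cache_run M B (window f B z) D tr q \<and> q \<le> 3 * f + 6 * f * m \<and>
    int (m * B) \<le> int d + (\<Sum>j<f. \<bar>int (g j) - int (z j)\<bar>)"
  using assms
proof (induction arbitrary: D z rule: fingers.induct)
  case (nil g)
  have "cache_run M B (window f B z) {} [] 0" by (rule cache_run.Finish)
  moreover have "finite D" "card D \<le> 3 * f"
    using nil finite_window card_window by (meson finite_subset card_mono le_trans)+
  ultimately have "cache_run M B (window f B z) D [] (card D + 0)"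
    by (intro cache_run_write_back_all)
  then show ?case using \<open>card D \<le> 3 * f\<close>
    by (intro exI[of _ "card D"] exI[of _ 0]) (auto intro: sum_nonneg)
next
  case (move j tr g a g' d)
  let ?dist = "\<lambda>g z. \<lambda>j. \<bar>int (g j) - int (z j)\<bar>"
  have split: "(\<Sum>i<f. ?dist g z i) = ?dist g z j + (\<Sum>i\<in>{..<f} - {j}. ?dist g z i)" for g z
    using move(1) by (intro sum.remove) auto
  show ?case
  proof (cases "\<bar>int a - int (z j)\<bar> \<le> int B")
    case True
    then have "\<exists>q m. cache_run M B (window f B z) D tr q \<and> q \<le> 3 * f + 6 * f * m \<and>
      int (m * B) \<le> int d + (\<Sum>i<f. ?dist (g(j := a)) z i)"
      using move by (intro move.IH) auto
    then obtain q m where qm: "cache_run M B (window f B z) D tr q" "q \<le> 3 * f + 6 * f * m"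
      "int (m * B) \<le> int d + (\<Sum>i<f. ?dist (g(j := a)) z i)" by blast
    have "(\<Sum>i<f. ?dist (g(j := a)) z i) \<le> \<bar>int a - int (g j)\<bar> + (\<Sum>i<f. ?dist g z i)"
      unfolding split[of _ z] by simp
    with qm show ?thesis by (intro exI[of _ q] exI[of _ m]) auto
  next
    case False
    \<comment> \<open>Only this finger gets a new anchor. Its old distance and the length of the
      move together exceed \<open>B\<close>, its new distance is 0, and the other summands are
      unchanged, so one reload is paid for.\<close>
    let ?z = "z(j := a)"
    have "\<exists>q m. cache_run M B (window f B ?z) {} tr q \<and> q \<le> 3 * f + 6 * f * m \<and>
      int (m * B) \<le> int d + (\<Sum>i<f. ?dist (g(j := a)) ?z i)"
      using move by (intro move.IH) auto
    then obtain q m where qm: "cache_run M B (window f B ?z) {} tr q" "q \<le> 3 * f + 6 * f * m"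
      "int (m * B) \<le> int d + (\<Sum>i<f. ?dist (g(j := a)) ?z i)" by blast
    have "card (window f B ?z) * B \<le> M"
      using card_window[of f B ?z] move.prems(2) by (meson mult_le_mono1 le_trans)
    then have "cache_run M B (window f B z) D tr (card D + card (window f B ?z) + q)"
      using qm(1) move.prems finite_window by (intro cache_run_reload) auto
    moreover have "card D \<le> 3 * f"
      using move.prems(3) finite_window card_window by (meson card_mono le_trans)
    then have "card D + card (window f B ?z) + q \<le> 3 * f + 6 * f * (m + 1)"
      using qm(2) card_window[of f B ?z] by (simp add: algebra_simps)
    moreover have "(\<Sum>i<f. ?dist (g(j := a)) ?z i) + int B
        \<le> \<bar>int a - int (g j)\<bar> + (\<Sum>i<f. ?dist g z i)"
      using False unfolding split by simp
    then have "int ((m + 1) * B) \<le> int (nat \<bar>int a - int (g j)\<bar> + d) + (\<Sum>i<f. ?dist g z i)"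
      using qm(3) by (simp add: algebra_simps)
    ultimately show ?thesis by blast
  qed
next
  case (access j c g tr g' d)
  have a: "adr c div B \<in> window f B z" using access by (intro in_window) auto
  show ?case
  proof (cases c)
    case (Rd x)
    from access obtain q m where "cache_run M B (window f B z) D tr q" "q \<le> 3 * f + 6 * f * m"
      "int (m * B) \<le> int d + (\<Sum>j<f. \<bar>int (g j) - int (z j)\<bar>)" by meson
    with a Rd show ?thesis
      by (intro exI[of _ q] exI[of _ m]) (auto intro: cache_run.Read)
  next
    case (Wr x)
    have "insert (x div B) D \<subseteq> window f B z" using access a Wr by auto
    with access obtain q m where "cache_run M B (window f B z) (insert (x div B) D) tr q" "q \<le> 3 * f + 6 * f * m"
      "int (m * B) \<le> int d + (\<Sum>j<f. \<bar>int (g j) - int (z j)\<bar>)" by meson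
    with a Wr show ?thesis
      by (intro exI[of _ q] exI[of _ m]) (auto intro: cache_run.Write)
  qed
qed

text \<open>Anchoring the fingers where they start makes the initial distances vanish. The first
  \<open>6 * f\<close> covers loading the initial window and writing back at the end.\<close>

lemma io_cost_fingers:
  assumes "fingers f tr g g' d" "1 \<le> B" "3 * f * B \<le> M"
  shows "io_cost M B tr \<le> enat (6 * f + 6 * f * (d div B))"
proof -
  obtain q m where qm: "cache_run M B (window f B g) {} tr q" "q \<le> 3 * f + 6 * f * m"
    "int (m * B) \<le> int d"
    using cache_run_fingers[OF assms, of "{}" g] by auto
  have "card (window f B g) * B \<le> M"
    using card_window[of f B g] assms(3) by (meson mult_le_mono1 le_trans)
  then have "cache_run M B {} {} tr (0 + card (window f B g) + q)"
    using cache_run_reload[of "{}" "{}" "window f B g"] qm(1) finite_window by simp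
  then have "io_cost M B tr \<le> enat (card (window f B g) + q)"
    unfolding io_cost_def by (intro Inf_lower) auto
  moreover have "m \<le> d div B"
    using qm(3) assms(2) by (metis div_le_mono nonzero_mult_div_cancel_right not_one_le_zero of_nat_le_iff)
  then have "6 * f * m \<le> 6 * f * (d div B)" by simp
  then have "card (window f B g) + q \<le> 6 * f + 6 * f * (d div B)"
    using qm(2) card_window[of f B g] by linarith
  ultimately show ?thesis by (meson enat_ord_simps(1) order_trans)
qed

section \<open>A lower bound for scanning\<close>

lemma cache_run_blocks:
  assumes "cache_run M B C D tr q"
  shows "card ((\<lambda>c. adr c div B) ` set tr - C) \<le> q"
  using assms
proof (induction rule: cache_run.induct)
  case (Read a C D tr q)
  then have "(\<lambda>c. adr c div B) ` set (Rd a # tr) - C = (\<lambda>c. adr c div B) ` set tr - C" by auto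
  with Read show ?case by simp
next
  case (Write a C D tr q)
  then have "(\<lambda>c. adr c div B) ` set (Wr a # tr) - C = (\<lambda>c. adr c div B) ` set tr - C" by auto
  with Write show ?case by simp
next
  case (Fetch b C D tr q)
  have "card ((\<lambda>c. adr c div B) ` set tr - C)
      \<le> card (insert b ((\<lambda>c. adr c div B) ` set tr - insert b C))" by (intro card_mono) auto
  also have "\<dots> \<le> Suc (card ((\<lambda>c. adr c div B) ` set tr - insert b C))" by (rule card_insert_le_m1) auto
  finally show ?case using Fetch by simp
next
  case (Evict b C D tr q)
  have "card ((\<lambda>c. adr c div B) ` set tr - C) \<le> card ((\<lambda>c. adr c div B) ` set tr - (C - {b}))"
    by (intro card_mono) auto
  with Evict show ?case by simp
qed simp_all

text \<open>Starting at address 0 is one of the alignments in the supremum. Every block index up to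
  \<open>(n - 1) div B\<close> occurs there, and each of them costs a fetch.\<close>

lemma Scan_ge:
  assumes "1 \<le> n" "1 \<le> B"
  shows "enat ((n - 1) div B + 1) \<le> Scan M B n"
proof -
  have "enat ((n - 1) div B + 1) \<le> io_cost M B (map Rd [0..<0 + n])"
    unfolding io_cost_def
  proof (rule Inf_greatest, clarify)
    fix q assume "cache_run M B {} {} (map Rd [0..<0 + n]) q"
    from cache_run_blocks[OF this]
    have "card ((\<lambda>a. a div B) ` {0..<n}) \<le> q" by (simp add: image_image)
    moreover have "{..(n - 1) div B} \<subseteq> (\<lambda>a. a div B) ` {0..<n}"
    proof
      fix b assume "b \<in> {..(n - 1) div B}"
      then have "b * B \<le> n - 1" using assms(2) by (simp add: less_eq_div_iff_mult_less_eq)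
      then show "b \<in> (\<lambda>a. a div B) ` {0..<n}" using assms by (intro image_eqI[of _ _ "b * B"]) auto
    qed
    then have "card {..(n - 1) div B} \<le> card ((\<lambda>a. a div B) ` {0..<n})" by (intro card_mono) auto
    ultimately show "enat ((n - 1) div B + 1) \<le> enat q" by simp
  qed
  also have "\<dots> \<le> Scan M B n" unfolding Scan_def by (rule SUP_upper) simp
  finally show ?thesis .
qed

lemma io_cost_le_Scan:
  assumes "fingers f tr g g' d" "d \<le> K * n" "1 \<le> n" "1 \<le> B" "3 * f * B \<le> M"
  shows "io_cost M B tr \<le> enat (6 * f * (K + 1)) * Scan M B n"
proof -
  let ?b = "(n - 1) div B + 1"
  have "n - 1 < ?b * B" using assms(4) by (metis Suc_eq_plus1 dividend_less_div_times mult_Suc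
    add.commute mult.commute less_eq_Suc_le One_nat_def)
  then have "n \<le> ?b * B" by simp
  then have "d \<le> K * (?b * B)" using assms(2) by (meson le_trans mult_le_mono2)
  then have "d div B \<le> K * ?b"
    using assms(4) by (metis div_le_mono mult.assoc nonzero_mult_div_cancel_right not_one_le_zero)
  then have "6 * f * (d div B) \<le> 6 * f * (K * ?b)" by (rule mult_le_mono2)
  then have "6 * f + 6 * f * (d div B) \<le> 6 * f * (K + 1) * ?b" by (simp add: algebra_simps)
  then have "io_cost M B tr \<le> enat (6 * f * (K + 1) * ?b)"
    using io_cost_fingers[OF assms(1,4,5)] by (meson enat_ord_simps(1) order_trans)
  also have "\<dots> = enat (6 * f * (K + 1)) * enat ?b" by simp
  also have "\<dots> \<le> enat (6 * f * (K + 1)) * Scan M B n"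
    using Scan_ge[OF assms(3,4)] by (rule mult_left_mono) simp
  finally show ?thesis .
qed

section \<open>A machine with stacks\<close>

text \<open>Stacks 0 and 1 are the input arrays, popped from their ends, stacks 2 to 9 contain
  reals and stacks 10 and 11 contain naturals. The last ten are interleaved in memory, so
  that all of them can grow without bound. Registers below 20 are available to programs,
  register \<open>20 + j\<close> contains the height of stack \<open>j\<close>, and registers 32 to 34 the base
  addresses. The head of a list is the top of the stack.\<close>

type_synonym bases = "nat \<times> nat \<times> nat"
type_synonym nregs = "nat \<Rightarrow> nat"
type_synonym rregs = "nat \<Rightarrow> real"
type_synonym rstacks = "nat \<Rightarrow> real list"
type_synonym nstacks = "nat \<Rightarrow> nat list"

definition slot :: "bases \<Rightarrow> nat \<Rightarrow> nat \<Rightarrow> nat" where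
  "slot p j i = (case p of (pX, pY, b) \<Rightarrow>
    if j = 0 then pX + i else if j = 1 then pY + i else b + 12 * i + j)"

definition contents :: "rstacks \<Rightarrow> nstacks \<Rightarrow> nat \<Rightarrow> word list" where
  "contents S T j = (if j < 10 then map RealW (S j) else map NatW (T j))"

definition layout :: "bases \<Rightarrow> (nat \<Rightarrow> word list) \<Rightarrow> state \<Rightarrow> bool" where
  "layout p w s \<longleftrightarrow> (case p of (pX, pY, b) \<Rightarrow>
    nreg s 32 = pX \<and> nreg s 33 = pY \<and> nreg s 34 = b \<and>
    pX + length (w 0) \<le> b \<and> pY + length (w 1) \<le> b) \<and>
    (\<forall>j < 12. nreg s (20 + j) = length (w j)) \<and>
    (\<forall>j < 12. \<forall>i < length (w j). mem s (slot p j i) = rev (w j) ! i)"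

definition regv :: "nregs \<Rightarrow> rstacks \<Rightarrow> nstacks \<Rightarrow> nat \<Rightarrow> nat" where
  "regv n S T x = (if x < 20 then n x else length (contents S T (x - 20)))"

definition represents ::
  "bases \<Rightarrow> nregs \<Rightarrow> rregs \<Rightarrow> rstacks \<Rightarrow> nstacks \<Rightarrow> state \<Rightarrow> bool" where
  "represents p n r S T s \<longleftrightarrow>
    layout p (contents S T) s \<and> rreg s = r \<and> (\<forall>x < 20. nreg s x = n x)"

definition bounded ::
  "nregs \<Rightarrow> rstacks \<Rightarrow> nstacks \<Rightarrow> nat \<Rightarrow> nat \<Rightarrow> bool" where
  "bounded n S T l q \<longleftrightarrow> (\<forall>j < 12. length (contents S T j) \<le> l) \<and> (\<forall>x < 20. n x \<le> q) \<and>
    (\<forall>j < 12. \<forall>v \<in> set (T j). v \<le> q)"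

definition grow :: "nat \<Rightarrow> nat \<Rightarrow> nat \<Rightarrow> nat" where
  "grow l q t = q + t * (l + t + 64)"

definition room :: "nat \<Rightarrow> bases \<Rightarrow> nat \<Rightarrow> nat \<Rightarrow> nat \<Rightarrow> bool" where
  "room W p l q t \<longleftrightarrow> snd (snd p) + 12 * (l + t) + 12 \<le> W \<and> 64 + grow l q t \<le> W"

definition pos :: "bases \<Rightarrow> rstacks \<Rightarrow> nstacks \<Rightarrow> nat \<Rightarrow> nat" where
  "pos p S T j = slot p j (length (contents S T j))"

text \<open>A step of the stack machine moves one finger by at most 12 words. Each step can
  increase the naturals by the height of a stack, which itself is bounded by the time.\<close>

definition serves :: "nat \<Rightarrow> com \<Rightarrow> bases \<Rightarrow> state \<Rightarrow> nat \<Rightarrow> nat \<Rightarrow> rstacks \<Rightarrow> nstacks \<Rightarrow>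
    nat \<Rightarrow> nregs \<Rightarrow> rregs \<Rightarrow> rstacks \<Rightarrow> nstacks \<Rightarrow> bool" where
  "serves W c p s l q S T t n' r' S' T' \<longleftrightarrow>
    (\<exists>u tr s' d. exec W c s u tr s' \<and> u < 20 * t \<and> represents p n' r' S' T' s' \<and>
      bounded n' S' T' (l + t) (grow l q t) \<and>
      fingers 12 tr (pos p S T) (pos p S' T') d \<and> d \<le> 20 * t)"

text \<open>Word bound, addresses and concrete states are quantified away here, so that programs can
  be analysed on registers and stacks only. The condition \<open>room\<close> is discharged once,
  for the whole program.\<close>

definition runs :: "com \<Rightarrow> nregs \<Rightarrow> rregs \<Rightarrow> rstacks \<Rightarrow> nstacks \<Rightarrow>
    nat \<Rightarrow> nregs \<Rightarrow> rregs \<Rightarrow> rstacks \<Rightarrow> nstacks \<Rightarrow> bool" where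
  "runs c n r S T t n' r' S' T' \<longleftrightarrow>
    (\<forall>W p s l q. represents p n r S T s \<and> bounded n S T l q \<and> room W p l q t \<longrightarrow>
      serves W c p s l q S T t n' r' S' T')"

definition wp :: "com \<Rightarrow>
    (nat \<Rightarrow> nregs \<Rightarrow> rregs \<Rightarrow> rstacks \<Rightarrow> nstacks \<Rightarrow> bool) \<Rightarrow>
    nregs \<Rightarrow> rregs \<Rightarrow> rstacks \<Rightarrow> nstacks \<Rightarrow> bool" where
  "wp c Q n r S T \<longleftrightarrow> (\<exists>t n' r' S' T'. runs c n r S T t n' r' S' T' \<and> Q t n' r' S' T')"

section \<open>Composing runs\<close>

lemma grow_grow: "grow (l + t1) (grow l q t1) t2 \<le> grow l q (t1 + t2)"
proof -
  have "t1 * (l + t1 + 64) \<le> t1 * (l + (t1 + t2) + 64)" by (intro mult_le_mono2) simp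
  moreover have "(t1 + t2) * (l + (t1 + t2) + 64) =
    t1 * (l + (t1 + t2) + 64) + t2 * (l + t1 + t2 + 64)" by (simp add: algebra_simps)
  ultimately show ?thesis unfolding grow_def by simp
qed

lemma grow_mono: "t \<le> t' \<Longrightarrow> grow l q t \<le> grow l q t'"
  unfolding grow_def by (intro add_mono mult_mono) auto

lemma bounded_mono: "bounded n S T l q \<Longrightarrow> l \<le> l' \<Longrightarrow> q \<le> q' \<Longrightarrow> bounded n S T l' q'"
  unfolding bounded_def by (meson le_trans)

lemma room_split:
  assumes "room W p l q (t1 + t2)"
  shows "room W p l q t1" "room W p (l + t1) (grow l q t1) t2"
proof -
  have "grow l q t1 \<le> grow l q (t1 + t2)" by (rule grow_mono) simp
  then show "room W p l q t1" "room W p (l + t1) (grow l q t1) t2"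
    using assms grow_grow[of l t1 q t2] unfolding room_def by auto
qed

lemma runs_Seq:
  assumes "runs c n r S T t1 n' r' S' T'" "runs d n' r' S' T' t2 n'' r'' S'' T''"
  shows "runs (Seq c d) n r S T (t1 + t2) n'' r'' S'' T''"
  unfolding runs_def
proof (intro allI impI, elim conjE)
  fix W p s l q
  assume a: "represents p n r S T s" "bounded n S T l q" "room W p l q (t1 + t2)"
  from assms(1) a room_split[OF a(3)] obtain u1 tr1 s1 d1 where
    1: "exec W c s u1 tr1 s1" "u1 < 20 * t1" "represents p n' r' S' T' s1"
    "bounded n' S' T' (l + t1) (grow l q t1)"
    "fingers 12 tr1 (pos p S T) (pos p S' T') d1" "d1 \<le> 20 * t1"
    unfolding runs_def serves_def by blast
  from assms(2) 1 room_split[OF a(3)] obtain u2 tr2 s2 d2 where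
    2: "exec W d s1 u2 tr2 s2" "u2 < 20 * t2" "represents p n'' r'' S'' T'' s2"
    "bounded n'' S'' T'' (l + t1 + t2) (grow (l + t1) (grow l q t1) t2)"
    "fingers 12 tr2 (pos p S' T') (pos p S'' T'') d2" "d2 \<le> 20 * t2"
    unfolding runs_def serves_def by blast
  have "bounded n'' S'' T'' (l + (t1 + t2)) (grow l q (t1 + t2))"
    using 2(4) by (rule bounded_mono) (simp_all add: grow_grow)
  \<comment> \<open>Both running times are strictly below 20 times their counts; this slack absorbs
    the step that \<open>Seq\<close> itself costs.\<close>
  then show "serves W (Seq c d) p s l q S T (t1 + t2) n'' r'' S'' T''"
    unfolding serves_def
    using exec.Seq[OF 1(1) 2(1)] fingers_append[OF 1(5) 2(5)] 1(2,6) 2(2,3,6)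
    by (intro exI[of _ "1 + u1 + u2"] exI[of _ "tr1 @ tr2"] exI[of _ s2] exI[of _ "d1 + d2"]) auto
qed

lemma wp_Seq:
  assumes "wp c (\<lambda>t. wp d (\<lambda>t'. Q (t + t'))) n r S T"
  shows "wp (Seq c d) Q n r S T"
proof -
  from assms obtain t n1 r1 S1 T1 t' n2 r2 S2 T2 where
    "runs c n r S T t n1 r1 S1 T1" "runs d n1 r1 S1 T1 t' n2 r2 S2 T2" "Q (t + t') n2 r2 S2 T2"
    unfolding wp_def by blast
  then show ?thesis using runs_Seq unfolding wp_def by fast
qed

lemma runs_Skip: "runs Skip n r S T 1 n r S T"
  unfolding runs_def serves_def
  using exec.Skip fingers.nil grow_mono[of 0 1]
  by (fastforce intro: bounded_mono simp: grow_def)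

lemma wp_Skip: "Q 1 n r S T \<Longrightarrow> wp Skip Q n r S T"
  using runs_Skip unfolding wp_def by blast

section \<open>Expressions that keep the naturals small\<close>

primrec atom :: "nexp \<Rightarrow> bool" where
  "atom (NConst c) \<longleftrightarrow> c \<le> 64"
| "atom (NReg x) \<longleftrightarrow> x < 32"
| "atom (NAdd e f) \<longleftrightarrow> False"
| "atom (NSub e f) \<longleftrightarrow> False"
| "atom (NMul e f) \<longleftrightarrow> False"
| "atom (NDiv e f) \<longleftrightarrow> False"
| "atom (NMod e f) \<longleftrightarrow> False"

text \<open>The summand added to a register is a constant or a height, so a step adds at most the
  larger of 64 and a height. Adding two registers, or multiplying, could make the naturals grow
  exponentially.\<close>

primrec tame :: "nexp \<Rightarrow> bool" where
  "tame (NConst c) \<longleftrightarrow> c \<le> 64"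
| "tame (NReg x) \<longleftrightarrow> x < 32"
| "tame (NAdd e f) \<longleftrightarrow> (\<exists>x < 20. e = NReg x) \<and> atom f \<and> (\<forall>x < 20. f \<noteq> NReg x)"
| "tame (NSub e f) \<longleftrightarrow> atom e \<and> atom f"
| "tame (NMul e f) \<longleftrightarrow> False"
| "tame (NDiv e f) \<longleftrightarrow> atom e \<and> atom f"
| "tame (NMod e f) \<longleftrightarrow> False"

primrec guard :: "bexp \<Rightarrow> bool" where
  "guard (NLess e f) \<longleftrightarrow> atom e \<and> atom f"
| "guard (RLess e f) \<longleftrightarrow> True"
| "guard (BNot b) \<longleftrightarrow> guard b"
| "guard (BAnd b c) \<longleftrightarrow> guard b \<and> guard c"

text \<open>A dummy state on which \<open>nval\<close>, \<open>rval\<close> and \<open>bval\<close>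
  evaluate expressions of the stack machine. Its memory is arbitrary, as expressions do not read
  memory.\<close>

definition view :: "nregs \<Rightarrow> rregs \<Rightarrow> rstacks \<Rightarrow> nstacks \<Rightarrow> state" where
  "view n r S T = \<lparr>nreg = regv n S T, rreg = r, mem = \<lambda>_. NatW 0\<rparr>"

lemma view_simps [simp]: "nreg (view n r S T) = regv n S T" "rreg (view n r S T) = r"
  by (simp_all add: view_def)

lemma represents_nreg:
  assumes "represents p n r S T s" "x < 32"
  shows "nreg s x = regv n S T x"
proof (cases "x < 20")
  case False
  then have "x - 20 < 12" "x = 20 + (x - 20)" using assms(2) by auto
  then show ?thesis using assms(1) False unfolding represents_def layout_def regv_def by metis
qed (use assms in \<open>simp add: represents_def regv_def\<close>)

lemma regv_le:
  assumes "bounded n S T l q" "x < 32"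
  shows "regv n S T x \<le> max l q" "x < 20 \<Longrightarrow> regv n S T x \<le> q" "\<not> x < 20 \<Longrightarrow> regv n S T x \<le> l"
proof -
  show "x < 20 \<Longrightarrow> regv n S T x \<le> q" using assms unfolding bounded_def regv_def by auto
  moreover show "\<not> x < 20 \<Longrightarrow> regv n S T x \<le> l" using assms unfolding bounded_def regv_def by auto
  ultimately show "regv n S T x \<le> max l q" by linarith
qed

lemma atom_eval:
  assumes "atom e" "represents p n r S T s" "bounded n S T l q"
  shows "nval e s = nval e (view n r S T)" "nval e s \<le> max 64 (max l q)"
    "max 64 (max l q) \<le> W \<Longrightarrow> nfits W e s"
  using assms represents_nreg[OF assms(2)] regv_le(1)[OF assms(3)]
  by (cases e; fastforce simp: le_max_iff_disj)+

lemma room_le: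
  assumes "room W p l q t" "1 \<le> t"
  shows "max 64 (max l q) \<le> W" "64 + q + l \<le> W" "l + q + 64 \<le> grow l q t"
proof -
  have "l + t + 64 \<le> t * (l + t + 64)" using mult_le_mono1[OF assms(2), of "l + t + 64"] by (simp only: mult_1)
  then show "max 64 (max l q) \<le> W" "64 + q + l \<le> W" "l + q + 64 \<le> grow l q t"
    using assms unfolding room_def grow_def by linarith+
qed

lemma rexp_eval: "rreg s = rreg s' \<Longrightarrow> rval e s = rval e s'"
  by (induction e) auto

lemma tame_eval:
  assumes "tame e" "represents p n r S T s" "bounded n S T l q" "room W p l q t" "1 \<le> t"
  shows "nfits W e s \<and> nval e s = nval e (view n r S T) \<and> nval e s \<le> grow l q t"
proof -
  note room = room_le[OF assms(4,5)] and at = atom_eval[OF _ assms(2,3)]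
    and reg = represents_nreg[OF assms(2)] and reg_le = regv_le[OF assms(3)]
  have le: "nval e s \<le> grow l q t" if "atom e" for e
    using at(2)[OF that] room(3) by linarith
  show ?thesis
  proof (cases e)
    case (NAdd e1 e2)
    then obtain x where x: "x < 20" "e1 = NReg x" "atom e2" "\<forall>x<20. e2 \<noteq> NReg x"
      using assms(1) by auto
    have "nval e2 s \<le> max 64 l"
    proof (cases e2)
      case (NReg y)
      then have "y < 32" "\<not> y < 20" using x by auto
      then show ?thesis using NReg reg[of y] reg_le(3)[of y] by simp
    qed (use x in auto)
    moreover have "nval e1 s \<le> q" using x reg[of x] reg_le(2)[of x] by simp
    ultimately show ?thesis using NAdd x room at(1,3)[of e2] reg[of x] by auto
  next
    case (NDiv e1 e2)
    have "nval e1 s div nval e2 s \<le> nval e1 s" by (rule div_le_dividend)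
    also have "\<dots> \<le> grow l q t" using NDiv assms(1) by (intro le) simp
    finally show ?thesis using NDiv assms(1) room at[of e1] at[of e2] by auto
  next
    case (NSub e1 e2)
    have "nval e1 s - nval e2 s \<le> nval e1 s" by (rule diff_le_self)
    also have "\<dots> \<le> grow l q t" using NSub assms(1) by (intro le) simp
    finally show ?thesis using NSub assms(1) room at[of e1] at[of e2] by auto
  qed (use assms(1) room at[of e] at le[of e] in auto)
qed

lemma guard_eval:
  assumes "guard b" "represents p n r S T s" "bounded n S T l q" "room W p l q t" "1 \<le> t"
  shows "bval b s = bval b (view n r S T)" "bfits W b s"
proof -
  note at = atom_eval[OF _ assms(2,3)]
  have r: "rreg s = rreg (view n r S T)" using assms(2) by (simp add: represents_def)
  show "bval b s = bval b (view n r S T)"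
    using assms(1) by (induction b) (auto simp: at(1) rexp_eval[OF r])
  show "bfits W b s"
    using assms(1) by (induction b) (auto intro: at(3)[OF _ room_le(1)[OF assms(4,5)]])
qed

lemma runs_NAssign:
  assumes "x < 20" "ncost e < 19" "1 \<le> t"
    and e: "\<And>W p s l q. represents p n r S T s \<Longrightarrow> bounded n S T l q \<Longrightarrow> room W p l q t \<Longrightarrow>
      nfits W e s \<and> nval e s = v \<and> v \<le> grow l q t"
  shows "runs (NAssign x e) n r S T t (n(x := v)) r S T"
  unfolding runs_def
proof (intro allI impI, elim conjE)
  fix W p s l q
  assume a: "represents p n r S T s" "bounded n S T l q" "room W p l q t"
  note e = e[OF a]
  let ?s = "s\<lparr>nreg := (nreg s)(x := nval e s)\<rparr>"
  have "exec W (NAssign x e) s (1 + ncost e) [] ?s" using e by (intro exec.NAssign) simp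
  moreover have "represents p (n(x := v)) r S T ?s"
    using a(1) e assms(1) unfolding represents_def layout_def by auto
  moreover have "bounded (n(x := v)) S T (l + t) (grow l q t)"
  proof -
    have "bounded n S T (l + t) (grow l q t)"
      using a(2) by (rule bounded_mono) (auto simp: grow_def)
    then show ?thesis using e unfolding bounded_def by simp
  qed
  ultimately show "serves W (NAssign x e) p s l q S T t (n(x := v)) r S T"
    unfolding serves_def
    using assms(2,3) fingers.nil[of 12 "pos p S T"] by fastforce
qed

lemma wp_NAssign:
  assumes "x < 20" "tame e" "Q 1 (n(x := nval e (view n r S T))) r S T"
  shows "wp (NAssign x e) Q n r S T"
proof -
  have "ncost e < 19"
  proof -
    have "ncost f = 1" if "atom f" for f using that by (cases f) auto
    then show ?thesis using assms(2) by (cases e) auto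
  qed
  then have "runs (NAssign x e) n r S T 1 (n(x := nval e (view n r S T))) r S T"
    by (intro runs_NAssign) (use assms tame_eval[OF assms(2)] in \<open>fastforce+\<close>)
  with assms(3) show ?thesis unfolding wp_def by blast
qed

definition double :: "nat \<Rightarrow> com" where
  "double x = NAssign x (NAdd (NReg x) (NReg x))"

text \<open>Charging \<open>n x\<close> steps for a doubling keeps the growth of the naturals in check.\<close>

lemma wp_double:
  assumes "x < 20" "Q (1 + n x) (n(x := 2 * n x)) r S T"
  shows "wp (double x) Q n r S T"
proof -
  have "runs (double x) n r S T (1 + n x) (n(x := 2 * n x)) r S T"
    unfolding double_def
  proof (intro runs_NAssign)
    fix W p s l q
    assume a: "represents p n r S T s" "bounded n S T l q" "room W p l q (1 + n x)"
    have "n x \<le> (1 + n x) * (l + (1 + n x) + 64)" by simp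
    moreover have "nreg s x = n x" "n x \<le> q" using a assms(1) by (auto simp: represents_def bounded_def)
    ultimately show "nfits W (NAdd (NReg x) (NReg x)) s \<and>
        nval (NAdd (NReg x) (NReg x)) s = 2 * n x \<and> 2 * n x \<le> grow l q (1 + n x)"
      using a(3) unfolding room_def grow_def by auto
  qed (use assms in auto)
  with assms show ?thesis unfolding wp_def by blast
qed

lemma wp_RAssign:
  assumes "rcost e < 19" "Q 1 n (r(x := rval e (view n r S T))) S T"
  shows "wp (RAssign x e) Q n r S T"
proof -
  have "runs (RAssign x e) n r S T 1 n (r(x := rval e (view n r S T))) S T"
    unfolding runs_def
  proof (intro allI impI, elim conjE)
    fix W p s l q
    assume a: "represents p n r S T s" "bounded n S T l q" "room W p l q 1"
    let ?s = "s\<lparr>rreg := (rreg s)(x := rval e s)\<rparr>"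
    have "exec W (RAssign x e) s (1 + rcost e) [] ?s" by (rule exec.RAssign)
    moreover have "rval e s = rval e (view n r S T)"
      using a(1) by (intro rexp_eval) (simp add: represents_def)
    then have "represents p n (r(x := rval e (view n r S T))) S T ?s"
      using a(1) unfolding represents_def layout_def by auto
    moreover have "bounded n S T (l + 1) (grow l q 1)"
      using a(2) by (rule bounded_mono) (auto simp: grow_def)
    ultimately show "serves W (RAssign x e) p s l q S T 1 n (r(x := rval e (view n r S T))) S T"
      unfolding serves_def
      using assms(1) fingers.nil[of 12 "pos p S T"] by fastforce
  qed
  with assms show ?thesis unfolding wp_def by blast
qed

lemma runs_Cond:
  assumes "guard b" "bcost b < 19"
    "runs (if bval b (view n r S T) then c else d) n r S T t n' r' S' T'"
  shows "runs (Cond b c d) n r S T (t + 1) n' r' S' T'"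
  unfolding runs_def
proof (intro allI impI, elim conjE)
  fix W p s l q
  assume a: "represents p n r S T s" "bounded n S T l q" "room W p l q (t + 1)"
  let ?c = "if bval b (view n r S T) then c else d"
  from assms(3) a room_split(1)[OF a(3)] obtain u tr s' d' where
    1: "exec W ?c s u tr s'" "u < 20 * t" "represents p n' r' S' T' s'"
    "bounded n' S' T' (l + t) (grow l q t)"
    "fingers 12 tr (pos p S T) (pos p S' T') d'" "d' \<le> 20 * t"
    unfolding runs_def serves_def by blast
  have "exec W (Cond b c d) s (1 + bcost b + u) tr s'"
    using guard_eval[OF assms(1) a(1,2,3)] 1(1)
    by (cases "bval b s") (auto intro: exec.CondTrue[simplified] exec.CondFalse[simplified])
  moreover have "bounded n' S' T' (l + (t + 1)) (grow l q (t + 1))"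
    using 1(4) by (rule bounded_mono) (auto intro: grow_mono)
  ultimately show "serves W (Cond b c d) p s l q S T (t + 1) n' r' S' T'"
    unfolding serves_def
    using 1 assms(2) by (intro exI[of _ "1 + bcost b + u"] exI[of _ tr] exI[of _ s'] exI[of _ d']) auto
qed

lemma wp_Cond:
  assumes "guard b" "bcost b < 19"
    "bval b (view n r S T) \<Longrightarrow> wp c (\<lambda>t. Q (t + 1)) n r S T"
    "\<not> bval b (view n r S T) \<Longrightarrow> wp d (\<lambda>t. Q (t + 1)) n r S T"
  shows "wp (Cond b c d) Q n r S T"
proof -
  have "wp (if bval b (view n r S T) then c else d) (\<lambda>t. Q (t + 1)) n r S T" using assms by auto
  then obtain t n' r' S' T' where
    "runs (if bval b (view n r S T) then c else d) n r S T t n' r' S' T'" "Q (t + 1) n' r' S' T'"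
    unfolding wp_def by blast
  then show ?thesis using runs_Cond[OF assms(1,2)] unfolding wp_def by blast
qed

lemma runs_While_False:
  assumes "guard b" "bcost b < 18" "\<not> bval b (view n r S T)"
  shows "runs (While b c) n r S T 1 n r S T"
  unfolding runs_def
proof (intro allI impI, elim conjE)
  fix W p s l q
  assume a: "represents p n r S T s" "bounded n S T l q" "room W p l q 1"
  have "exec W (While b c) s (1 + bcost b) [] s"
    using guard_eval[OF assms(1) a] assms(3) by (intro exec.WhileFalse) auto
  moreover have "bounded n S T (l + 1) (grow l q 1)"
    using a(2) by (rule bounded_mono) (auto simp: grow_def)
  ultimately show "serves W (While b c) p s l q S T 1 n r S T"
    unfolding serves_def
    using a(1) assms(2) fingers.nil[of 12 "pos p S T"] by fastforce
qed

lemma runs_While_True: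
  assumes "guard b" "bcost b < 18" "bval b (view n r S T)"
    "runs (Seq c (While b c)) n r S T t n' r' S' T'"
  shows "runs (While b c) n r S T (t + 1) n' r' S' T'"
  unfolding runs_def
proof (intro allI impI, elim conjE)
  fix W p s l q
  assume a: "represents p n r S T s" "bounded n S T l q" "room W p l q (t + 1)"
  from assms(4) a room_split(1)[OF a(3)] obtain u tr s' d where
    1: "exec W (Seq c (While b c)) s u tr s'" "u < 20 * t" "represents p n' r' S' T' s'"
    "bounded n' S' T' (l + t) (grow l q t)"
    "fingers 12 tr (pos p S T) (pos p S' T') d" "d \<le> 20 * t"
    unfolding runs_def serves_def by blast
  from 1(1) obtain u1 tr1 s1 u2 tr2 where
    2: "exec W c s u1 tr1 s1" "exec W (While b c) s1 u2 tr2 s'" "u = Suc (u1 + u2)" "tr = tr1 @ tr2"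
    by (rule exec_elims) (auto intro: that)
  have "exec W (While b c) s (1 + bcost b + u1 + u2) tr s'"
    using guard_eval[OF assms(1) a] 2 assms(3) by (auto intro: exec.WhileTrue[simplified])
  moreover have "bounded n' S' T' (l + (t + 1)) (grow l q (t + 1))"
    using 1(4) by (rule bounded_mono) (auto intro: grow_mono)
  ultimately show "serves W (While b c) p s l q S T (t + 1) n' r' S' T'"
    unfolding serves_def
    using 1 2(3) assms(2)
    by (intro exI[of _ "1 + bcost b + u1 + u2"] exI[of _ tr] exI[of _ s'] exI[of _ d]) auto
qed

text \<open>The rule merely unrolls one iteration. Instead of invariants, each loop gets an
  induction over the list or number that it consumes, with the postcondition generalised.\<close>

lemma wp_While:
  assumes "guard b" "bcost b < 18"
    "bval b (view n r S T) \<Longrightarrow>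
      wp c (\<lambda>t. wp (While b c) (\<lambda>t'. Q (t + t' + 1))) n r S T"
    "\<not> bval b (view n r S T) \<Longrightarrow> Q 1 n r S T"
  shows "wp (While b c) Q n r S T"
proof (cases "bval b (view n r S T)")
  case True
  then have "wp (Seq c (While b c)) (\<lambda>t. Q (t + 1)) n r S T" using assms(3) by (intro wp_Seq) simp
  then obtain t n' r' S' T' where
    "runs (Seq c (While b c)) n r S T t n' r' S' T'" "Q (t + 1) n' r' S' T'"
    unfolding wp_def by blast
  then show ?thesis using runs_While_True[OF assms(1,2) True] unfolding wp_def by blast
next
  case False
  then show ?thesis using assms(4) runs_While_False[OF assms(1,2) False] unfolding wp_def by blast
qed

subsection \<open>Pushing and popping\<close>

text \<open>This contains the only product that programs compute; the first part of
  \<open>room\<close> keeps it within a word.\<close>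

definition slot_exp :: "nat \<Rightarrow> nexp" where
  "slot_exp j = (if j = 0 then NAdd (NReg 32) (NReg 20) else if j = 1 then NAdd (NReg 33) (NReg 21)
    else NAdd (NReg 34) (NAdd (NMul (NConst 12) (NReg (20 + j))) (NConst j)))"

definition rpush :: "nat \<Rightarrow> nat \<Rightarrow> com" where
  "rpush j x = Seq (RStore (slot_exp j) (RReg x)) (NAssign (20 + j) (NAdd (NReg (20 + j)) (NConst 1)))"

definition rpop :: "nat \<Rightarrow> nat \<Rightarrow> com" where
  "rpop j x = Seq (NAssign (20 + j) (NSub (NReg (20 + j)) (NConst 1))) (RLoad x (slot_exp j))"

definition npush :: "nat \<Rightarrow> nat \<Rightarrow> com" where
  "npush j x = Seq (NStore (slot_exp j) (NReg x)) (NAssign (20 + j) (NAdd (NReg (20 + j)) (NConst 1)))"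

definition npop :: "nat \<Rightarrow> nat \<Rightarrow> com" where
  "npop j x = Seq (NAssign (20 + j) (NSub (NReg (20 + j)) (NConst 1))) (NLoad x (slot_exp j))"

lemma slot_exp:
  assumes "layout p w s" "j < 12" "length (w j) \<le> h" "snd (snd p) + 12 * h + 12 \<le> W"
  shows "nval (slot_exp j) s = slot p j (length (w j))" "nfits W (slot_exp j) s"
    "nfits W (NAdd (NReg (20 + j)) (NConst 1)) s" "nfits W (NSub (NReg (20 + j)) (NConst 1)) s"
proof -
  obtain pX pY b where p: "p = (pX, pY, b)" by (cases p)
  have "nreg s 32 = pX" "nreg s 33 = pY" "nreg s 34 = b" "nreg s (20 + j) = length (w j)"
    "pX + length (w 0) \<le> b" "pY + length (w 1) \<le> b"
    and "\<And>j. j < 12 \<Longrightarrow> nreg s (20 + j) = length (w j)"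
    using assms(1,2) p unfolding layout_def by auto
  from this(7)[of 0] this(7)[of 1] this(1-6)
  have r: "nreg s 32 = pX" "nreg s 33 = pY" "nreg s 34 = b" "nreg s (20 + j) = length (w j)"
    "pX + length (w 0) \<le> b" "pY + length (w 1) \<le> b"
    "nreg s 20 = length (w 0)" "nreg s 21 = length (w 1)" by auto
  then show "nval (slot_exp j) s = slot p j (length (w j))"
    by (auto simp: slot_exp_def slot_def p)
  show "nfits W (slot_exp j) s" "nfits W (NAdd (NReg (20 + j)) (NConst 1)) s"
    "nfits W (NSub (NReg (20 + j)) (NConst 1)) s"
    using r assms(2-4) p by (auto simp: slot_exp_def)
qed

text \<open>The inputs end below the base, and above it the residue modulo 12 identifies the stack;
  with stride 12 instead of 10 that residue offset is simply \<open>j\<close>. Stacks 0 and 1 are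
  never pushed to, hence \<open>2 \<le> j\<close>, and so the two input arrays may even
  overlap.\<close>

lemma slot_inj:
  assumes "layout p w s" "2 \<le> j" "j < 12" "j' < 12" "slot p j i = slot p j' i'" "i' < length (w j')"
  shows "j = j' \<and> i = i'"
proof -
  obtain pX pY b where p: "p = (pX, pY, b)" by (cases p)
  have le: "pX + length (w 0) \<le> b" "pY + length (w 1) \<le> b"
    using assms(1) p unfolding layout_def by auto
  show ?thesis
  proof (cases "j' < 2")
    case True
    then have "j' = 0 \<or> j' = 1" by auto
    then show ?thesis using assms le p unfolding slot_def by auto
  next
    case False
    then have e: "12 * i + j = 12 * i' + j'" using assms p unfolding slot_def by auto
    then have "(12 * i + j) mod 12 = (12 * i' + j') mod 12" by simp
    then have "j = j'" using assms(3,4) by simp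
    then show ?thesis using e by simp
  qed
qed

lemma layout_push:
  assumes "layout p w s" "2 \<le> j" "j < 12"
    "s' = s\<lparr>mem := (mem s)(slot p j (length (w j)) := v), nreg := (nreg s)(20 + j := Suc (length (w j)))\<rparr>"
  shows "layout p (w(j := v # w j)) s'"
proof -
  obtain pX pY b where p: "p = (pX, pY, b)" by (cases p)
  have "mem s' (slot p j' i) = rev ((w(j := v # w j)) j') ! i"
    if ji: "j' < 12" "i < length ((w(j := v # w j)) j')" for j' i
  proof (cases "j' = j \<and> i = length (w j)")
    case True
    then show ?thesis using assms(4) by (simp add: nth_append)
  next
    case False
    then have i: "i < length (w j')" using ji by (cases "j' = j") auto
    then have "slot p j (length (w j)) \<noteq> slot p j' i"
      using slot_inj[OF assms(1-3) ji(1) _ i] False by metis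
    then have "mem s' (slot p j' i) = rev (w j') ! i"
      using assms(1,4) ji(1) i unfolding layout_def by auto
    then show ?thesis using i by (auto simp: nth_append)
  qed
  then show ?thesis using assms(1-4) p unfolding layout_def by auto
qed

lemma layout_pop:
  assumes "layout p w s" "j < 12" "w j = v # vs" "s' = s\<lparr>nreg := (nreg s)(20 + j := length vs)\<rparr>"
  shows "layout p (w(j := vs)) s'" "mem s' (slot p j (length vs)) = v"
proof -
  obtain pX pY b where p: "p = (pX, pY, b)" by (cases p)
  have "mem s' (slot p j' i) = rev ((w(j := vs)) j') ! i"
    if ji: "j' < 12" "i < length ((w(j := vs)) j')" for j' i
  proof -
    have "i < length (w j')" using ji assms(3) by (cases "j' = j") auto
    then have "mem s' (slot p j' i) = rev (w j') ! i"
      using assms(1,4) ji(1) unfolding layout_def by auto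
    then show ?thesis using ji assms(3) by (auto simp: nth_append)
  qed
  then show "layout p (w(j := vs)) s'" using assms p unfolding layout_def by auto
  have "mem s (slot p j (length vs)) = rev (w j) ! length vs"
    using assms(1-3) unfolding layout_def by auto
  then show "mem s' (slot p j (length vs)) = v" using assms(3,4) by (simp add: nth_append)
qed

lemma contents_update:
  "j < 10 \<Longrightarrow> contents (S(j := xs)) T = (contents S T)(j := map RealW xs)"
  "10 \<le> j \<Longrightarrow> contents S (T(j := ms)) = (contents S T)(j := map NatW ms)"
  by (auto simp: contents_def fun_eq_iff)

text \<open>A finger rests on the first free slot of its stack. Hence a push accesses and then
  moves, while a pop moves and then accesses.\<close>

lemma fingers_push:
  assumes "j < 12" "contents S' T' = (contents S T)(j := v # contents S T j)" "adr c = pos p S T j"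
  shows "\<exists>d \<le> 20. fingers 12 [c] (pos p S T) (pos p S' T') d"
proof -
  let ?a = "pos p S' T' j"
  have "pos p S' T' = (pos p S T)(j := ?a)" using assms(2) by (auto simp: pos_def)
  then have "fingers 12 [c] (pos p S T) (pos p S' T') (nat \<bar>int ?a - int (pos p S T j)\<bar> + 0)"
    using assms(1,3) by (metis fingers.nil fingers.move fingers.access)
  moreover have "nat \<bar>int ?a - int (pos p S T j)\<bar> + 0 \<le> 20"
    using assms(2) by (auto simp: pos_def slot_def split: prod.splits)
  ultimately show ?thesis by blast
qed

lemma fingers_pop:
  assumes "j < 12" "contents S T = (contents S' T')(j := v # contents S' T' j)" "adr c = pos p S' T' j"
  shows "\<exists>d \<le> 20. fingers 12 [c] (pos p S T) (pos p S' T') d"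
proof -
  let ?a = "pos p S' T' j"
  have g: "pos p S' T' = (pos p S T)(j := ?a)" using assms(2) by (auto simp: pos_def)
  have "fingers 12 [c] ((pos p S T)(j := ?a)) (pos p S' T') 0"
    unfolding g[symmetric] using assms(1,3) by (intro fingers.access fingers.nil) auto
  then have "fingers 12 [c] (pos p S T) (pos p S' T') (nat \<bar>int ?a - int (pos p S T j)\<bar> + 0)"
    using assms(1) by (intro fingers.move)
  moreover have "nat \<bar>int ?a - int (pos p S T j)\<bar> + 0 \<le> 20"
    using assms(2) by (auto simp: pos_def slot_def split: prod.splits)
  ultimately show ?thesis by blast
qed

lemma bounded_contents:
  assumes "bounded n S T l q" "j < 12" "length xs \<le> Suc (length (contents S T j))" "1 \<le> t"
    "contents S' T' = (contents S T)(j := xs)" "\<And>x. x < 20 \<Longrightarrow> n' x \<le> q"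
    "\<And>i v. i < 12 \<Longrightarrow> v \<in> set (T' i) \<Longrightarrow> v \<le> q"
  shows "bounded n' S' T' (l + t) (grow l q t)"
proof -
  have le: "length (contents S T i) \<le> l" if "i < 12" for i
    using assms(1) that by (simp add: bounded_def)
  have "length (contents S' T' i) \<le> l + t" if "i < 12" for i
    using le[OF that] assms(3,4) unfolding assms(5) by (cases "i = j") auto
  moreover have "q \<le> grow l q t" by (simp add: grow_def)
  then have "n' x \<le> grow l q t" if "x < 20" for x using assms(6)[OF that] by linarith
  moreover have "v \<le> grow l q t" if "i < 12" "v \<in> set (T' i)" for i v
    using assms(7)[OF that] \<open>q \<le> grow l q t\<close> by linarith
  ultimately show ?thesis unfolding bounded_def by blast
qed

lemma ncost_slot_exp: "ncost (slot_exp j) \<le> 7"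
  by (simp add: slot_exp_def)

lemma runs_push:
  assumes j: "2 \<le> j" "j < 12" and c: "contents S' T' = (contents S T)(j := v # contents S T j)"
    and store: "\<And>W p s l q. represents p n r S T s \<Longrightarrow> bounded n S T l q \<Longrightarrow> room W p l q 1 \<Longrightarrow>
      nfits W (slot_exp j) s \<Longrightarrow> exec W st s (1 + ncost (slot_exp j) + 1) [Wr (nval (slot_exp j) s)]
        (s\<lparr>mem := (mem s)(nval (slot_exp j) s := v)\<rparr>)"
    and T': "\<And>l q i w. bounded n S T l q \<Longrightarrow> i < 12 \<Longrightarrow> w \<in> set (T' i) \<Longrightarrow> w \<le> q"
  shows "runs (Seq st (NAssign (20 + j) (NAdd (NReg (20 + j)) (NConst 1)))) n r S T 1 n r S' T'"
  unfolding runs_def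
proof (intro allI impI, elim conjE)
  fix W p s l q
  assume a: "represents p n r S T s" "bounded n S T l q" "room W p l q 1"
  have lay: "layout p (contents S T) s" and r: "rreg s = r" and n: "\<forall>x<20. nreg s x = n x"
    using a(1) by (auto simp: represents_def)
  have len: "length (contents S T j) \<le> l" using a(2) j by (auto simp: bounded_def)
  have sl: "nval (slot_exp j) s = pos p S T j" "nfits W (slot_exp j) s"
    "nfits W (NAdd (NReg (20 + j)) (NConst 1)) s"
    using slot_exp[OF lay, of j l W] len j a(3) by (auto simp: room_def pos_def)
  let ?inc = "NAssign (20 + j) (NAdd (NReg (20 + j)) (NConst 1))"
  let ?s1 = "s\<lparr>mem := (mem s)(pos p S T j := v)\<rparr>"
  let ?s2 = "?s1\<lparr>nreg := (nreg ?s1)(20 + j := nval (NAdd (NReg (20 + j)) (NConst 1)) ?s1)\<rparr>"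
  have "exec W ?inc ?s1 (1 + (1 + 1 + 1)) [] ?s2"
    using exec.NAssign[of W "NAdd (NReg (20 + j)) (NConst 1)" ?s1 "20 + j"] sl(3) by simp
  with store[OF a sl(2)] have ex: "exec W (Seq st ?inc) s
      (1 + (1 + ncost (slot_exp j) + 1) + (1 + (1 + 1 + 1))) ([Wr (pos p S T j)] @ []) ?s2"
    unfolding sl(1) by (rule exec.Seq)
  have "nreg s (20 + j) = length (contents S T j)" using lay j by (auto simp: layout_def)
  then have "layout p (contents S' T') ?s2"
    unfolding c using j by (intro layout_push[OF lay]) (auto simp: pos_def)
  then have "represents p n r S' T' ?s2" using r n by (auto simp: represents_def)
  moreover have "bounded n S' T' (l + 1) (grow l q 1)"
    using a(2) j T'[OF a(2)] by (intro bounded_contents[OF a(2) _ _ _ c]) (auto simp: bounded_def)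
  moreover obtain d where "d \<le> 20" "fingers 12 [Wr (pos p S T j)] (pos p S T) (pos p S' T') d"
    using fingers_push[OF _ c, of "Wr (pos p S T j)" p] j by auto
  ultimately show "serves W (Seq st ?inc) p s l q S T 1 n r S' T'"
    unfolding serves_def using ex ncost_slot_exp[of j]
    by (intro exI[of _ "1 + (1 + ncost (slot_exp j) + 1) + (1 + (1 + 1 + 1))"] exI[of _ "[Wr (pos p S T j)]"]
      exI[of _ ?s2] exI[of _ d]) auto
qed

lemma wp_rpush:
  assumes "2 \<le> j" "j < 10" "Q 1 n r (S(j := r x # S j)) T"
  shows "wp (rpush j x) Q n r S T"
proof -
  have "runs (rpush j x) n r S T 1 n r (S(j := r x # S j)) T"
    unfolding rpush_def
  proof (rule runs_push)
    show "contents (S(j := r x # S j)) T = (contents S T)(j := RealW (r x) # contents S T j)"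
      using assms(2) by (subst contents_update) (auto simp: contents_def)
    fix W p s l q assume "represents p n r S T s" "nfits W (slot_exp j) s"
    then show "exec W (RStore (slot_exp j) (RReg x)) s (1 + ncost (slot_exp j) + 1) [Wr (nval (slot_exp j) s)]
        (s\<lparr>mem := (mem s)(nval (slot_exp j) s := RealW (r x))\<rparr>)"
      using exec.RStore[of W "slot_exp j" s "RReg x"] by (simp add: represents_def)
  qed (use assms in \<open>auto simp: bounded_def\<close>)
  with assms(3) show ?thesis unfolding wp_def by blast
qed

lemma wp_npush:
  assumes "10 \<le> j" "j < 12" "x < 20" "Q 1 n r S (T(j := n x # T j))"
  shows "wp (npush j x) Q n r S T"
proof -
  have "runs (npush j x) n r S T 1 n r S (T(j := n x # T j))"
    unfolding npush_def
  proof (rule runs_push)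
    show "contents S (T(j := n x # T j)) = (contents S T)(j := NatW (n x) # contents S T j)"
      using assms(1) by (subst contents_update) (auto simp: contents_def)
    fix W p s l q
    assume a: "represents p n r S T s" "bounded n S T l q" "room W p l q 1" "nfits W (slot_exp j) s"
    have "nreg s x = n x" "n x \<le> q" using a assms(3) by (auto simp: represents_def bounded_def)
    then have "nval (NReg x) s = n x" "nfits W (NReg x) s" using room_le(2)[OF a(3)] by auto
    then show "exec W (NStore (slot_exp j) (NReg x)) s (1 + ncost (slot_exp j) + 1) [Wr (nval (slot_exp j) s)]
        (s\<lparr>mem := (mem s)(nval (slot_exp j) s := NatW (n x))\<rparr>)"
      using exec.NStore[OF a(4), of "NReg x"] by simp
  qed (use assms in \<open>auto simp: bounded_def split: if_splits\<close>)
  with assms(4) show ?thesis unfolding wp_def by blast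
qed

lemma runs_pop:
  assumes j: "j < 12" and cj: "contents S T j = v # vs" and c: "contents S' T' = (contents S T)(j := vs)"
    and load: "\<And>W s. nfits W (slot_exp j) s \<Longrightarrow> mem s (nval (slot_exp j) s) = v \<Longrightarrow>
      exec W ld s (1 + ncost (slot_exp j)) [Rd (nval (slot_exp j) s)] (f s)"
    and f: "\<And>p s. represents p n r S' T' s \<Longrightarrow> represents p n' r' S' T' (f s)"
    and q: "\<And>l q. bounded n S T l q \<Longrightarrow> (\<forall>x<20. n' x \<le> q) \<and> (\<forall>i<12. \<forall>w\<in>set (T' i). w \<le> q)"
  shows "runs (Seq (NAssign (20 + j) (NSub (NReg (20 + j)) (NConst 1))) ld) n r S T 1 n' r' S' T'"
  unfolding runs_def
proof (intro allI impI, elim conjE)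
  fix W p s l q
  assume a: "represents p n r S T s" "bounded n S T l q" "room W p l q 1"
  have lay: "layout p (contents S T) s" and r: "rreg s = r" and n: "\<forall>x<20. nreg s x = n x"
    using a(1) by (auto simp: represents_def)
  have len: "length (contents S T j) \<le> l" using a(2) j by (auto simp: bounded_def)
  have c': "contents S T = (contents S' T')(j := v # contents S' T' j)" by (simp add: c cj[symmetric])
  have nr: "nreg s (20 + j) = length (contents S T j)" using lay j by (auto simp: layout_def)
  let ?dec = "NAssign (20 + j) (NSub (NReg (20 + j)) (NConst 1))"
  let ?s = "s\<lparr>nreg := (nreg s)(20 + j := length vs)\<rparr>"
  have lay': "layout p (contents S' T') ?s" "mem ?s (pos p S' T' j) = v"
    using layout_pop[OF lay _ cj, of ?s] j by (auto simp: pos_def c)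
  have sl: "nval (slot_exp j) ?s = pos p S' T' j" "nfits W (slot_exp j) ?s"
    using slot_exp[OF lay'(1), of j l W] len cj j a(3) by (auto simp: room_def pos_def c)
  have "nfits W (NSub (NReg (20 + j)) (NConst 1)) s"
    using slot_exp[OF lay, of j l W] len j a(3) by (auto simp: room_def)
  then have "exec W ?dec s (1 + (1 + 1 + 1)) [] ?s"
    using exec.NAssign[of W "NSub (NReg (20 + j)) (NConst 1)" s "20 + j"] nr cj by simp
  moreover have "exec W ld ?s (1 + ncost (slot_exp j)) [Rd (pos p S' T' j)] (f ?s)"
    using load[OF sl(2)] lay'(2) unfolding sl(1) by simp
  ultimately have ex: "exec W (Seq ?dec ld) s (1 + (1 + (1 + 1 + 1)) + (1 + ncost (slot_exp j)))
      ([] @ [Rd (pos p S' T' j)]) (f ?s)"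
    by (rule exec.Seq)
  have "represents p n r S' T' ?s" using lay'(1) r n by (auto simp: represents_def)
  then have "represents p n' r' S' T' (f ?s)" by (rule f)
  moreover have "bounded n' S' T' (l + 1) (grow l q 1)"
    using j cj q[OF a(2)] by (intro bounded_contents[OF a(2) _ _ _ c]) auto
  moreover obtain d where "d \<le> 20" "fingers 12 [Rd (pos p S' T' j)] (pos p S T) (pos p S' T') d"
    using fingers_pop[OF _ c', of "Rd (pos p S' T' j)" p] j by auto
  ultimately show "serves W (Seq ?dec ld) p s l q S T 1 n' r' S' T'"
    unfolding serves_def using ex ncost_slot_exp[of j]
    by (intro exI[of _ "1 + (1 + (1 + 1 + 1)) + (1 + ncost (slot_exp j))"] exI[of _ "[Rd (pos p S' T' j)]"]
      exI[of _ "f ?s"] exI[of _ d]) auto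
qed

lemma wp_rpop:
  assumes "j < 10" "S j \<noteq> []" "Q 1 n (r(x := hd (S j))) (S(j := tl (S j))) T"
  shows "wp (rpop j x) Q n r S T"
proof -
  have "runs (rpop j x) n r S T 1 n (r(x := hd (S j))) (S(j := tl (S j))) T"
    unfolding rpop_def
  proof (rule runs_pop)
    show "contents S T j = RealW (hd (S j)) # map RealW (tl (S j))"
      using assms(1,2) by (cases "S j") (auto simp: contents_def)
    show "contents (S(j := tl (S j))) T = (contents S T)(j := map RealW (tl (S j)))"
      using assms(1) by (rule contents_update)
    show "exec W (RLoad x (slot_exp j)) s (1 + ncost (slot_exp j)) [Rd (nval (slot_exp j) s)]
        (s\<lparr>rreg := (rreg s)(x := hd (S j))\<rparr>)"
      if "nfits W (slot_exp j) s" "mem s (nval (slot_exp j) s) = RealW (hd (S j))" for W s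
      using that by (rule exec.RLoad)
  qed (use assms in \<open>auto simp: bounded_def represents_def layout_def\<close>)
  with assms(3) show ?thesis unfolding wp_def by blast
qed

lemma wp_npop:
  assumes "10 \<le> j" "j < 12" "x < 20" "T j \<noteq> []" "Q 1 (n(x := hd (T j))) r S (T(j := tl (T j)))"
  shows "wp (npop j x) Q n r S T"
proof -
  have "runs (npop j x) n r S T 1 (n(x := hd (T j))) r S (T(j := tl (T j)))"
    unfolding npop_def
  proof (rule runs_pop)
    show "contents S T j = NatW (hd (T j)) # map NatW (tl (T j))"
      using assms(1,4) by (cases "T j") (auto simp: contents_def)
    show "contents S (T(j := tl (T j))) = (contents S T)(j := map NatW (tl (T j)))"
      using assms(1) by (rule contents_update)
    show "exec W (NLoad x (slot_exp j)) s (1 + ncost (slot_exp j)) [Rd (nval (slot_exp j) s)]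
        (s\<lparr>nreg := (nreg s)(x := hd (T j))\<rparr>)"
      if "nfits W (slot_exp j) s" "mem s (nval (slot_exp j) s) = NatW (hd (T j))" for W s
      using that by (rule exec.NLoad)
    fix l q assume b: "bounded n S T l q"
    have "w \<le> q" if "i < 12" "w \<in> set (T i)" for i w using b that by (auto simp: bounded_def)
    then show "(\<forall>y<20. (n(x := hd (T j))) y \<le> q) \<and> (\<forall>i<12. \<forall>w\<in>set ((T(j := tl (T j))) i). w \<le> q)"
      using b assms(2,4) hd_in_set[OF assms(4)] by (auto simp: bounded_def dest: list.set_sel(2)[rotated])
  qed (use assms in \<open>auto simp: represents_def layout_def\<close>)
  with assms(5) show ?thesis unfolding wp_def by blast
qed

section \<open>Moving the contents of stacks\<close>

abbreviation seq (infixr \<open>;;\<close> 60) where "c ;; d \<equiv> Seq c d"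
abbreviation height :: "nat \<Rightarrow> nexp" where "height j \<equiv> NReg (20 + j)"
abbreviation nonempty :: "nat \<Rightarrow> bexp" where "nonempty j \<equiv> NLess (NConst 0) (height j)"
abbreviation decr :: "nat \<Rightarrow> com" where "decr x \<equiv> NAssign x (NSub (NReg x) (NConst 1))"

abbreviation agree :: "nat \<Rightarrow> (nat \<Rightarrow> 'a) \<Rightarrow> (nat \<Rightarrow> 'a) \<Rightarrow> bool" where
  "agree k f g \<equiv> \<forall>x<k. f x = g x"

lemmas wp_intros = wp_Seq wp_NAssign wp_RAssign wp_rpush wp_rpop wp_npush wp_npop wp_Skip wp_double wp_Cond

lemmas eval_simps = regv_def contents_def

definition move_all :: "nat \<Rightarrow> nat \<Rightarrow> nat \<Rightarrow> com" where
  "move_all i j x = While (nonempty i) (rpop i x ;; rpush j x)"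

text \<open>The last element moved stays in register \<open>x\<close>; later this is how the ends of
  the input arrays are read. An empty stack leaves \<open>x\<close> unchanged, which is why it is a
  case of its own.\<close>

lemma wp_move_all:
  assumes "i < 10" "2 \<le> j" "j < 10" "i \<noteq> j"
    and "\<And>t v. t \<le> 3 * length (S i) + 1 \<Longrightarrow> S i \<noteq> [] \<Longrightarrow> v = last (S i) \<Longrightarrow>
      Q t n (r(x := v)) (S(i := [], j := rev (S i) @ S j)) T"
    and "S i = [] \<Longrightarrow> Q 1 n r S T"
  shows "wp (move_all i j x) Q n r S T"
  using assms(5,6)
proof (induction "S i" arbitrary: S r Q)
  case Nil
  then show ?case unfolding move_all_def using assms(1)
    by (intro wp_While) (auto simp: eval_simps)
next
  case (Cons u us)
  let ?S = "S(i := us, j := u # S j)" and ?r = "r(x := u)"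
  have "wp (move_all i j x) (\<lambda>t. Q (Suc (Suc (Suc t)))) n ?r ?S T"
  proof (rule Cons.hyps(1))
    show "us = ?S i" using assms(4) by simp
    fix t v
    assume a: "t \<le> 3 * length (?S i) + 1" "?S i \<noteq> []" "v = last (?S i)"
    have eq: "?S(i := [], j := rev (?S i) @ ?S j) = S(i := [], j := rev (S i) @ S j)"
      using assms(4) Cons.hyps(2)[symmetric] by (auto simp: fun_eq_iff)
    have us: "us \<noteq> []" "t \<le> 3 * length us + 1" "v = last us" using a assms(4) by auto
    have "Q (Suc (Suc (Suc t))) n (r(x := v)) (S(i := [], j := rev (S i) @ S j)) T"
      using us Cons.hyps(2)[symmetric] by (intro Cons.prems(1)) auto
    then show "Q (Suc (Suc (Suc t))) n (?r(x := v)) (?S(i := [], j := rev (?S i) @ ?S j)) T"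
      unfolding eq by simp
  next
    assume "?S i = []"
    then have us: "us = []" using assms(4) by simp
    have eq: "?S = S(i := [], j := rev (S i) @ S j)"
      using us assms(4) Cons.hyps(2)[symmetric] by (auto simp: fun_eq_iff)
    show "Q (Suc (Suc (Suc 1))) n ?r ?S T"
      unfolding eq using us Cons.hyps(2)[symmetric] by (intro Cons.prems(1)) auto
  qed
  then show ?case
    unfolding move_all_def using assms(1-4) Cons.hyps(2)[symmetric]
    by - ((rule wp_While; (intro wp_intros)?), (auto simp: eval_simps fun_upd_twist add.commute))
qed

lemma wp_move_list:
  assumes "i < 10" "2 \<le> j" "j < 10" "i \<noteq> j" "S i = xs" "xs \<noteq> []"
    and "\<And>t. t \<le> 3 * length xs + 1 \<Longrightarrow> Q t n (r(x := last xs)) (S(i := [], j := rev xs @ S j)) T"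
  shows "wp (move_all i j x) Q n r S T"
  by (rule wp_move_all) (use assms in auto)

definition clear :: "nat \<Rightarrow> nat \<Rightarrow> com" where
  "clear i x = While (nonempty i) (rpop i x)"

lemma wp_clear:
  assumes "i < 10"
    and "\<And>t v. t \<le> 2 * length (S i) + 1 \<Longrightarrow> Q t n (r(x := v)) (S(i := [])) T"
  shows "wp (clear i x) Q n r S T"
  using assms(2)
proof (induction "S i" arbitrary: S r Q)
  case Nil
  have "S(i := []) = S" using Nil by (auto simp: fun_eq_iff)
  then have "Q 1 n r S T" using Nil(2)[of 1 "r x"] by simp
  with Nil show ?case unfolding clear_def using assms(1)
    by (intro wp_While) (auto simp: eval_simps)
next
  case (Cons u us)
  have "wp (clear i x) (\<lambda>t. Q (t + 2)) n (r(x := u)) (S(i := us)) T"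
  proof (rule Cons.hyps(1))
    fix t v assume "t \<le> 2 * length ((S(i := us)) i) + 1"
    then show "Q (t + 2) n (r(x := u, x := v)) (S(i := us, i := [])) T"
      using Cons.prems[of "t + 2" v] Cons.hyps(2)[symmetric] by simp
  qed simp
  then show ?case
    unfolding clear_def using assms(1) Cons.hyps(2)[symmetric]
    by - ((rule wp_While; (intro wp_intros)?), (auto simp: eval_simps))
qed

text \<open>Register 13 is the counter of the loops below.\<close>

definition move_some :: "nat \<Rightarrow> nat \<Rightarrow> nat \<Rightarrow> com" where
  "move_some i j x = While (NLess (NConst 0) (NReg 13)) (rpop i x ;; rpush j x ;; decr 13)"

lemma wp_move_some:
  assumes "i < 10" "2 \<le> j" "j < 10" "i \<noteq> j" "S i = xs @ ys" "n 13 = length xs"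
    and "\<And>t v. t \<le> 4 * length xs + 1 \<Longrightarrow>
      Q t (n(13 := 0)) (r(x := v)) (S(i := ys, j := rev xs @ S j)) T"
  shows "wp (move_some i j x) Q n r S T"
  using assms(5-7)
proof (induction xs arbitrary: S n r Q)
  case Nil
  have eq: "n(13 := 0) = n" "S(i := ys, j := rev [] @ S j) = S" using Nil by (auto simp: fun_eq_iff)
  have "Q 1 n r S T" using Nil(3)[of 1 "r x"] unfolding eq by simp
  with Nil show ?case unfolding move_some_def
    by (intro wp_While) (auto simp: eval_simps)
next
  case (Cons u xs)
  let ?S = "S(i := xs @ ys, j := u # S j)" and ?r = "r(x := u)" and ?n = "n(13 := length xs)"
  have "wp (move_some i j x) (\<lambda>t. Q (Suc (Suc (Suc (Suc t))))) ?n ?r ?S T"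
  proof (rule Cons.IH)
    show "?S i = xs @ ys" "?n 13 = length xs" using assms(4) by auto
    fix t v
    assume t: "t \<le> 4 * length xs + 1"
    have eq: "?S(i := ys, j := rev xs @ ?S j) = S(i := ys, j := rev (u # xs) @ S j)"
      using assms(4) by (auto simp: fun_eq_iff)
    have "Q (Suc (Suc (Suc (Suc t)))) (n(13 := 0)) (r(x := v)) (S(i := ys, j := rev (u # xs) @ S j)) T"
      using t by (intro Cons.prems(3)) simp
    then show "Q (Suc (Suc (Suc (Suc t)))) (?n(13 := 0)) (?r(x := v)) (?S(i := ys, j := rev xs @ ?S j)) T"
      unfolding eq fun_upd_upd .
  qed
  then show ?case
    unfolding move_some_def using assms(1-4) Cons.prems(1,2)
    by - ((rule wp_While; (intro wp_intros)?), (auto simp: eval_simps fun_upd_twist add.commute))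
qed

section \<open>Selection in linear time\<close>

text \<open>Ranks are expressed by counting instead of sorting: counts are additive, so ranks can be
  transferred between a multiset and its parts, and ties need no choice of a position.\<close>

definition kth :: "nat \<Rightarrow> real multiset \<Rightarrow> real \<Rightarrow> bool" where
  "kth k M v \<longleftrightarrow> size {#x \<in># M. x < v#} < k \<and> k \<le> size {#x \<in># M. x \<le> v#}"

lemma size_filter_le:
  "size {#x \<in># M. x \<le> (v::real)#} = size {#x \<in># M. x < v#} + size {#x \<in># M. x = v#}"
proof -
  have "{#x \<in># M. x \<le> v#} = {#x \<in># M. x < v#} + {#x \<in># M. x = v#}"
    by (induction M) auto
  then show ?thesis by simp
qed

lemma kth_mem:
  assumes "kth k M v"
  shows "v \<in># M"
proof (rule ccontr)
  assume "v \<notin># M"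
  then have "{#x \<in># M. x = v#} = {#}" by (auto simp: filter_mset_eq_conv)
  with assms size_filter_le[of v M] show False by (auto simp: kth_def)
qed

lemma kth_filter_less:
  assumes "kth k {#x \<in># M. x < p#} v"
  shows "kth k M v"
proof -
  have "v < p" using kth_mem[OF assms] by simp
  then have "{#x \<in># {#x \<in># M. x < p#}. x < v#} = {#x \<in># M. x < v#}"
    "{#x \<in># {#x \<in># M. x < p#}. x \<le> v#} = {#x \<in># M. x \<le> v#}"
    by (auto simp: filter_filter_mset intro!: filter_mset_cong)
  with assms show ?thesis by (simp add: kth_def)
qed

lemma kth_filter_greater:
  assumes "kth k {#x \<in># M. p < x#} v"
  shows "kth (size {#x \<in># M. x \<le> p#} + k) M v"
proof -
  have v: "p < v" using kth_mem[OF assms] by simp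
  have "{#x \<in># M. x < v#} = {#x \<in># M. x \<le> p#} + {#x \<in># {#x \<in># M. p < x#}. x < v#}"
    "{#x \<in># M. x \<le> v#} = {#x \<in># M. x \<le> p#} + {#x \<in># {#x \<in># M. p < x#}. x \<le> v#}"
    using v by (induction M) auto
  with assms show ?thesis by (simp add: kth_def)
qed

definition median3 :: "real \<Rightarrow> real \<Rightarrow> real \<Rightarrow> real" where
  "median3 a b c = (if c < max a b then max (min a b) c else max a b)"

fun medians3 :: "real list \<Rightarrow> real list" where
  "medians3 (a # b # c # xs) = median3 a b c # medians3 xs"
| "medians3 _ = []"

lemma length_medians3: "length (medians3 xs) = length xs div 3"
  by (induction xs rule: medians3.induct) auto

lemma filter_medians3:
  "2 * length (filter (\<lambda>x. x \<le> p) (medians3 xs)) \<le> length (filter (\<lambda>x. x \<le> p) xs)"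
  "2 * length (filter (\<lambda>x. p \<le> x) (medians3 xs)) \<le> length (filter (\<lambda>x. p \<le> x) xs)"
  by (induction xs rule: medians3.induct) (auto simp: median3_def max_def min_def split: if_splits)

text \<open>Each round pops from one stack and pushes onto another, which reverses the order of the
  medians; the reversals record this. Incomplete blocks at the end are dropped.\<close>

definition ninthers :: "real list \<Rightarrow> real list" where
  "ninthers xs = rev (medians3 (rev (medians3 xs)))"

lemma length_ninthers: "length (ninthers xs) = length xs div 9"
  by (simp add: ninthers_def length_medians3 flip: div_mult2_eq)

lemma filter_ninthers:
  "4 * length (filter (\<lambda>x. x \<le> p) (ninthers xs)) \<le> length (filter (\<lambda>x. x \<le> p) xs)"
  "4 * length (filter (\<lambda>x. p \<le> x) (ninthers xs)) \<le> length (filter (\<lambda>x. p \<le> x) xs)"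
  using filter_medians3[of p xs] filter_medians3[of p "rev (medians3 xs)"]
  by (simp_all add: ninthers_def rev_filter[symmetric])

text \<open>At least half of the ninthers are at most \<open>p\<close> and at least half are at
  least \<open>p\<close>. Each of them accounts for 4 of the 9 elements of its group on the same
  side, so either strict side misses at least \<open>2 * (length xs div 9)\<close> elements.\<close>

lemma pivot_splits:
  assumes "kth (length xs div 9 div 2 + 1) (mset (ninthers xs)) p"
  shows "length (filter (\<lambda>x. x < p) xs) + 2 * (length xs div 9) \<le> length xs"
    "length (filter (\<lambda>x. p < x) xs) + 2 * (length xs div 9) \<le> length xs"
proof -
  let ?m = "length xs div 9"
  have c: "length (filter (\<lambda>x. x < p) ys) + length (filter (\<lambda>x. p \<le> x) ys) = length ys"
    "length (filter (\<lambda>x. p < x) ys) + length (filter (\<lambda>x. x \<le> p) ys) = length ys" for ys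
    by (induction ys) auto
  have "length (filter (\<lambda>x. x < p) (ninthers xs)) < ?m div 2 + 1"
    "?m div 2 + 1 \<le> length (filter (\<lambda>x. x \<le> p) (ninthers xs))"
    using assms by (simp_all add: kth_def flip: mset_filter)
  with c(1)[of xs] c(2)[of xs] c(1)[of "ninthers xs"] filter_ninthers[of p xs]
  show "length (filter (\<lambda>x. x < p) xs) + 2 * ?m \<le> length xs"
    "length (filter (\<lambda>x. p < x) xs) + 2 * ?m \<le> length xs"
    unfolding length_ninthers by linarith+
qed

text \<open>Register 10 contains the length of the current list, which is on top of stack 4,
  register 11 the rank, and real register 3 the pivot.\<close>

definition partition_loop :: com where
  "partition_loop = While (NLess (NConst 0) (NReg 13)) (rpop 4 11 ;;
    Cond (RLess (RReg 11) (RReg 3)) (rpush 5 11)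
      (Cond (RLess (RReg 3) (RReg 11)) (rpush 6 11) Skip) ;;
    decr 13)"

definition partition :: com where
  "partition = NAssign 13 (NReg 10) ;; partition_loop"

lemma wp_partition:
  assumes "S 4 = L @ D" "n 10 = length L"
    and Q: "\<And>t v. t \<le> 6 * length L + 2 \<Longrightarrow>
      Q t (n(13 := 0)) (r(11 := v)) (S(4 := D, 5 := rev (filter (\<lambda>x. x < r 3) L) @ S 5,
        6 := rev (filter (\<lambda>x. r 3 < x) L) @ S 6)) T"
  shows "wp partition Q n r S T"
proof -
  have *: "wp partition_loop Q n r S T"
    if "S 4 = L @ D" "n 13 = length L" "\<And>t v. t \<le> 6 * length L + 1 \<Longrightarrow>
      Q t (n(13 := 0)) (r(11 := v)) (S(4 := D, 5 := rev (filter (\<lambda>x. x < r 3) L) @ S 5,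
        6 := rev (filter (\<lambda>x. r 3 < x) L) @ S 6)) T" for Q n r S L
    using that
  proof (induction L arbitrary: Q n r S)
    case Nil
    have eq: "n(13 := 0) = n" "S(4 := D, 5 := rev (filter (\<lambda>x. x < r 3) []) @ S 5,
        6 := rev (filter (\<lambda>x. r 3 < x) []) @ S 6) = S" using Nil by (auto simp: fun_eq_iff)
    have "Q 1 n r S T" using Nil(3)[of 1 "r 11"] unfolding eq by simp
    with Nil show ?case unfolding partition_loop_def
      by - ((rule wp_While; (intro wp_intros)?), (auto simp: eval_simps))
  next
    case (Cons u L)
    let ?n = "n(13 := length L)" and ?r = "r(11 := u)"
    let ?S = "if u < r 3 then S(4 := L @ D, 5 := u # S 5)
      else if r 3 < u then S(4 := L @ D, 6 := u # S 6) else S(4 := L @ D)"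
    have w: "wp partition_loop (\<lambda>t. Q (k + t)) ?n ?r ?S T" if "k \<le> 6" for k
    proof (rule Cons.IH)
      show "?S 4 = L @ D" "?n 13 = length L" by auto
      fix t v
      assume t: "t \<le> 6 * length L + 1"
      have eq: "?S(4 := D, 5 := rev (filter (\<lambda>x. x < ?r 3) L) @ ?S 5,
          6 := rev (filter (\<lambda>x. ?r 3 < x) L) @ ?S 6) =
        S(4 := D, 5 := rev (filter (\<lambda>x. x < r 3) (u # L)) @ S 5,
          6 := rev (filter (\<lambda>x. r 3 < x) (u # L)) @ S 6)"
        by (auto simp: fun_eq_iff)
      have "Q (k + t) (n(13 := 0)) (r(11 := v)) (S(4 := D, 5 := rev (filter (\<lambda>x. x < r 3) (u # L)) @ S 5,
          6 := rev (filter (\<lambda>x. r 3 < x) (u # L)) @ S 6)) T"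
        using t \<open>k \<le> 6\<close> by (intro Cons.prems(3)) simp
      then show "Q (k + t) (?n(13 := 0)) (?r(11 := v)) (?S(4 := D, 5 := rev (filter (\<lambda>x. x < ?r 3) L) @ ?S 5,
          6 := rev (filter (\<lambda>x. ?r 3 < x) L) @ ?S 6)) T"
        unfolding eq fun_upd_upd .
    qed
    from w[of 5] w[of 6] show ?case
      unfolding partition_loop_def using Cons.prems(1,2)
      by - ((rule wp_While; (intro wp_intros)?),
        (auto simp: eval_simps numeral_eq_Suc split: if_splits))
  qed
  show ?thesis
    unfolding partition_def
    by (intro wp_intros *) (use assms in \<open>auto simp: eval_simps\<close>)
qed

definition triple :: "nat \<Rightarrow> nat \<Rightarrow> com" where
  "triple i j = rpop i 10 ;; rpop i 11 ;; rpop i 12 ;;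
    Cond (RLess (RReg 11) (RReg 10))
      (RAssign 13 (RReg 10) ;; RAssign 10 (RReg 11) ;; RAssign 11 (RReg 13)) Skip ;;
    Cond (RLess (RReg 12) (RReg 11))
      (Cond (RLess (RReg 10) (RReg 12)) (RAssign 11 (RReg 12)) (RAssign 11 (RReg 10))) Skip ;;
    rpush j 11"

definition triples :: "nat \<Rightarrow> nat \<Rightarrow> com" where
  "triples i j = While (NLess (NConst 2) (height i)) (triple i j) ;; clear i 10"

lemma wp_triples:
  assumes "i < 10" "2 \<le> j" "j < 10" "i \<noteq> j"
    and Q: "\<And>t r'. t \<le> 13 * length (S i) + 6 \<Longrightarrow> agree 10 r' r \<Longrightarrow>
      Q t n r' (S(i := [], j := rev (medians3 (S i)) @ S j)) T"
  shows "wp (triples i j) Q n r S T"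
proof -
  have body: "wp (triple i j) Q n r S T" if Si: "S i = a # b # c # xs" and Qi:
    "\<And>t r'. t \<le> 12 \<Longrightarrow> agree 10 r' r \<Longrightarrow>
      Q t n r' (S(i := xs, j := median3 a b c # S j)) T" for Q n r S a b c xs
  proof -
    have Q: "Q t n r' S' T" if "t \<le> 12" "agree 10 r' r" "S' = S(i := xs, j := median3 a b c # S j)"
      for t r' S' using Qi that by blast
    show ?thesis
      unfolding triple_def using assms(1-4)
      by (intro wp_intros; (intro Q)?)
        (simp_all add: Si median3_def fun_eq_iff max_def min_def)
  qed
  have *: "wp (While (NLess (NConst 2) (height i)) (triple i j)) Q n r S T"
    if "\<And>t r' (ys :: real list). t \<le> 13 * length (S i) + 1 \<Longrightarrow> length ys < 3 \<Longrightarrow>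
      agree 10 r' r \<Longrightarrow> Q t n r' (S(i := ys, j := rev (medians3 (S i)) @ S j)) T"
    for Q n r S
    using that
  proof (induction "length (S i)" arbitrary: Q r S rule: less_induct)
    case less
    show ?case
    proof (cases "2 < length (S i)")
      case True
      then obtain a b c xs where Si: "S i = a # b # c # xs"
        by (auto simp: less_eq_Suc_le numeral_eq_Suc Suc_le_length_iff)
      let ?S = "S(i := xs, j := median3 a b c # S j)"
      have w: "wp (While (NLess (NConst 2) (height i)) (triple i j)) (\<lambda>t. Q (t0 + t + 1)) n r' ?S T"
        if "t0 \<le> 12" "agree 10 r' r" for t0 r'
      proof (rule less(1))
        show "length (?S i) < length (S i)" using assms(4) Si by simp
        fix t r'' and ys :: "real list"
        assume t: "t \<le> 13 * length (?S i) + 1" "length ys < 3" "agree 10 r'' r'"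
        have eq: "?S(i := ys, j := rev (medians3 (?S i)) @ ?S j) =
          S(i := ys, j := rev (medians3 (S i)) @ S j)" using assms(4) Si by (auto simp: fun_eq_iff)
        show "Q (t0 + t + 1) n r'' (?S(i := ys, j := rev (medians3 (?S i)) @ ?S j)) T"
          unfolding eq by (rule less(2)) (use t that assms(4) Si in auto)
      qed
      show ?thesis
      proof (rule wp_While)
        show "wp (triple i j) (\<lambda>t. wp (While (NLess (NConst 2) (height i)) (triple i j)) (\<lambda>t'. Q (t + t' + 1))) n r S T"
          using w by (intro body[of S a b c xs] Si) auto
      qed (use assms(1) Si in \<open>auto simp: eval_simps\<close>)
    next
      case False
      then have "medians3 (S i) = []" using length_medians3[of "S i"] by simp
      then have eq: "S(i := S i, j := rev (medians3 (S i)) @ S j) = S" by simp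
      have "Q 1 n r S T" using less(2)[of 1 "S i" r] False unfolding eq by simp
      then show ?thesis using assms(1) False
        by - ((rule wp_While), (auto simp: eval_simps))
    qed
  qed
  show ?thesis
    unfolding triples_def
  proof (intro wp_Seq * wp_clear assms(1))
    fix t r' ys t' v
    assume a: "t \<le> 13 * length (S i) + 1" "length ys < 3" "agree 10 r' r"
      "t' \<le> 2 * length ((S(i := ys, j := rev (medians3 (S i)) @ S j)) i) + 1"
    have eq: "S(i := ys, j := rev (medians3 (S i)) @ S j, i := []) =
      S(i := [], j := rev (medians3 (S i)) @ S j)" using assms(4) by (auto simp: fun_eq_iff)
    show "Q (t + t') n (r'(10 := v)) (S(i := ys, j := rev (medians3 (S i)) @ S j, i := [])) T"
      unfolding eq by (rule Q) (use a assms(4) in auto)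
  qed
qed

definition copy_loop :: com where
  "copy_loop = While (nonempty 5) (rpop 5 10 ;; rpush 4 10 ;; rpush 6 10)"

text \<open>A stack can be read only by emptying it. The detour over stack 5 reverses the list
  twice, so that it is back on stack 4 and also on stack 6 in its original order.\<close>

definition copy :: com where
  "copy = NAssign 13 (NReg 10) ;; move_some 4 5 10 ;; copy_loop"

definition find_pivot :: com where
  "find_pivot =
    Cond (NLess (NReg 10) (NConst 64)) (rpop 4 3 ;; rpush 4 3 ;; NAssign 12 (NConst 1))
      (npush 10 10 ;; npush 10 11 ;;
       copy ;; triples 6 5 ;; triples 5 4 ;;
       NAssign 10 (NDiv (NReg 10) (NConst 3)) ;; NAssign 10 (NDiv (NReg 10) (NConst 3)) ;;
       NAssign 11 (NDiv (NReg 10) (NConst 2)) ;; NAssign 11 (NAdd (NReg 11) (NConst 1)))"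

definition keep :: "nat \<Rightarrow> nat \<Rightarrow> com" where
  "keep i j = NAssign 10 (height i) ;; clear j 10 ;; move_all i 4 10 ;; NAssign 12 (NConst 0)"

definition resume :: com where
  "resume = clear 5 10 ;; clear 6 10 ;;
    Cond (nonempty 10) (npop 10 11 ;; npop 10 10) (NAssign 12 (NConst 2))"

text \<open>Register 14 is the number of elements equal to the pivot, and register 11 the rank that
  remains after discounting the smaller ones.\<close>

definition branch :: com where
  "branch = Cond (NLess (NReg 14) (NReg 11)) (NAssign 11 (NSub (NReg 11) (NReg 14)) ;; keep 6 5) resume"

definition use_pivot :: com where
  "use_pivot = partition ;;
    Cond (NLess (height 5) (NReg 11))
      (NAssign 11 (NSub (NReg 11) (height 5)) ;;
       NAssign 14 (NSub (NReg 10) (height 5)) ;; NAssign 14 (NSub (NReg 14) (height 6)) ;; branch)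
      (keep 5 6)"

definition select_loop :: com where
  "select_loop = While (NLess (NReg 12) (NConst 2)) (Cond (NLess (NReg 12) (NConst 1)) find_pivot use_pivot)"

definition select :: com where
  "select = NAssign 12 (NConst 0) ;; select_loop"

text \<open>Register 12 is 0 if a pivot has to be found, 1 if one is available, and 2 at the end.
  When the pivot turns out to be the element sought, it is the pivot for the pending list
  whose rank and length are on top of stack 10.\<close>

definition resumed :: "nregs \<Rightarrow> nat list \<Rightarrow> bool" where
  "resumed n ms \<longleftrightarrow> (case ms of k # m # _ \<Rightarrow> n 12 = 1 \<and> n 11 = k \<and> n 10 = m | _ \<Rightarrow> n 12 = 2)"

lemma wp_keep:
  assumes ij: "i = 5 \<and> j = 6 \<or> i = 6 \<and> j = 5" and S: "S i = rev A"
    and Q: "\<And>t v. t \<le> 3 * length A + 2 * length (S j) + 5 \<Longrightarrow>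
      Q t (n(10 := length A, 12 := 0)) (r(10 := v)) (S(4 := A @ S 4, 5 := [], 6 := [])) T"
  shows "wp (keep i j) Q n r S T"
proof -
  have Q: "Q t n' r' S' T"
    if "t \<le> 3 * length A + 2 * length (S j) + 5" "n' = n(10 := length A, 12 := 0)"
      "\<exists>v. r' = r(10 := v)" "S' = S(4 := A @ S 4, 5 := [], 6 := [])" for t n' r' S'
    using Q that by blast
  have n: "nval (height i) (view n r S T) = length A" using ij S by (auto simp: eval_simps)
  show ?thesis
    unfolding keep_def
    by (intro wp_Seq wp_clear wp_move_all wp_NAssign; (unfold n)?; (intro Q)?)
      (use ij S in \<open>auto simp: fun_eq_iff intro: fun_upd_upd\<close>)
qed

lemma wp_resume:
  assumes T: "T 10 = [] \<or> (\<exists>k m ms. T 10 = k # m # ms)" and n: "n 12 = 1"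
    and Q: "\<And>t n' v. t \<le> 2 * length (S 5) + 2 * length (S 6) + 5 \<Longrightarrow> resumed n' (T 10) \<Longrightarrow>
      agree 10 n' n \<Longrightarrow>
      Q t n' (r(10 := v)) (S(5 := [], 6 := [])) (T(10 := drop 2 (T 10)))"
  shows "wp resume Q n r S T"
proof -
  have Q: "Q t n' r' (S(5 := [], 6 := [])) T'"
    if "t \<le> 2 * length (S 5) + 2 * length (S 6) + 5" "resumed n' (T 10)" "agree 10 n' n"
      "\<exists>v. r' = r(10 := v)" "T' = T(10 := drop 2 (T 10))" for t n' r' T'
    using Q that by blast
  show ?thesis
    using T
  proof (elim disjE exE)
    assume "T 10 = []"
    then show ?thesis unfolding resume_def
      by (intro wp_Seq wp_clear wp_intros; (intro Q)?)
        (auto simp: eval_simps resumed_def fun_eq_iff intro: fun_upd_upd)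
  next
    fix k m ms assume "T 10 = k # m # ms"
    then show ?thesis unfolding resume_def using n
      by (intro wp_Seq wp_clear wp_intros; (intro Q)?)
        (auto simp: eval_simps resumed_def fun_eq_iff intro: fun_upd_upd)
  qed
qed

lemma wp_use_pivot:
  assumes S: "S 4 = L @ D" "S 5 = []" "S 6 = []" and n: "n 10 = length L" "n 11 = k" "n 12 = 1" "1 \<le> k" "k \<le> length L"
    and T: "T 10 = [] \<or> T 10 = k' # m' # ms"
    and less: "\<And>t n' r'. t \<le> 13 * length L + 20 \<Longrightarrow> agree 10 n' n \<Longrightarrow>
      agree 3 r' r \<Longrightarrow> n' 12 = 0 \<Longrightarrow> n' 11 = k \<Longrightarrow>
      n' 10 = length (filter (\<lambda>x. x < r 3) L) \<Longrightarrow> k \<le> length (filter (\<lambda>x. x < r 3) L) \<Longrightarrow>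
      Q t n' r' (S(4 := filter (\<lambda>x. x < r 3) L @ D)) T"
    and greater: "\<And>t n' r' j. t \<le> 13 * length L + 20 \<Longrightarrow> agree 10 n' n \<Longrightarrow>
      agree 3 r' r \<Longrightarrow> n' 12 = 0 \<Longrightarrow> n' 11 = j \<Longrightarrow>
      n' 10 = length (filter (\<lambda>x. r 3 < x) L) \<Longrightarrow> 1 \<le> j \<Longrightarrow>
      k = length (filter (\<lambda>x. x \<le> r 3) L) + j \<Longrightarrow>
      Q t n' r' (S(4 := filter (\<lambda>x. r 3 < x) L @ D)) T"
    and equal: "\<And>t n' r'. t \<le> 13 * length L + 20 \<Longrightarrow> agree 10 n' n \<Longrightarrow>
      agree 3 r' r \<Longrightarrow> r' 3 = r 3 \<Longrightarrow> resumed n' (T 10) \<Longrightarrow> kth k (mset L) (r 3) \<Longrightarrow>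
      Q t n' r' (S(4 := D)) (T(10 := drop 2 (T 10)))"
  shows "wp use_pivot Q n r S T"
proof -
  let ?lt = "filter (\<lambda>x. x < r 3) L" and ?gt = "filter (\<lambda>x. r 3 < x) L" and ?le = "filter (\<lambda>x. x \<le> r 3) L"
  have c: "length ?le + length ?gt = length L" by (induction L) auto
  have l: "length ?lt \<le> length ?le" by (induction L) auto
  have less: "Q t n' r' S' T"
    if "t \<le> 13 * length L + 20" "agree 10 n' n" "agree 3 r' r" "n' 12 = 0" "n' 11 = k"
      "n' 10 = length ?lt" "k \<le> length ?lt" "S' = S(4 := ?lt @ D)" for t n' r' S'
    using less that by blast
  have greater: "Q t n' r' S' T"
    if "t \<le> 13 * length L + 20" "agree 10 n' n" "agree 3 r' r" "n' 12 = 0" "n' 11 = k - length ?le"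
      "n' 10 = length ?gt" "length ?le < k" "S' = S(4 := ?gt @ D)" for t n' r' S'
  proof -
    have "1 \<le> k - length ?le" "k = length ?le + (k - length ?le)" using that by auto
    then show ?thesis using greater[of t n' r' "k - length ?le"] that by blast
  qed
  have equal: "Q t n' r' S' T'"
    if "t \<le> 13 * length L + 20" "agree 10 n' n" "agree 3 r' r" "r' 3 = r 3"
      "resumed n' (T 10)" "length ?lt < k" "k \<le> length ?le" "S' = S(4 := D)" "T' = T(10 := drop 2 (T 10))"
    for t n' r' S' T'
  proof -
    have "kth k (mset L) (r 3)" using that by (simp add: kth_def flip: mset_filter)
    then show ?thesis using equal that by blast
  qed
  show ?thesis
    unfolding use_pivot_def
  proof (rule wp_Seq, rule wp_partition, rule S(1), rule n(1))
    fix t v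
    assume t: "t \<le> 6 * length L + 2"
    let ?n = "n(13 := 0)" and ?r = "r(11 := v)" and ?S = "S(4 := D, 5 := rev ?lt @ S 5, 6 := rev ?gt @ S 6)"
    have S': "?S 4 = D" "?S 5 = rev ?lt" "?S 6 = rev ?gt" using S by auto
    have ev: "nval (height 5) (view n' r' ?S T') = length ?lt"
      "nval (height 6) (view n' r' ?S T') = length ?gt" for n' r' T'
      using S by (auto simp: eval_simps)
    have le: "length ?le = length ?lt + (length L - length ?lt - length ?gt)"
      using c l by linarith
    have gt: "length ?gt + length ?lt \<le> length L" using c l by linarith
    have 1: "wp (keep 5 6) (\<lambda>t'. Q (t + (t' + 1))) ?n ?r ?S T" if "\<not> length ?lt < k"
    proof (rule wp_keep)
      fix t' v' assume "t' \<le> 3 * length ?lt + 2 * length (?S 6) + 5"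
      then show "Q (t + (t' + 1)) (?n(10 := length ?lt, 12 := 0)) (?r(10 := v'))
          (?S(4 := ?lt @ ?S 4, 5 := [], 6 := [])) T"
        using t S that n gt by (intro less) (auto simp: fun_eq_iff)
    qed (use S' in auto)
    have 2: "wp (keep 6 5) (\<lambda>t'. Q (t + (1 + (1 + (1 + (1 + t' + 1))) + 1)))
        (?n(11 := k - length ?lt, 14 := length L - length ?lt - length ?gt,
            11 := k - length ?lt - (length L - length ?lt - length ?gt))) ?r ?S T"
      if "length L - length ?lt - length ?gt < k - length ?lt"
    proof (rule wp_keep)
      fix t' v' assume "t' \<le> 3 * length ?gt + 2 * length (?S 5) + 5"
      then show "Q (t + (1 + (1 + (1 + (1 + t' + 1))) + 1)) ((?n(11 := k - length ?lt, 14 := length L - length ?lt - length ?gt,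
            11 := k - length ?lt - (length L - length ?lt - length ?gt)))(10 := length ?gt, 12 := 0)) (?r(10 := v'))
          (?S(4 := ?gt @ ?S 4, 5 := [], 6 := [])) T"
        using t S that n gt le by (intro greater) (auto simp: fun_eq_iff)
    qed (use S' in auto)
    have 3: "wp resume (\<lambda>t'. Q (t + (1 + (1 + (1 + (t' + 1))) + 1)))
        (?n(11 := k - length ?lt, 14 := length L - length ?lt - length ?gt)) ?r ?S T"
      if "\<not> length L - length ?lt - length ?gt < k - length ?lt" "length ?lt < k"
    proof (rule wp_resume)
      fix t' n' v'
      assume "t' \<le> 2 * length (?S 5) + 2 * length (?S 6) + 5" "resumed n' (T 10)"
        "agree 10 n' (?n(11 := k - length ?lt, 14 := length L - length ?lt - length ?gt))"
      then show "Q (t + (1 + (1 + (1 + (t' + 1))) + 1)) n' (?r(10 := v'))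
          (?S(5 := [], 6 := [])) (T(10 := drop 2 (T 10)))"
        using t S that n gt le by (intro equal) (auto simp: fun_eq_iff)
    qed (use T n in auto)
    let ?n2 = "?n(11 := k - length ?lt, 14 := length L - length ?lt - length ?gt)"
    have 4: "wp branch (\<lambda>t'. Q (t + (1 + (1 + (1 + t')) + 1))) ?n2 ?r ?S T" if lt: "length ?lt < k"
      unfolding branch_def
    proof (rule wp_Cond)
      assume "bval (NLess (NReg 14) (NReg 11)) (view ?n2 ?r ?S T)"
      then have "length L - length ?lt - length ?gt < k - length ?lt" by (simp add: regv_def)
      from 2[OF this]
      show "wp (NAssign 11 (NSub (NReg 11) (NReg 14)) ;; keep 6 5)
        (\<lambda>t'. Q (t + (1 + (1 + (1 + (t' + 1))) + 1))) ?n2 ?r ?S T"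
        by (intro wp_Seq wp_NAssign) (simp_all add: regv_def)
    next
      assume "\<not> bval (NLess (NReg 14) (NReg 11)) (view ?n2 ?r ?S T)"
      then show "wp resume (\<lambda>t'. Q (t + (1 + (1 + (1 + (t' + 1))) + 1))) ?n2 ?r ?S T"
        using lt by (intro 3) (simp_all add: regv_def)
    qed simp_all
    let ?ranks = "NAssign 11 (NSub (NReg 11) (height 5)) ;;
       NAssign 14 (NSub (NReg 10) (height 5)) ;; NAssign 14 (NSub (NReg 14) (height 6)) ;; branch"
    show "wp (Cond (NLess (height 5) (NReg 11)) (?ranks) (keep 5 6)) (\<lambda>t'. Q (t + t')) ?n ?r ?S T"
    proof (rule wp_Cond)
      assume "bval (NLess (height 5) (NReg 11)) (view ?n ?r ?S T)"
      then have "length ?lt < k" by (simp add: eval_simps S n)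
      from 4[OF this] show "wp (?ranks) (\<lambda>t'. Q (t + (t' + 1))) ?n ?r ?S T"
        by (intro wp_Seq wp_NAssign) (simp_all add: eval_simps S n)
    next
      assume "\<not> bval (NLess (height 5) (NReg 11)) (view ?n ?r ?S T)"
      then show "wp (keep 5 6) (\<lambda>t'. Q (t + (t' + 1))) ?n ?r ?S T"
        by (intro 1) (simp add: eval_simps S n)
    qed simp_all
  qed
qed

lemma wp_find_pivot_small:
  assumes "n 10 < 64" "S 4 \<noteq> []" "\<And>t. t \<le> 4 \<Longrightarrow> Q t (n(12 := 1)) (r(3 := hd (S 4))) S T"
  shows "wp find_pivot Q n r S T"
proof -
  have Q: "Q t n' (r(3 := hd (S 4))) S' T" if "t \<le> 4" "n' = n(12 := 1)" "S' = S" for t n' S'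
    using assms(3) that by blast
  show ?thesis
    unfolding find_pivot_def
  proof (rule wp_Cond)
    show "wp (rpop 4 3 ;; rpush 4 3 ;; NAssign 12 (NConst 1)) (\<lambda>t. Q (t + 1)) n r S T"
      using assms(2) by (intro wp_intros; (intro Q)?) (auto simp: fun_eq_iff)
  qed (use assms(1) in \<open>simp_all add: regv_def\<close>)
qed

lemma wp_copy:
  assumes "S 4 = L @ D" "S 5 = []" "n 10 = length L"
    and Q: "\<And>t v. t \<le> 8 * length L + 3 \<Longrightarrow> Q t (n(13 := 0)) (r(10 := v)) (S(6 := L @ S 6)) T"
  shows "wp copy Q n r S T"
proof -
  have *: "wp copy_loop Q n r S T"
    if "S 5 = A" "\<And>t v. t \<le> 4 * length A + 1 \<Longrightarrow>
      Q t n (r(10 := v)) (S(5 := [], 4 := rev A @ S 4, 6 := rev A @ S 6)) T" for Q n r S A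
    using that
  proof (induction A arbitrary: Q r S)
    case Nil
    have eq: "S(5 := [], 4 := rev [] @ S 4, 6 := rev [] @ S 6) = S" using Nil by (auto simp: fun_eq_iff)
    have "Q 1 n r S T" using Nil(2)[of 1 "r 10"] unfolding eq by simp
    with Nil show ?case unfolding copy_loop_def
      by - ((rule wp_While; (intro wp_intros)?), (auto simp: eval_simps))
  next
    case (Cons u A)
    let ?r = "r(10 := u)" and ?S = "S(5 := A, 4 := u # S 4, 6 := u # S 6)"
    have "wp copy_loop (\<lambda>t. Q (Suc (Suc (Suc (Suc t))))) n ?r ?S T"
    proof (rule Cons.IH)
      show "?S 5 = A" by simp
      fix t v
      assume t: "t \<le> 4 * length A + 1"
      have eq: "?S(5 := [], 4 := rev A @ ?S 4, 6 := rev A @ ?S 6) =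
        S(5 := [], 4 := rev (u # A) @ S 4, 6 := rev (u # A) @ S 6)" by (auto simp: fun_eq_iff)
      have "Q (Suc (Suc (Suc (Suc t)))) n (r(10 := v))
          (S(5 := [], 4 := rev (u # A) @ S 4, 6 := rev (u # A) @ S 6)) T"
        using t by (intro Cons.prems(2)) simp
      then show "Q (Suc (Suc (Suc (Suc t)))) n (?r(10 := v)) (?S(5 := [], 4 := rev A @ ?S 4, 6 := rev A @ ?S 6)) T"
        unfolding eq fun_upd_upd .
    qed
    then show ?case
      unfolding copy_loop_def using Cons.prems(1)
      by - ((rule wp_While; (intro wp_intros)?), (auto simp: eval_simps))
  qed
  show ?thesis
    unfolding copy_def
  proof (intro wp_Seq wp_NAssign wp_move_some * refl)
    let ?n = "n(13 := nval (NReg 10) (view n r S T))"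
    show "S 4 = L @ D" "?n 13 = length L" using assms by (simp_all add: regv_def)
    fix t v t' v'
    let ?S = "S(4 := D, 5 := rev L @ S 5)"
    assume t: "t \<le> 4 * length L + 1" "t' \<le> 4 * length (?S 5) + 1"
    have eq: "?S(5 := [], 4 := rev (?S 5) @ ?S 4, 6 := rev (?S 5) @ ?S 6) = S(6 := L @ S 6)"
      using assms(1,2) by (auto simp: fun_eq_iff)
    show "Q (1 + (t + t')) (?n(13 := 0)) (r(10 := v, 10 := v'))
        (?S(5 := [], 4 := rev (?S 5) @ ?S 4, 6 := rev (?S 5) @ ?S 6)) T"
      unfolding eq unfolding fun_upd_upd by (rule Q) (use t assms(2) in auto)
  qed simp_all
qed

lemma wp_find_pivot_large:
  assumes "S 4 = L @ D" "S 5 = []" "S 6 = []" "n 10 = length L" "n 11 = k" "64 \<le> length L"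
    and Q: "\<And>t n' r'. t \<le> 34 * length L + 30 \<Longrightarrow> agree 10 n' n \<Longrightarrow>
      agree 10 r' r \<Longrightarrow> n' 12 = n 12 \<Longrightarrow> n' 10 = length L div 9 \<Longrightarrow>
      n' 11 = length L div 9 div 2 + 1 \<Longrightarrow>
      Q t n' r' (S(4 := ninthers L @ L @ D)) (T(10 := k # length L # T 10))"
  shows "wp find_pivot Q n r S T"
proof -
  let ?T = "T(10 := k # length L # T 10)" and ?n = "n(13 := 0)"
  define ranks where "ranks = NAssign 10 (NDiv (NReg 10) (NConst 3)) ;; NAssign 10 (NDiv (NReg 10) (NConst 3)) ;;
    NAssign 11 (NDiv (NReg 10) (NConst 2)) ;; NAssign 11 (NAdd (NReg 11) (NConst 1))"
  have ranks: "wp ranks (\<lambda>t'. Q (t + t')) n' r' S' ?T"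
    if "t \<le> 34 * length L + 26" "agree 10 r' r" "S' = S(4 := ninthers L @ L @ D)" "n' = ?n" for t n' r' S'
  proof -
    have Q: "Q t n' r' S' ?T" if "t \<le> 34 * length L + 30" "agree 10 n' n" "n' 12 = n 12"
      "n' 10 = length L div 9" "n' 11 = length L div 9 div 2 + 1" for t n'
      unfolding \<open>S' = _\<close> using that \<open>\<forall>x<10. r' x = r x\<close> by (intro Q) auto
    show ?thesis unfolding ranks_def using that assms(4)
      by (intro wp_intros; (intro Q)?) (simp_all add: regv_def flip: div_mult2_eq)
  qed
  have "wp (copy ;; triples 6 5 ;; triples 5 4 ;; ranks) (\<lambda>t. Q (1 + (1 + t) + 1)) n r S ?T"
  proof (intro wp_Seq, rule wp_copy[where L = L and D = D and S = S and n = n, OF assms(1,2,4)], intro wp_Seq wp_triples)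
    fix t v t1 r1 t2 r2
    let ?S = "S(6 := L @ S 6)"
    let ?S1 = "?S(6 := [], 5 := rev (medians3 (?S 6)) @ ?S 5)"
    assume t: "t \<le> 8 * length L + 3" "t1 \<le> 13 * length (?S 6) + 6" "t2 \<le> 13 * length (?S1 5) + 6"
      "agree 10 r1 (r(10 := v))" "agree 10 r2 r1"
    have "wp ranks (\<lambda>t'. Q (3 + (t + (t1 + t2)) + t')) ?n r2 (?S1(5 := [], 4 := rev (medians3 (?S1 5)) @ ?S1 4)) ?T"
    proof (rule ranks)
      show "?S1(5 := [], 4 := rev (medians3 (?S1 5)) @ ?S1 4) = S(4 := ninthers L @ L @ D)"
        using assms(1-3) by (auto simp: fun_eq_iff ninthers_def)
      show "3 + (t + (t1 + t2)) \<le> 34 * length L + 26"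
        using t assms(2,3,6) by (simp add: length_medians3)
    qed (use t in auto)
    moreover have "3 + (t + (t1 + t2)) + t' = 1 + (1 + (t + (t1 + (t2 + t')))) + 1" for t' by simp
    ultimately show "wp ranks (\<lambda>t'. Q (1 + (1 + (t + (t1 + (t2 + t')))) + 1)) ?n r2 (?S1(5 := [], 4 := rev (medians3 (?S1 5)) @ ?S1 4)) ?T"
      by (simp only:)
  qed simp_all
  then have "wp (npush 10 10 ;; npush 10 11 ;; copy ;; triples 6 5 ;; triples 5 4 ;; ranks) (\<lambda>t. Q (t + 1)) n r S T"
    using assms(4,5)
    by - (rule wp_Seq, rule wp_npush, simp, simp, simp, rule wp_Seq, rule wp_npush, simp_all)
  then show ?thesis
    unfolding find_pivot_def ranks_def using assms(4,6)
    by (intro wp_Cond) (auto simp: regv_def)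
qed

text \<open>The same loop also serves the recursive calls, so the rule does not describe its end but
  the moment at which \<open>L\<close> has been replaced by its answer: if the loop achieves
  \<open>Q\<close> from there, it does so from the start. \<open>D\<close> contains the pending
  lists below \<open>L\<close>. This form can be applied twice in a row, to the ninthers and then to
  the remaining side.\<close>

lemma wp_select_loop:
  assumes "S 4 = L @ D" "S 5 = []" "S 6 = []" "n 12 = 0" "n 10 = length L" "n 11 = k" "1 \<le> k" "k \<le> length L"
    and "T 10 = [] \<or> (\<exists>k m ms. T 10 = k # m # ms)"
    and "\<And>t n' r'. t \<le> 900 * length L \<Longrightarrow> agree 10 n' n \<Longrightarrow>
      agree 3 r' r \<Longrightarrow> resumed n' (T 10) \<Longrightarrow> kth k (mset L) (r' 3) \<Longrightarrow>
      wp select_loop (\<lambda>t'. Q (t + t')) n' r' (S(4 := D)) (T(10 := drop 2 (T 10)))"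
  shows "wp select_loop Q n r S T"
  using assms
proof (induction "length L" arbitrary: L D k n r S T Q rule: less_induct)
  case less
  note S = less(2-4) and n = less(5-9) and T = less(10) and Q = less(11)
  let ?body = "Cond (NLess (NReg 12) (NConst 1)) find_pivot use_pivot"
  have step: "wp select_loop Q n r S T" if "n 12 < 2"
    "wp ?body (\<lambda>t. wp select_loop (\<lambda>t'. Q (t + t' + 1))) n r S T" for Q n r S T
    using that unfolding select_loop_def by (intro wp_While) (auto simp: regv_def)
  have find: "wp ?body Q n r S T" if "n 12 = 0" "wp find_pivot (\<lambda>t. Q (t + 1)) n r S T" for Q n r S T
    using that by (intro wp_Cond) (auto simp: regv_def)
  have use: "wp ?body Q n r S T" if "n 12 = 1" "wp use_pivot (\<lambda>t. Q (t + 1)) n r S T" for Q n r S T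
    using that by (intro wp_Cond) (auto simp: regv_def)
  have pivot: "wp select_loop (\<lambda>t'. Q (t0 + t')) n0 r0 S T"
    if n0: "agree 10 n0 n" "n0 10 = length L" "n0 11 = k" "n0 12 = 1" and r0: "agree 3 r0 r"
      and sm: "length (filter (\<lambda>x. x < r0 3) L) < length L" "length (filter (\<lambda>x. r0 3 < x) L) < length L"
      and t0: "\<And>l. l = length (filter (\<lambda>x. x < r0 3) L) \<or> l = length (filter (\<lambda>x. r0 3 < x) L) \<or> l = 0 \<Longrightarrow>
        t0 + (13 * length L + 22) + 900 * l \<le> 900 * length L"
    for t0 n0 r0
  proof (intro step use)
    let ?lt = "filter (\<lambda>x. x < r0 3) L" and ?gt = "filter (\<lambda>x. r0 3 < x) L"
    have T': "T 10 = [] \<or> T 10 = T 10 ! 0 # T 10 ! 1 # drop 2 (T 10)"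
      using T by (auto simp: numeral_2_eq_2)
    show "wp use_pivot (\<lambda>t. wp select_loop (\<lambda>t'. Q (t0 + (t + 1 + t' + 1)))) n0 r0 S T"
    proof (rule wp_use_pivot[where L = L and D = D and k = k and n = n0 and r = r0 and S = S and T = T, OF S n0(2,3,4) n(4,5) T'])
      fix t1 n1 r1
      assume 1: "t1 \<le> 13 * length L + 20" "agree 10 n1 n0" "agree 3 r1 r0"
        "n1 12 = 0" "n1 11 = k" "n1 10 = length ?lt" "k \<le> length ?lt"
      show "wp select_loop (\<lambda>t'. Q (t0 + (t1 + 1 + t' + 1))) n1 r1 (S(4 := ?lt @ D)) T"
      proof (rule less(1)[OF sm(1)])
        fix t2 n2 r2
        assume 2: "t2 \<le> 900 * length ?lt" "agree 10 n2 n1" "agree 3 r2 r1"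
          "resumed n2 (T 10)" "kth k (mset ?lt) (r2 3)"
        have "wp select_loop (\<lambda>t'. Q (t0 + (t1 + 1 + t2 + 1) + t')) n2 r2 (S(4 := D)) (T(10 := drop 2 (T 10)))"
          using 1 2 n0 r0 t0[of "length ?lt"] by (intro Q) (auto intro: kth_filter_less simp: mset_filter)
        then show "wp select_loop (\<lambda>t'. Q (t0 + (t1 + 1 + (t2 + t') + 1))) n2 r2 (S(4 := ?lt @ D, 4 := D)) (T(10 := drop 2 (T 10)))"
          by (simp add: add_ac)
      qed (use 1 S n T in auto)
    next
      fix t1 n1 r1 j
      assume 1: "t1 \<le> 13 * length L + 20" "agree 10 n1 n0" "agree 3 r1 r0"
        "n1 12 = 0" "n1 11 = j" "n1 10 = length ?gt" "1 \<le> j" "k = length (filter (\<lambda>x. x \<le> r0 3) L) + j"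
      have "length (filter (\<lambda>x. x \<le> r0 3) L) + length ?gt = length L" by (induction L) auto
      then have j: "j \<le> length ?gt" using 1(8) n(5) by linarith
      show "wp select_loop (\<lambda>t'. Q (t0 + (t1 + 1 + t' + 1))) n1 r1 (S(4 := ?gt @ D)) T"
      proof (rule less(1)[OF sm(2)])
        fix t2 n2 r2
        assume 2: "t2 \<le> 900 * length ?gt" "agree 10 n2 n1" "agree 3 r2 r1"
          "resumed n2 (T 10)" "kth j (mset ?gt) (r2 3)"
        have "kth k (mset L) (r2 3)"
          using kth_filter_greater[of j "r0 3" "mset L" "r2 3"] 2(5) 1(8) by (simp flip: mset_filter)
        then have "wp select_loop (\<lambda>t'. Q (t0 + (t1 + 1 + t2 + 1) + t')) n2 r2 (S(4 := D)) (T(10 := drop 2 (T 10)))"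
          using 1 2 n0 r0 t0[of "length ?gt"] by (intro Q) auto
        then show "wp select_loop (\<lambda>t'. Q (t0 + (t1 + 1 + (t2 + t') + 1))) n2 r2 (S(4 := ?gt @ D, 4 := D)) (T(10 := drop 2 (T 10)))"
          by (simp add: add_ac)
      qed (use 1 j S n T in auto)
    next
      fix t1 n1 r1
      assume 1: "t1 \<le> 13 * length L + 20" "agree 10 n1 n0" "agree 3 r1 r0"
        "r1 3 = r0 3" "resumed n1 (T 10)" "kth k (mset L) (r0 3)"
      have "wp select_loop (\<lambda>t'. Q (t0 + (t1 + 1 + 1) + t')) n1 r1 (S(4 := D)) (T(10 := drop 2 (T 10)))"
        using 1 n0 r0 t0[of 0] by (intro Q) auto
      then show "wp select_loop (\<lambda>t'. Q (t0 + (t1 + 1 + t' + 1))) n1 r1 (S(4 := D)) (T(10 := drop 2 (T 10)))"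
        by (simp add: add_ac)
    qed
  qed (use n0 in auto)
  show ?case
  proof (intro step find)
    show "n 12 < 2" "n 12 = 0" using n by auto
    show "wp find_pivot (\<lambda>t. wp select_loop (\<lambda>t'. Q (t + 1 + t' + 1))) n r S T"
    proof (cases "length L < 64")
      case True
      have L: "L \<noteq> []" using n by auto
      let ?p = "hd L"
      have hd: "?p \<in> set L" using L by simp
      have sm: "length (filter (\<lambda>x. x < ?p) L) < length L" "length (filter (\<lambda>x. ?p < x) L) < length L"
        using hd by (auto intro: length_filter_less)
      show ?thesis
      proof (rule wp_find_pivot_small)
        show "n 10 < 64" "S 4 \<noteq> []" using True n S L by auto
        fix t :: nat assume t: "t \<le> 4"
        \<comment> \<open>A short list may lose nothing but its pivot. The saving of 900 pays for a
          whole round on at most 63 elements, as \<open>6 + 13 * 63 + 22 = 847\<close>.\<close>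
        have "wp select_loop (\<lambda>t'. Q ((t + 2) + t')) (n(12 := 1)) (r(3 := ?p)) S T"
          by (rule pivot) (use n sm t True L in auto)
        then show "wp select_loop (\<lambda>t'. Q (t + 1 + t' + 1)) (n(12 := 1)) (r(3 := hd (S 4))) S T"
          using S(1) L by (simp add: add_ac)
      qed
    next
      case False
      let ?m = "length L div 9"
      show ?thesis
      proof (rule wp_find_pivot_large[where L = L and D = D and S = S and n = n, OF S n(2,3)])
        show "64 \<le> length L" using False by simp
        fix t1 n1 r1
        let ?S = "S(4 := ninthers L @ L @ D)" and ?T = "T(10 := k # length L # T 10)"
        assume 1: "t1 \<le> 34 * length L + 30" "agree 10 n1 n" "agree 10 r1 r"
          "n1 12 = n 12" "n1 10 = ?m" "n1 11 = ?m div 2 + 1"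
        have m: "7 \<le> ?m" "?m < length L" "length L \<le> 9 * ?m + 8" using False by auto
        show "wp select_loop (\<lambda>t'. Q (t1 + 1 + t' + 1)) n1 r1 ?S ?T"
        proof (rule less(1)[of "ninthers L" _ "L @ D"])
          fix t2 n2 r2
          assume 2: "t2 \<le> 900 * length (ninthers L)" "agree 10 n2 n1"
            "agree 3 r2 r1" "resumed n2 (?T 10)" "kth (?m div 2 + 1) (mset (ninthers L)) (r2 3)"
          note sp = pivot_splits[OF 2(5)]
          have "wp select_loop (\<lambda>t'. Q ((t1 + 2 + t2) + t')) n2 r2 S T"
          proof (rule pivot)
            \<comment> \<open>The two recursions have sizes \<open>?m\<close> and at most
              \<open>length L - 2 * ?m\<close>, which leaves \<open>900 * ?m\<close> steps for the
              remaining \<open>47 * length L + 54\<close>. This is enough as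
              \<open>length L \<le> 9 * ?m + 8\<close>.\<close>
            fix l assume "l = length (filter (\<lambda>x. x < r2 3) L) \<or> l = length (filter (\<lambda>x. r2 3 < x) L) \<or> l = 0"
            then have "l + 2 * ?m \<le> length L" using sp by auto
            then show "t1 + 2 + t2 + (13 * length L + 22) + 900 * l \<le> 900 * length L"
              using 1(1) 2(1) m unfolding length_ninthers by linarith
          qed (use 1 2 sp m in \<open>auto simp: resumed_def\<close>)
          moreover have "?S(4 := L @ D) = S" "?T(10 := drop 2 (?T 10)) = T"
            using S by (auto simp: fun_eq_iff)
          ultimately show "wp select_loop (\<lambda>t'. Q (t1 + 1 + (t2 + t') + 1)) n2 r2 (?S(4 := L @ D)) (?T(10 := drop 2 (?T 10)))"
            by (simp add: add_ac)
        qed (use 1 m S n in \<open>auto simp: length_ninthers\<close>)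
      qed
    qed
  qed
qed

lemma wp_select:
  assumes "S 4 = L @ D" "S 5 = []" "S 6 = []" "n 10 = length L" "n 11 = k" "1 \<le> k" "k \<le> length L" "T 10 = []"
    and Q: "\<And>t n' r'. t \<le> 900 * length L + 2 \<Longrightarrow> agree 10 n' n \<Longrightarrow>
      agree 3 r' r \<Longrightarrow> kth k (mset L) (r' 3) \<Longrightarrow> Q t n' r' (S(4 := D)) T"
  shows "wp select Q n r S T"
  unfolding select_def
proof (intro wp_Seq wp_NAssign)
  show "wp select_loop (\<lambda>t'. Q (1 + t')) (n(12 := nval (NConst 0) (view n r S T))) r S T"
  proof (rule wp_select_loop[where L = L and D = D and S = S, OF assms(1-3)])
    fix t n' r'
    assume 1: "t \<le> 900 * length L" "agree 10 n' (n(12 := nval (NConst 0) (view n r S T)))"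
      "agree 3 r' r" "resumed n' (T 10)" "kth k (mset L) (r' 3)"
    have "T(10 := drop 2 (T 10)) = T" using assms(8) by (auto simp: fun_eq_iff)
    moreover have "n' 12 = 2" using 1(4) assms(8) by (simp add: resumed_def)
    ultimately show "wp select_loop (\<lambda>t'. Q (1 + (t + t'))) n' r' (S(4 := D)) (T(10 := drop 2 (T 10)))"
      unfolding select_loop_def using 1
      by (intro wp_While) (auto simp: regv_def intro!: Q)
  qed (use assms in auto)
qed simp_all

section \<open>Sampling the matrix of sums\<close>

lemma filter_mset_empty_iff: "filter_mset P M = {#} \<longleftrightarrow> (\<forall>x \<in># M. \<not> P x)"
  by (induction M) auto

definition all_sums :: "real list \<Rightarrow> real list \<Rightarrow> real multiset" where
  "all_sums X Y = (\<Sum>x\<leftarrow>X. image_mset ((+) x) (mset Y))"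

text \<open>Index pairs make it possible to count entries by injections and coverings.\<close>

definition cells :: "(real \<Rightarrow> bool) \<Rightarrow> real list \<Rightarrow> real list \<Rightarrow> (nat \<times> nat) set" where
  "cells P X Y = {(i, j). i < length X \<and> j < length Y \<and> P (X ! i + Y ! j)}"

lemma finite_cells: "finite (cells P X Y)"
  by (rule finite_subset[of _ "{..<length X} \<times> {..<length Y}"]) (auto simp: cells_def)

lemma all_sums_simps [simp]:
  "all_sums [] Y = {#}"
  "all_sums (x # X) Y = image_mset ((+) x) (mset Y) + all_sums X Y"
  "all_sums (X @ X') Y = all_sums X Y + all_sums X' Y"
  by (simp_all add: all_sums_def)

lemma all_sums_append: "all_sums X (Y @ Y') = all_sums X Y + all_sums X Y'"
  by (induction X) auto

lemma in_all_sums: "z \<in># all_sums X Y \<longleftrightarrow> (\<exists>x\<in>set X. \<exists>y\<in>set Y. z = x + y)"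
  by (induction X) auto

lemma size_all_sums: "size (all_sums X Y) = length X * length Y"
  by (induction X) auto

lemma size_filter_all_sums: "size {#z \<in># all_sums X Y. P z#} = card (cells P X Y)"
proof -
  have "size {#z \<in># all_sums X Y. P z#} = (\<Sum>x\<leftarrow>X. length (filter (\<lambda>y. P (x + y)) Y))"
    by (induction X) (auto simp: filter_mset_image_mset simp flip: mset_filter)
  also have "\<dots> = (\<Sum>i<length X. card {j. j < length Y \<and> P (X ! i + Y ! j)})"
    by (simp add: sum_list_sum_nth length_filter_conv_card atLeast0LessThan)
  also have "\<dots> = card (SIGMA i:{..<length X}. {j. j < length Y \<and> P (X ! i + Y ! j)})"
    by simp
  also have "(SIGMA i:{..<length X}. {j. j < length Y \<and> P (X ! i + Y ! j)}) = cells P X Y"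
    by (auto simp: cells_def)
  finally show ?thesis .
qed

fun odds :: "real list \<Rightarrow> real list" where
  "odds (x # y # xs) = y # odds xs"
| "odds _ = []"

lemma length_odds: "length (odds xs) = length xs div 2"
  by (induction xs rule: odds.induct) auto

lemma nth_odds: "i < length xs div 2 \<Longrightarrow> odds xs ! i = xs ! (2 * i + 1)"
proof (induction xs arbitrary: i rule: odds.induct)
  case (1 x y xs)
  then show ?case by (cases i) auto
qed auto

lemma set_odds: "set (odds xs) \<subseteq> set xs"
  by (induction xs rule: odds.induct) auto

lemma sorted_odds: "sorted xs \<Longrightarrow> sorted (odds xs)"
  by (induction xs rule: odds.induct) (use set_odds in fastforce)+

text \<open>A sampled entry is the largest of a block of four entries, and it is at most as large
  as the entries of the next block on the diagonal.\<close>

lemma card_cells_odds: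
  assumes "sorted X" "sorted Y" "length X = 2 * m" "length Y = 2 * m"
    and P: "\<And>z z'. P z \<Longrightarrow> z' \<le> z \<Longrightarrow> P z'"
  shows "4 * card (cells P (odds X) (odds Y)) \<le> card (cells P X Y)"
    "card (cells P X Y) \<le> 4 * card (cells P (odds X) (odds Y)) + 8 * m"
proof -
  let ?C = "cells P X Y" and ?O = "cells P (odds X) (odds Y)" and ?B = "{..<2::nat} \<times> {..<2::nat}"
  have lo: "length (odds X) = m" "length (odds Y) = m" using assms by (auto simp: length_odds)
  have O: "(i, j) \<in> ?O \<longleftrightarrow> i < m \<and> j < m \<and> P (X ! (2 * i + 1) + Y ! (2 * j + 1))" for i j
    using assms(3,4) lo by (auto simp: cells_def nth_odds)
  have mono: "X ! i \<le> X ! i'" "Y ! i \<le> Y ! i'" if "i \<le> i'" "i' < 2 * m" for i i'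
    using assms that by (auto intro: sorted_nth_mono)
  have fin: "finite ?O" "finite ?C" by (rule finite_cells)+
  have card: "card (?O \<times> ?B) = 4 * card ?O" by (simp add: card_cartesian_product)
  let ?f = "\<lambda>((i, j), (a, b)). (2 * i + a, 2 * j + b) :: nat \<times> nat"
  have "inj_on ?f (?O \<times> ?B)"
    by (rule inj_onI) (clarsimp, presburger)
  moreover have "?f ` (?O \<times> ?B) \<subseteq> ?C"
  proof clarsimp
    fix i j a b :: nat
    assume a: "(i, j) \<in> ?O" "a < 2" "b < 2"
    then have "i < m" "j < m" "P (X ! (2 * i + 1) + Y ! (2 * j + 1))" using O by auto
    moreover have "X ! (2 * i + a) \<le> X ! (2 * i + 1)" "Y ! (2 * j + b) \<le> Y ! (2 * j + 1)"
      using a \<open>i < m\<close> \<open>j < m\<close> by (auto intro: mono)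
    ultimately show "(2 * i + a, 2 * j + b) \<in> ?C"
      using a assms(3,4) unfolding cells_def by (auto intro: P add_mono)
  qed
  ultimately show "4 * card ?O \<le> card ?C"
    using card_inj_on_le[of ?f "?O \<times> ?B" ?C] fin card by simp
  \<comment> \<open>\<open>?g\<close> shifts each block by 2 in both directions, to its successor on
    the diagonal. Only the first two rows and columns, at most \<open>8 * m\<close> cells, have no
    predecessor.\<close>
  let ?g = "\<lambda>((i, j), (a, b)). (2 * i + 2 + a, 2 * j + 2 + b) :: nat \<times> nat"
  let ?E = "{..<2} \<times> {..<2 * m} \<union> {..<2 * m} \<times> {..<2}"
  have "?C \<subseteq> ?E \<union> ?g ` (?O \<times> ?B)"
  proof (rule subsetI)
    fix c assume "c \<in> ?C"
    then obtain i j where c: "c = (i, j)" and l: "i < 2 * m" "j < 2 * m" "P (X ! i + Y ! j)"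
      using assms by (auto simp: cells_def)
    show "c \<in> ?E \<union> ?g ` (?O \<times> ?B)"
    proof (cases "c \<in> ?E")
      case False
      then have g: "2 \<le> i" "2 \<le> j" using l c by auto
      let ?i = "i div 2 - 1" and ?j = "j div 2 - 1"
      have "X ! (2 * ?i + 1) \<le> X ! i" "Y ! (2 * ?j + 1) \<le> Y ! j"
        using g l by (auto intro!: mono)
      then have "(?i, ?j) \<in> ?O" using l g unfolding O by (auto intro: P add_mono)
      moreover have "x = 2 * (x div 2 - 1) + 2 + x mod 2" if "2 \<le> x" for x :: nat using that by presburger
      then have "(i, j) = ?g ((?i, ?j), (i mod 2, j mod 2))" using g by simp
      ultimately have "(i, j) \<in> ?g ` (?O \<times> ?B)"
        by (intro image_eqI[of _ _ "((?i, ?j), (i mod 2, j mod 2))"]) auto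
      then show ?thesis using c by blast
    qed simp
  qed
  then have "card ?C \<le> card (?E \<union> ?g ` (?O \<times> ?B))" using fin by (intro card_mono) auto
  also have "\<dots> \<le> card ?E + card (?g ` (?O \<times> ?B))" by (rule card_Un_le)
  also have "card (?g ` (?O \<times> ?B)) \<le> 4 * card ?O" using card card_image_le[of "?O \<times> ?B" ?g] fin by simp
  also have "card ?E \<le> card ({..<2::nat} \<times> {..<2 * m}) + card ({..<2 * m} \<times> {..<2::nat})"
    by (rule card_Un_le)
  also have "\<dots> = 8 * m" by (simp add: card_cartesian_product)
  finally show "card ?C \<le> 4 * card ?O + 8 * m" by simp
qed

lemma size_mid:
  assumes "a < (b::real)"
  shows "size {#x \<in># M. a < x \<and> x < b#} + size {#x \<in># M. x \<le> a#} = size {#x \<in># M. x < b#}"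
proof -
  have "{#x \<in># M. x < b#} = {#x \<in># M. a < x \<and> x < b#} + {#x \<in># M. x \<le> a#}"
    using assms by (induction M) auto
  then show ?thesis by simp
qed

text \<open>Ranks of the entries of the sample that enclose the entries of ranks \<open>k1\<close> and \<open>k2\<close>.
  If the first rank is 0, the smallest entry of the matrix is the lower bound.\<close>

locale sample =
  fixes X Y :: "real list" and m k1 k2 r1 r2 :: nat and a b :: real
  assumes XY: "sorted X" "sorted Y" "length X = 2 * m" "length Y = 2 * m" "1 \<le> m"
    and k: "k1 \<le> k2" "1 \<le> k2" "k2 \<le> k1 + 16 * m"
    and r1: "r1 = (k1 + 3) div 4 - 2 * m" and r2: "r2 = (k2 + 3) div 4"
    and a: "1 \<le> r1 \<Longrightarrow> kth r1 (all_sums (odds X) (odds Y)) a" "r1 = 0 \<Longrightarrow> a = X ! 0 + Y ! 0"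
    and b: "kth r2 (all_sums (odds X) (odds Y)) b"
begin

lemma count_odds:
  "4 * size {#z \<in># all_sums (odds X) (odds Y). z \<le> v#} \<le> size {#z \<in># all_sums X Y. z \<le> v#}"
  "size {#z \<in># all_sums X Y. z < v#} \<le> 4 * size {#z \<in># all_sums (odds X) (odds Y). z < v#} + 8 * m"
  using card_cells_odds[OF XY(1-4), of "\<lambda>z. z < v"] card_cells_odds[OF XY(1-4), of "\<lambda>z. z \<le> v"]
  by (simp_all add: size_filter_all_sums)

text \<open>\<open>(k1 + 3) div 4\<close> is \<open>k1 / 4\<close> rounded up. Lowering it by
  \<open>2 * m\<close> makes up for the \<open>8 * m\<close> cells lost by sampling, since
  \<open>4 * (r1 - 1) + 8 * m < k1\<close>. The rank \<open>k1\<close> may itself be 0 after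
  truncation; \<open>max 1 k1\<close> then asks for a lower bound of the whole matrix.\<close>

lemma lower: "size {#z \<in># all_sums X Y. z < a#} < max 1 k1"
proof (cases "r1 = 0")
  case True
  have "\<not> z < a" if z: "z \<in># all_sums X Y" for z
  proof -
    obtain x y where "x \<in> set X" "y \<in> set Y" "z = x + y" using z by (auto simp: in_all_sums)
    moreover have "\<forall>x \<in> set X. X ! 0 \<le> x" "\<forall>y \<in> set Y. Y ! 0 \<le> y"
      using XY by (auto simp: in_set_conv_nth intro!: sorted_nth_mono)
    ultimately have "X ! 0 \<le> x" "Y ! 0 \<le> y" "z = x + y" by blast+
    then show ?thesis using a(2)[OF True] by linarith
  qed
  then have "size {#z \<in># all_sums X Y. z < a#} = 0" by (auto simp: filter_mset_empty_iff)
  then show ?thesis by linarith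
next
  case False
  then have "size {#z \<in># all_sums (odds X) (odds Y). z < a#} < r1" using a(1) by (auto simp: kth_def)
  then show ?thesis using count_odds(2)[of a] False r1 by linarith
qed

lemma upper: "k2 \<le> size {#z \<in># all_sums X Y. z \<le> b#}"
  using b count_odds(1)[of b] r2 unfolding kth_def by linarith

lemma a_le_b: "a \<le> b"
proof (rule ccontr)
  assume "\<not> a \<le> b"
  then have "size {#z \<in># all_sums X Y. z \<le> b#} \<le> size {#z \<in># all_sums X Y. z < a#}"
    by (intro size_mset_mono filter_mset_mono_strong) auto
  then show False using lower upper k by linarith
qed

text \<open>The ranks in the sample are at most \<open>6 * m\<close> apart: \<open>4 * m\<close>
  from a quarter of the old gap and \<open>2 * m\<close> from lowering the first. Four times this,
  plus the \<open>8 * m\<close> cells lost by sampling, gives \<open>32 * m\<close>.\<close>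

lemma size_between: "size {#z \<in># all_sums X Y. a < z \<and> z < b#} \<le> 32 * m"
proof (cases "a < b")
  case True
  have "size {#z \<in># all_sums X Y. z < b#} \<le> 4 * (r2 - 1) + 8 * m"
    using b count_odds(2)[of b] unfolding kth_def by linarith
  moreover have "4 * r1 \<le> size {#z \<in># all_sums X Y. z \<le> a#}"
    using a(1) count_odds(1)[of a] unfolding kth_def by (cases "r1 = 0") auto
  moreover have "r2 \<le> r1 + 6 * m" using k r1 r2 by linarith
  ultimately show ?thesis using size_mid[OF True, of "all_sums X Y"] by linarith
next
  case False
  then have "size {#z \<in># all_sums X Y. a < z \<and> z < b#} = 0" by (auto simp: filter_mset_empty_iff)
  then show ?thesis by linarith
qed

end

text \<open>In \<open>L\<close> the bound \<open>a\<close> comes first and \<open>b\<close> last,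
  once each in place of all their ties. The element of rank \<open>k\<close> in \<open>M\<close>
  therefore has position \<open>k + 1 - l\<close> in \<open>L\<close>; clamping this to
  \<open>a\<close> or \<open>b\<close> is right when the rank falls among their ties. For
  \<open>a = b\<close> every choice is right, so \<open>l\<close> may then be anything.\<close>

lemma kth_between:
  assumes ab: "a \<le> b" and k: "size {#x \<in># M. x < a#} < k" "k \<le> size {#x \<in># M. x \<le> b#}"
    and l: "a < b \<Longrightarrow> l = size {#x \<in># M. x \<le> a#}"
    and L: "L = {#a, b#} + {#x \<in># M. a < x \<and> x < b#}"
    and v: "kth (max 1 (min (k + 1 - l) (size L))) L v"
  shows "kth k M v"
proof (cases "a = b")
  case True
  then have "v = a" using kth_mem[OF v] L by auto
  then show ?thesis using k True by (simp add: kth_def)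
next
  case False
  then have ab: "a < b" using ab by simp
  let ?L = "{#x \<in># M. a < x \<and> x < b#}"
  note l = l[OF ab]
  have sL: "size L = size ?L + 2" using L by simp
  have mid: "size ?L + l = size {#x \<in># M. x < b#}" using size_mid[OF ab, of M] l by simp
  consider "v = a" | "v = b" | "a < v" "v < b" using kth_mem[OF v] L by auto
  then show ?thesis
  proof cases
    case 1
    have "{#x \<in># L. x \<le> a#} = {#a#}" using ab L by (auto simp: filter_mset_eq_conv)
    then have "max 1 (min (k + 1 - l) (size L)) \<le> 1" using v 1 by (simp add: kth_def)
    then have "k \<le> l" using sL by linarith
    then show ?thesis using 1 k l by (simp add: kth_def)
  next
    case 2
    have "{#x \<in># L. x < b#} = {#a#} + ?L" using ab L by (auto simp: filter_filter_mset conj_commute conj_left_commute intro: filter_mset_cong)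
    then have "size ?L + 1 < max 1 (min (k + 1 - l) (size L))" using v 2 by (simp add: kth_def)
    then have "size ?L + l < k" using sL by linarith
    then show ?thesis using 2 k mid by (simp add: kth_def)
  next
    case 3
    have e: "{#x \<in># L. x < v#} = {#a#} + {#x \<in># ?L. x < v#}" "{#x \<in># L. x \<le> v#} = {#a#} + {#x \<in># ?L. x \<le> v#}"
      using 3 L by auto
    have "{#x \<in># M. x < v#} = {#x \<in># ?L. x < v#} + {#x \<in># M. x \<le> a#}"
      "{#x \<in># M. x \<le> v#} = {#x \<in># ?L. x \<le> v#} + {#x \<in># M. x \<le> a#}"
      using 3 by (induction M) auto
    then have M: "size {#x \<in># M. x < v#} = size {#x \<in># ?L. x < v#} + l"
      "size {#x \<in># M. x \<le> v#} = size {#x \<in># ?L. x \<le> v#} + l" using l by simp_all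
    have "size {#x \<in># ?L. x \<le> v#} \<le> size ?L" by (intro size_mset_mono) auto
    moreover have "size {#x \<in># L. x < v#} = size {#x \<in># ?L. x < v#} + 1"
      "size {#x \<in># L. x \<le> v#} = size {#x \<in># ?L. x \<le> v#} + 1" unfolding e by simp_all
    ultimately show ?thesis using v sL unfolding kth_def M by linarith
  qed
qed

text \<open>Ties between \<open>M\<close> and \<open>R\<close> are harmless: if some element of
  \<open>R\<close> is at most \<open>v\<close>, then all of \<open>M\<close> is, and there are at
  least \<open>k\<close> of them.\<close>

lemma kth_padded:
  assumes "kth k (M + R) v" "k \<le> size M" "\<And>x y. x \<in># M \<Longrightarrow> y \<in># R \<Longrightarrow> x \<le> y"
  shows "kth k M v"
proof -
  have "k \<le> size {#x \<in># M. x \<le> v#}"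
  proof (cases "\<exists>y \<in># R. y \<le> v")
    case True
    then have "{#x \<in># M. x \<le> v#} = M" using assms(3) by (fastforce simp: filter_mset_eq_conv)
    then show ?thesis using assms(2) by simp
  next
    case False
    then have "size {#x \<in># R. x \<le> v#} = 0" by (auto simp: filter_mset_empty_iff)
    moreover have "k \<le> size {#x \<in># M. x \<le> v#} + size {#x \<in># R. x \<le> v#}"
      using assms(1) by (simp add: kth_def)
    ultimately show ?thesis by linarith
  qed
  then show ?thesis using assms(1) by (simp add: kth_def)
qed

lemma kth_imp_is_kth_smallest:
  assumes "kth k M v" "1 \<le> k"
  shows "is_kth_smallest k M v"
proof -
  obtain zs where zs: "M = mset zs" "sorted zs"
    by (metis mset_sorted_list_of_multiset sorted_sorted_list_of_multiset)
  have c: "length (filter (\<lambda>x. x < v) zs) < k" "k \<le> length (filter (\<lambda>x. x \<le> v) zs)"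
    using assms(1) unfolding kth_def zs(1) by (simp_all flip: mset_filter)
  then have k: "k \<le> length zs" using length_filter_le[of "\<lambda>x. x \<le> v" zs] by linarith
  let ?z = "zs ! (k - 1)"
  have "\<not> ?z < v"
  proof
    assume z: "?z < v"
    have "{..<k} \<subseteq> {i. i < length zs \<and> zs ! i < v}"
    proof
      fix i assume "i \<in> {..<k}"
      then have "zs ! i \<le> ?z" "i < length zs" using k zs(2) by (auto intro: sorted_nth_mono)
      with z show "i \<in> {i. i < length zs \<and> zs ! i < v}" by simp
    qed
    then have "card {..<k} \<le> card {i. i < length zs \<and> zs ! i < v}" by (intro card_mono) auto
    then show False using c(1) by (simp add: length_filter_conv_card)
  qed
  moreover have "\<not> v < ?z"
  proof
    assume z: "v < ?z"
    have "{i. i < length zs \<and> zs ! i \<le> v} \<subseteq> {..<k - 1}"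
    proof
      fix i assume i: "i \<in> {i. i < length zs \<and> zs ! i \<le> v}"
      have "?z \<le> zs ! i" if "k - 1 \<le> i" using that i zs(2) by (auto intro: sorted_nth_mono)
      with i z show "i \<in> {..<k - 1}" by force
    qed
    then have "card {i. i < length zs \<and> zs ! i \<le> v} \<le> card {..<k - 1}" by (intro card_mono) auto
    then show False using c(2) assms(2) by (simp add: length_filter_conv_card)
  qed
  ultimately show ?thesis unfolding is_kth_smallest_def using zs k assms(2)
    by (intro exI[of _ zs]) auto
qed

lemma size_filter_entries:
  "size {#z \<in># entries (length Y) (length X) (sum_matrix X Y). P z#} = size {#z \<in># all_sums X Y. P z#}"
proof -
  have "size {#z \<in># entries (length Y) (length X) (sum_matrix X Y). P z#} =
    card {(j, i). j < length Y \<and> i < length X \<and> P (X ! i + Y ! j)}"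
    by (auto simp: entries_def sum_matrix_def filter_mset_image_mset intro!: arg_cong[where f = card])
  also have "\<dots> = card (cells P X Y)"
    by (rule bij_betw_same_card[of prod.swap]) (auto simp: bij_betw_def inj_on_def cells_def image_iff)
  finally show ?thesis by (simp add: size_filter_all_sums)
qed

section \<open>Walking along the staircase\<close>

text \<open>The bounds are in the real registers 0 and 1, the current element of \<open>X\<close> in register 3.
  Stack 8 contains the elements of \<open>Y\<close> whose sum with it is not known to be too large, in
  descending order. Stacks 4 and 7 receive the sums between the bounds, register 10 their
  number, and register 9 the number of sums that are at most the lower bound.\<close>

definition drop_loop :: com where
  "drop_loop = While (BAnd (NLess (NConst 0) (NReg 15)) (nonempty 8)) (rpop 8 11 ;;
      Cond (RLess (RAdd (RReg 3) (RReg 11)) (RReg 1)) (rpush 8 11 ;; NAssign 15 (NConst 0)) Skip)"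

definition drop_large :: com where
  "drop_large = NAssign 15 (NConst 1) ;; drop_loop"

text \<open>An element has to be popped to be inspected, so the first one that may stay is pushed
  back, and clearing register 15 ends the loop. The additive constant pays for this.\<close>

lemma wp_drop_large:
  assumes Q: "\<And>t v w. t \<le> 4 * (length (S 8) - length (dropWhile (\<lambda>y. r 1 \<le> r 3 + y) (S 8))) + 8 \<Longrightarrow>
      Q t (n(15 := v)) (r(11 := w)) (S(8 := dropWhile (\<lambda>y. r 1 \<le> r 3 + y) (S 8))) T"
  shows "wp drop_large Q n r S T"
proof -
  let ?d = "\<lambda>r. dropWhile (\<lambda>y. r 1 \<le> r 3 + y)"
  have stop: "wp drop_loop Q n r S T" if "n 15 = 0 \<or> S 8 = []" "Q 1 n r S T" for Q n r S
    unfolding drop_loop_def by (rule wp_While) (use that in \<open>auto simp: eval_simps\<close>)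
  have *: "wp drop_loop Q n r S T"
    if "n 15 = 1" "S 8 = zs" "\<And>t n' v w. t \<le> 4 * (length zs - length (?d r zs)) + 7 \<Longrightarrow>
      n' = n(15 := v) \<Longrightarrow> Q t n' (r(11 := w)) (S(8 := ?d r zs)) T" for Q n r S zs
    using that
  proof (induction zs arbitrary: Q r S)
    case Nil
    have "S(8 := []) = S" using Nil by (auto simp: fun_eq_iff)
    then have "Q 1 n r S T" using Nil(3)[of 1 n 1 "r 11"] Nil(1) by (simp add: fun_upd_idem)
    with Nil show ?case by (intro stop) auto
  next
    case (Cons y zs)
    note Q = Cons.prems(3)
    show ?case
    proof (cases "r 1 \<le> r 3 + y")
      case True
      let ?r = "r(11 := y)" and ?S = "S(8 := zs)"
      have "wp drop_loop (\<lambda>t. Q (Suc (Suc (Suc (Suc t))))) n ?r ?S T"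
      proof (rule Cons.IH)
        fix t n' v w
        assume t: "t \<le> 4 * (length zs - length (?d ?r zs)) + 7" "n' = n(15 := v)"
        have "length (?d r zs) \<le> length zs" by (rule length_dropWhile_le)
        then have "Q (Suc (Suc (Suc (Suc t)))) n' (r(11 := w)) (S(8 := ?d r (y # zs))) T"
          using t True by (intro Q) (auto simp: Suc_diff_le)
        then show "Q (Suc (Suc (Suc (Suc t)))) n' (?r(11 := w)) (?S(8 := ?d ?r zs)) T"
          using True by simp
      qed (use Cons.prems(1) in auto)
      then show ?thesis using Cons.prems(1,2) True unfolding drop_loop_def
        by - ((rule wp_While; (intro wp_intros)?), (auto simp: eval_simps))
    next
      case False
      have "S(8 := y # zs) = S" using Cons.prems(2) by (auto simp: fun_eq_iff)
      moreover have "Q (Suc (Suc (Suc (Suc (Suc (Suc 0)))))) (n(15 := 0)) (r(11 := y)) (S(8 := ?d r (y # zs))) T"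
        using False by (intro Q) auto
      ultimately have "wp drop_loop (\<lambda>t. Q (Suc (Suc (Suc (Suc (Suc t)))))) (n(15 := 0)) (r(11 := y)) S T"
        using False by (intro stop) auto
      then show ?thesis using Cons.prems(1,2) False \<open>S(8 := y # zs) = S\<close> unfolding drop_loop_def
        by - ((rule wp_While; (intro wp_intros)?), (auto simp: eval_simps numeral_eq_Suc))
    qed
  qed
  show ?thesis
    unfolding drop_large_def
  proof (intro wp_Seq wp_NAssign *[OF _ refl])
    fix t n' v w
    assume "t \<le> 4 * (length (S 8) - length (?d r (S 8))) + 7"
      "n' = n(15 := nval (NConst 1) (view n r S T), 15 := v)"
    then show "Q (1 + t) n' (r(11 := w)) (S(8 := ?d r (S 8))) T"
      using Q[of "1 + t" v w] by simp
  qed simp_all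
qed

definition take_loop :: com where
  "take_loop = While (BAnd (NLess (NConst 0) (NReg 15)) (nonempty 8)) (rpop 8 11 ;;
      RAssign 12 (RAdd (RReg 3) (RReg 11)) ;;
      Cond (RLess (RReg 0) (RReg 12))
        (rpush 9 11 ;; rpush 4 12 ;; rpush 7 12 ;; NAssign 10 (NAdd (NReg 10) (NConst 1)))
        (rpush 8 11 ;; NAssign 15 (NConst 0)))"

definition take_between :: com where
  "take_between = NAssign 15 (NConst 1) ;; take_loop"

lemma wp_take_between:
  assumes Q: "\<And>t v r' us zs. S 8 = us @ zs \<Longrightarrow> us = takeWhile (\<lambda>y. r 0 < r 3 + y) (S 8) \<Longrightarrow>
      zs = dropWhile (\<lambda>y. r 0 < r 3 + y) (S 8) \<Longrightarrow> t \<le> 8 * length us + 8 \<Longrightarrow> agree 10 r' r \<Longrightarrow>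
      Q t (n(15 := v, 10 := n 10 + length us)) r' (S(8 := zs, 9 := rev us @ S 9,
        4 := rev (map ((+) (r 3)) us) @ S 4, 7 := rev (map ((+) (r 3)) us) @ S 7)) T"
  shows "wp take_between Q n r S T"
proof -
  let ?P = "\<lambda>r. (\<lambda>y. r 0 < r 3 + y)"
  let ?S = "\<lambda>r S zs us. S(8 := dropWhile (?P r) zs, 9 := rev us @ S 9,
        4 := rev (map ((+) (r 3)) us) @ S 4, 7 := rev (map ((+) (r 3)) us) @ S 7)"
  have stop: "wp take_loop Q n r S T" if "n 15 = 0 \<or> S 8 = []" "Q 1 n r S T" for Q n r S
    unfolding take_loop_def by (rule wp_While) (use that in \<open>auto simp: eval_simps\<close>)
  have *: "wp take_loop Q n r S T"
    if "n 15 = 1" "S 8 = zs" "\<And>t n' v r' S'. t \<le> 8 * length (takeWhile (?P r) zs) + 7 \<Longrightarrow>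
      n' = n(15 := v, 10 := n 10 + length (takeWhile (?P r) zs)) \<Longrightarrow> agree 10 r' r \<Longrightarrow>
      S' = ?S r S zs (takeWhile (?P r) zs) \<Longrightarrow> Q t n' r' S' T" for Q n r S zs
    using that
  proof (induction zs arbitrary: Q n r S)
    case Nil
    have "Q 1 n r S T" by (rule Nil(3)[of _ _ 1]) (use Nil in \<open>auto simp: fun_eq_iff\<close>)
    with Nil show ?case by (intro stop) auto
  next
    case (Cons y zs)
    note Q = Cons.prems(3)
    show ?case
    proof (cases "r 0 < r 3 + y")
      case True
      let ?r = "r(11 := y, 12 := r 3 + y)" and ?n = "n(10 := Suc (n 10))"
      let ?S' = "S(8 := zs, 9 := y # S 9, 4 := (r 3 + y) # S 4, 7 := (r 3 + y) # S 7)"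
      have "wp take_loop (\<lambda>t. Q (Suc (Suc (Suc (Suc (Suc (Suc (Suc (Suc t)))))))) ) ?n ?r ?S' T"
      proof (rule Cons.IH)
        fix t n' v r' S'
        assume t: "t \<le> 8 * length (takeWhile (?P ?r) zs) + 7"
          "n' = ?n(15 := v, 10 := ?n 10 + length (takeWhile (?P ?r) zs))" "agree 10 r' ?r"
          "S' = ?S ?r ?S' zs (takeWhile (?P ?r) zs)"
        show "Q (Suc (Suc (Suc (Suc (Suc (Suc (Suc (Suc t)))))))) n' r' S' T"
          by (rule Q[of _ _ v]) (use t True in \<open>auto simp: fun_eq_iff\<close>)
      qed (use Cons.prems(1) in auto)
      then show ?thesis using Cons.prems(1,2) True unfolding take_loop_def
        by - ((rule wp_While; (intro wp_intros)?), (auto simp: eval_simps fun_upd_twist))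
    next
      case False
      have S: "S(8 := y # zs) = S" using Cons.prems(2) by (auto simp: fun_eq_iff)
      have "Q (Suc (Suc (Suc (Suc (Suc (Suc (Suc 0))))))) (n(15 := 0)) (r(11 := y, 12 := r 3 + y)) S T"
        by (rule Q[of _ _ 0]) (use False Cons.prems(2) in \<open>auto simp: fun_eq_iff\<close>)
      then have "wp take_loop (\<lambda>t. Q (Suc (Suc (Suc (Suc (Suc (Suc t))))))) (n(15 := 0)) (r(11 := y, 12 := r 3 + y)) S T"
        by (intro stop) auto
      then show ?thesis using Cons.prems(1,2) False S unfolding take_loop_def
        by - ((rule wp_While; (intro wp_intros)?), (auto simp: eval_simps numeral_eq_Suc))
    qed
  qed
  show ?thesis
    unfolding take_between_def
  proof (intro wp_Seq wp_NAssign *[OF _ refl])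
    fix t n' v r' S'
    assume a: "t \<le> 8 * length (takeWhile (?P r) (S 8)) + 7"
      "n' = n(15 := nval (NConst 1) (view n r S T), 15 := v,
        10 := (n(15 := nval (NConst 1) (view n r S T))) 10 + length (takeWhile (?P r) (S 8)))"
      "agree 10 r' r" "S' = ?S r S (S 8) (takeWhile (?P r) (S 8))"
    have n': "n' = n(15 := v, 10 := n 10 + length (takeWhile (?P r) (S 8)))" using a(2) by simp
    show "Q (1 + t) n' r' S' T"
      unfolding n' a(4) by (rule Q) (use a in auto)
  qed simp_all
qed

text \<open>On a descending list an upward closed predicate holds exactly on a prefix, so loops that
  look only at the top of a stack compute filters.\<close>

lemma dropWhile_sorted:
  assumes "sorted (rev zs)" "\<And>y y'. P y \<Longrightarrow> y \<le> y' \<Longrightarrow> P y'"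
  shows "dropWhile P zs = filter (\<lambda>y. \<not> P y) zs" "takeWhile P zs = filter P (zs :: real list)"
proof -
  have "dropWhile P zs = filter (\<lambda>y. \<not> P y) zs \<and> takeWhile P zs = filter P zs"
    using assms(1)
  proof (induction zs)
    case (Cons z zs)
    have *: "\<forall>y \<in> set zs. y \<le> z" "sorted (rev zs)" using Cons.prems by (auto simp: sorted_append)
    show ?case
    proof (cases "P z")
      case False
      then have "\<forall>y \<in> set zs. \<not> P y" using * assms(2) by blast
      then show ?thesis using False by (simp add: filter_empty_conv filter_id_conv)
    qed (use Cons.IH * in auto)
  qed simp
  then show "dropWhile P zs = filter (\<lambda>y. \<not> P y) zs" "takeWhile P zs = filter P zs" by auto
qed

text \<open>When register 9 is updated, stack 8 has only the elements whose sum is at most the lower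
  bound, so its height counts them at once. The elements set aside are then put back, as their sums
  with the next element of \<open>X\<close> may again lie between the bounds.\<close>

definition row :: com where
  "row = rpop 2 3 ;; drop_large ;; take_between ;; NAssign 9 (NAdd (NReg 9) (height 8)) ;;
    move_all 9 8 10 ;; decr 14"

lemma move_nothing:
  assumes "S i = []" "i \<noteq> j"
  shows "S = S(i := [], j := rev (S i) @ S j)"
  using assms by (auto simp: fun_eq_iff)

lemma wp_row:
  assumes "S 2 = x # XR" "S 8 = zs" "S 9 = []" "sorted (rev zs)" "r 0 = a" "r 1 = b"
    and Q: "\<And>t n' r' us zs'. zs' = filter (\<lambda>y. x + y < b) zs \<Longrightarrow> us = filter (\<lambda>y. a < x + y) zs' \<Longrightarrow>
      t \<le> 4 * (length zs - length zs') + 11 * length us + 22 \<Longrightarrow>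
      agree 9 n' n \<Longrightarrow> agree 3 r' r \<Longrightarrow>
      n' 9 = n 9 + length (filter (\<lambda>y. x + y \<le> a) zs') \<Longrightarrow> n' 10 = n 10 + length us \<Longrightarrow> n' 14 = n 14 - 1 \<Longrightarrow>
      Q t n' r' (S(2 := XR, 8 := zs', 4 := rev (map ((+) x) us) @ S 4, 7 := rev (map ((+) x) us) @ S 7)) T"
  shows "wp row Q n r S T"
proof -
  let ?zs = "filter (\<lambda>y. x + y < b) zs"
  let ?us = "filter (\<lambda>y. a < x + y) ?zs"
  let ?S = "S(2 := XR, 8 := ?zs, 4 := rev (map ((+) x) ?us) @ S 4, 7 := rev (map ((+) x) ?us) @ S 7)"
  have Q: "Q t n' r' S' T" if "t \<le> 4 * (length zs - length ?zs) + 11 * length ?us + 22"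
    "agree 9 n' n" "agree 3 r' r" "n' 9 = n 9 + length (filter (\<lambda>y. x + y \<le> a) ?zs)"
    "n' 10 = n 10 + length ?us" "n' 14 = n 14 - 1" "S' = ?S" for t n' r' S'
    unfolding that(7) by (rule Q[OF refl refl]) (use that in auto)
  have drop: "dropWhile (\<lambda>y. b \<le> x + y) zs = ?zs"
    using dropWhile_sorted(1)[OF assms(4), of "\<lambda>y. b \<le> x + y"] by (simp add: not_le)
  have sorted: "sorted (rev ?zs)" using assms(4) by (simp add: rev_filter sorted_wrt_filter)
  have split: "takeWhile (\<lambda>y. a < x + y) ?zs = ?us"
    "dropWhile (\<lambda>y. a < x + y) ?zs = filter (\<lambda>y. x + y \<le> a) ?zs"
    using dropWhile_sorted[OF sorted, of "\<lambda>y. a < x + y"] by (simp_all add: not_less)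
  show ?thesis
    unfolding row_def
  proof (rule wp_Seq, rule wp_rpop, simp, use assms in simp, intro wp_Seq wp_drop_large wp_take_between wp_NAssign)
    let ?r = "r(3 := hd (S 2))" and ?St = "S(2 := tl (S 2))"
    fix t0 v0 w0 t1 v1 r1 us zs'
    let ?n1 = "n(15 := v0)" and ?r1 = "?r(11 := w0)"
    let ?S1 = "?St(8 := dropWhile (\<lambda>y. ?r 1 \<le> ?r 3 + y) (?St 8))"
    assume 0: "t0 \<le> 4 * (length (?St 8) - length (dropWhile (\<lambda>y. ?r 1 \<le> ?r 3 + y) (?St 8))) + 8"
    assume 1: "?S1 8 = us @ zs'" "us = takeWhile (\<lambda>y. ?r1 0 < ?r1 3 + y) (?S1 8)"
      "zs' = dropWhile (\<lambda>y. ?r1 0 < ?r1 3 + y) (?S1 8)" "t1 \<le> 8 * length us + 8"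
      "agree 10 r1 ?r1"
    have S1: "?S1 8 = ?zs" using assms drop by simp
    have us: "us = ?us" using 1(2) unfolding S1 using assms split by simp
    have zs': "zs' = filter (\<lambda>y. x + y \<le> a) ?zs" using 1(3) unfolding S1 using assms split by simp
    have cat: "?us @ zs' = ?zs" using 1(1)[unfolded S1] unfolding us by (rule sym)
    have t0: "t0 \<le> 4 * (length zs - length ?zs) + 8" using 0 assms drop by simp
    let ?n2 = "?n1(15 := v1, 10 := ?n1 10 + length us)"
    let ?S2 = "?S1(8 := zs', 9 := rev us @ ?S1 9, 4 := rev (map ((+) (?r1 3)) us) @ ?S1 4,
      7 := rev (map ((+) (?r1 3)) us) @ ?S1 7)"
    let ?n3 = "?n2(9 := nval (NAdd (NReg 9) (height 8)) (view ?n2 r1 ?S2 T))"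
    have n3: "?n3 9 = n 9 + length zs'" by (simp add: eval_simps)
    have S2: "?S2 9 = rev ?us" "?S2 8 = zs'" using us assms by auto
    have fin: "?S2(9 := [], 8 := rev (?S2 9) @ ?S2 8) = ?S"
    proof -
      have "?r1 3 = x" using assms(1) by simp
      then have "?S2(9 := [], 8 := ?zs) = ?S" using assms(1,3) us by (simp add: fun_eq_iff)
      then show ?thesis unfolding S2 rev_rev_ident cat .
    qed
    have fin': "?S2 = ?S" if "?S2 9 = []"
      using move_nothing[of ?S2 9 8] that unfolding fin by simp
    show "wp (move_all 9 8 10) (\<lambda>t'. wp (decr 14) (\<lambda>t''. Q (1 + (t0 + (t1 + (1 + (t' + t''))))))) ?n3 r1 ?S2 T"
    proof (rule wp_move_all)
      fix t2 v2
      assume 2: "t2 \<le> 3 * length (?S2 9) + 1"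
      show "wp (decr 14) (\<lambda>t''. Q (1 + (t0 + (t1 + (1 + (t2 + t'')))))) ?n3 (r1(10 := v2))
          (?S2(9 := [], 8 := rev (?S2 9) @ ?S2 8)) T"
        unfolding fin
      proof (rule wp_NAssign)
        show "Q (1 + (t0 + (t1 + (1 + (t2 + 1))))) (?n3(14 := nval (NSub (NReg 14) (NConst 1)) (view ?n3 (r1(10 := v2)) ?S T)))
            (r1(10 := v2)) ?S T"
          using t0 1(4,5) 2 S2 us zs' n3 by (intro Q) (auto simp: regv_def)
      qed simp_all
    next
      assume "?S2 9 = []"
      note e = this
      show "wp (decr 14) (\<lambda>t''. Q (1 + (t0 + (t1 + (1 + (1 + t'')))))) ?n3 r1 ?S2 T"
      proof (rule wp_NAssign)
        show "Q (1 + (t0 + (t1 + (1 + (1 + 1))))) (?n3(14 := nval (NSub (NReg 14) (NConst 1)) (view ?n3 r1 ?S2 T)))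
            r1 ?S2 T"
          using t0 1(4,5) us zs' n3 by (intro Q fin'[OF e]) (auto simp: regv_def)
      qed simp_all
    qed simp_all
  qed simp_all
qed

lemma filter_all_sums_filter:
  assumes "\<And>x y. x \<in> set xs \<Longrightarrow> y \<in> set zs \<Longrightarrow> P (x + y) \<Longrightarrow> R y"
  shows "{#z \<in># all_sums xs (filter R zs). P z#} = {#z \<in># all_sums xs zs. P z#}"
  using assms
proof (induction xs)
  case (Cons x xs)
  have "{#y \<in># {#y \<in># mset zs. R y#}. P (x + y)#} = {#y \<in># mset zs. P (x + y)#}"
  proof -
    have "\<forall>y \<in> set zs. P (x + y) \<longrightarrow> R y" using Cons.prems by (meson list.set_intros(1))
    then show ?thesis by (auto simp: filter_filter_mset intro!: filter_mset_cong)
  qed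
  with Cons show ?case by (auto simp: filter_mset_image_mset)
qed simp

definition rows :: com where
  "rows = While (NLess (NConst 0) (NReg 14)) row"

text \<open>Each row costs a constant, plus the elements of \<open>Y\<close> that it discards for
  good, plus the sums that it collects. Discarding is safe because the remaining elements of
  \<open>X\<close> are no smaller. The count in register 9 is claimed only for \<open>a < b\<close>:
  if \<open>a = b\<close>, sums equal to \<open>a\<close> are discarded before they are
  counted.\<close>

lemma wp_rows:
  assumes "S 2 = xs @ XR" "S 8 = zs" "S 9 = []" "n 14 = length xs" "sorted (rev zs)" "sorted xs" "r 0 = a" "r 1 = b"
    and "\<And>t n' r' zs' L. mset L = {#z \<in># all_sums xs zs. a < z \<and> z < b#} \<Longrightarrow>
      t \<le> 23 * length xs + 4 * (length zs - length zs') + 11 * length L + 1 \<Longrightarrow> length zs' \<le> length zs \<Longrightarrow>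
      agree 9 n' n \<Longrightarrow> agree 3 r' r \<Longrightarrow>
      (a < b \<Longrightarrow> n' 9 = n 9 + size {#z \<in># all_sums xs zs. z \<le> a#}) \<Longrightarrow> n' 10 = n 10 + length L \<Longrightarrow>
      Q t n' r' (S(2 := XR, 8 := zs', 4 := L @ S 4, 7 := L @ S 7)) T"
  shows "wp rows Q n r S T"
  using assms
proof (induction xs arbitrary: S n r zs Q)
  case Nil
  have eq: "S(2 := XR, 8 := zs, 4 := [] @ S 4, 7 := [] @ S 7) = S" using Nil by (auto simp: fun_eq_iff)
  have "Q 1 n r S T" using Nil(9)[of "[]" 1 zs n r] unfolding eq by simp
  with Nil show ?case unfolding rows_def by - (rule wp_While, auto simp: regv_def)
next
  case (Cons x xs)
  note Q = Cons.prems(9) and IH = Cons.IH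
  have xs: "sorted xs" "\<forall>x' \<in> set xs. x \<le> x'" using Cons.prems(6) by auto
  have "wp row (\<lambda>t. wp rows (\<lambda>t'. Q (t + t' + 1))) n r S T"
  proof (rule wp_row)
    show "S 2 = x # (xs @ XR)" "S 8 = zs" "S 9 = []" "sorted (rev zs)" "r 0 = a" "r 1 = b"
      using Cons.prems by auto
    fix t1 n1 r1 us zs1
    let ?S = "S(2 := xs @ XR, 8 := zs1, 4 := rev (map ((+) x) us) @ S 4, 7 := rev (map ((+) x) us) @ S 7)"
    assume 1: "zs1 = filter (\<lambda>y. x + y < b) zs" "us = filter (\<lambda>y. a < x + y) zs1"
      "t1 \<le> 4 * (length zs - length zs1) + 11 * length us + 22"
      "agree 9 n1 n" "agree 3 r1 r"
      "n1 9 = n 9 + length (filter (\<lambda>y. x + y \<le> a) zs1)" "n1 10 = n 10 + length us" "n1 14 = n 14 - 1"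
    have len: "length zs1 \<le> length zs" unfolding 1(1) by simp
    have mid: "{#z \<in># all_sums xs zs1. a < z \<and> z < b#} = {#z \<in># all_sums xs zs. a < z \<and> z < b#}"
      unfolding 1(1) using xs by (intro filter_all_sums_filter) fastforce
    have below: "{#z \<in># all_sums xs zs1. z \<le> a#} = {#z \<in># all_sums xs zs. z \<le> a#}" if "a < b"
      unfolding 1(1) using xs that by (intro filter_all_sums_filter) fastforce
    show "wp rows (\<lambda>t'. Q (t1 + t' + 1)) n1 r1 ?S T"
    proof (rule IH)
      show "sorted (rev zs1)" unfolding 1(1) using Cons.prems(5) by (simp add: rev_filter sorted_wrt_filter)
      fix t2 n2 r2 and zs2 L :: "real list"
      assume 2: "mset L = {#z \<in># all_sums xs zs1. a < z \<and> z < b#}"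
        "t2 \<le> 23 * length xs + 4 * (length zs1 - length zs2) + 11 * length L + 1" "length zs2 \<le> length zs1"
        "agree 9 n2 n1" "agree 3 r2 r1"
        "a < b \<Longrightarrow> n2 9 = n1 9 + size {#z \<in># all_sums xs zs1. z \<le> a#}" "n2 10 = n1 10 + length L"
      let ?L = "L @ rev (map ((+) x) us)"
      have eq: "?S(2 := XR, 8 := zs2, 4 := L @ ?S 4, 7 := L @ ?S 7) = S(2 := XR, 8 := zs2, 4 := ?L @ S 4, 7 := ?L @ S 7)"
        by (auto simp: fun_eq_iff)
      show "Q (t1 + t2 + 1) n2 r2 (?S(2 := XR, 8 := zs2, 4 := L @ ?S 4, 7 := L @ ?S 7)) T"
        unfolding eq
      proof (rule Q)
        show "mset ?L = {#z \<in># all_sums (x # xs) zs. a < z \<and> z < b#}"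
          using 2(1) mid unfolding 1(2) 1(1)
          by (auto simp: filter_mset_image_mset filter_filter_mset conj_commute intro!: arg_cong[of _ _ "image_mset _"] filter_mset_cong)
        show "length zs2 \<le> length zs" using 2(3) len by linarith
        show "t1 + t2 + 1 \<le> 23 * length (x # xs) + 4 * (length zs - length zs2) + 11 * length ?L + 1"
          using 1(3) 2(2,3) len by simp
        assume ab: "a < b"
        have "length (filter (\<lambda>y. x + y \<le> a) zs1) = size {#z \<in># image_mset ((+) x) (mset zs). z \<le> a#}"
          unfolding 1(1) using ab by (auto simp: filter_mset_image_mset intro!: arg_cong[of _ _ length] filter_cong simp flip: mset_filter)
        then show "n2 9 = n 9 + size {#z \<in># all_sums (x # xs) zs. z \<le> a#}"
          using 2(6)[OF ab] 1(6) below[OF ab] by simp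
      qed (use 1 2 len in auto)
    qed (use 1 Cons.prems xs in auto)
  qed
  then show ?case using Cons.prems(4) unfolding rows_def by - (rule wp_While, auto simp: regv_def)
qed

text \<open>Both bounds are pushed first, to be the representatives of their ties. Selection
  consumes its list and two ranks are sought, hence the second copy on stack 7.\<close>

definition walk :: com where
  "walk = NAssign 13 (NReg 5) ;; move_some 3 8 11 ;; NAssign 9 (NConst 0) ;;
    rpush 4 0 ;; rpush 4 1 ;; rpush 7 0 ;; rpush 7 1 ;; NAssign 10 (NConst 2) ;;
    NAssign 14 (NReg 5) ;; rows ;; clear 8 11"

lemma all_sums_rev: "all_sums X (rev Y) = all_sums X Y"
  by (simp add: all_sums_def)

lemma wp_walk:
  assumes S: "S 2 = X @ XR" "S 3 = Y @ YR" "S 4 = []" "S 7 = []" "S 8 = []" "S 9 = []"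
    and XY: "length X = n 5" "length Y = n 5" "sorted X" "sorted Y" and r: "r 0 = a" "r 1 = b"
    and Q: "\<And>t n' r' L. mset L = {#a, b#} + {#z \<in># all_sums X Y. a < z \<and> z < b#} \<Longrightarrow>
      t \<le> 33 * n 5 + 11 * length L + 20 \<Longrightarrow> agree 9 n' n \<Longrightarrow> agree 3 r' r \<Longrightarrow>
      (a < b \<Longrightarrow> n' 9 = size {#z \<in># all_sums X Y. z \<le> a#}) \<Longrightarrow> n' 10 = length L \<Longrightarrow>
      Q t n' r' (S(2 := XR, 3 := YR, 4 := L, 7 := L)) T"
  shows "wp walk Q n r S T"
proof -
  let ?n1 = "n(13 := 0, 9 := 0, 10 := 2, 14 := n 5)"
  let ?S1 = "S(3 := YR, 8 := rev Y, 4 := [b, a], 7 := [b, a])"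
  have rows: "wp rows (\<lambda>t'. wp (clear 8 11) (\<lambda>t''. Q (t + (t' + t'')))) n' r' S' T"
    if "t \<le> 4 * n 5 + 9" "n' = ?n1" "S' = ?S1" "agree 3 r' r" for t n' r' S'
    unfolding that(2,3)
  proof (rule wp_rows)
    show "?S1 2 = X @ XR" "?S1 8 = rev Y" "?S1 9 = []" "?n1 14 = length X" "sorted (rev (rev Y))" "sorted X"
      "r' 0 = a" "r' 1 = b" using S XY r that by auto
    fix t1 n1 r1 and zs L :: "real list"
    let ?S2 = "?S1(2 := XR, 8 := zs, 4 := L @ ?S1 4, 7 := L @ ?S1 7)"
    assume 1: "mset L = {#z \<in># all_sums X (rev Y). a < z \<and> z < b#}"
      "t1 \<le> 23 * length X + 4 * (length (rev Y) - length zs) + 11 * length L + 1" "length zs \<le> length (rev Y)"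
      "agree 9 n1 ?n1" "agree 3 r1 r'"
      "a < b \<Longrightarrow> n1 9 = ?n1 9 + size {#z \<in># all_sums X (rev Y). z \<le> a#}" "n1 10 = ?n1 10 + length L"
    show "wp (clear 8 11) (\<lambda>t''. Q (t + (t1 + t''))) n1 r1 ?S2 T"
    proof (rule wp_clear)
      fix t2 v
      assume 2: "t2 \<le> 2 * length (?S2 8) + 1"
      have eq: "?S2(8 := []) = S(2 := XR, 3 := YR, 4 := L @ [b, a], 7 := L @ [b, a])"
        using S by (auto simp: fun_eq_iff)
      show "Q (t + (t1 + t2)) n1 (r1(11 := v)) (?S2(8 := [])) T"
        unfolding eq by (rule Q) (use 1 2 that XY in \<open>auto simp: all_sums_rev\<close>)
    qed simp
  qed
  show ?thesis
    unfolding walk_def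
  proof (rule wp_Seq, rule wp_NAssign, simp, simp, rule wp_Seq, rule wp_move_some[where ys = YR and xs = Y])
    fix t v
    assume t: "t \<le> 4 * length Y + 1"
    let ?n = "n(13 := nval (NReg 5) (view n r S T), 13 := 0)" and ?r = "r(11 := v)"
      and ?S = "S(3 := YR, 8 := rev Y @ S 8)"
    show "wp (NAssign 9 (NConst 0) ;;
      rpush 4 0 ;; rpush 4 1 ;; rpush 7 0 ;; rpush 7 1 ;; NAssign 10 (NConst 2) ;;
      NAssign 14 (NReg 5) ;; rows ;; clear 8 11) (\<lambda>t'. Q (1 + (t + t'))) ?n ?r ?S T"
      by (rule wp_Seq, rule wp_NAssign, simp, simp,
          rule wp_Seq, rule wp_rpush, simp, simp, rule wp_Seq, rule wp_rpush, simp, simp,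
          rule wp_Seq, rule wp_rpush, simp, simp, rule wp_Seq, rule wp_rpush, simp, simp,
          rule wp_Seq, rule wp_NAssign, simp, simp, rule wp_Seq, rule wp_NAssign, simp, simp, rule wp_Seq)
        (use rows[of "t + 8"] t XY S r in \<open>simp add: regv_def fun_eq_iff numeral_eq_Suc\<close>)
  qed (use S XY in \<open>auto simp: regv_def\<close>)
qed

text \<open>The position from \<open>kth_between\<close>: truncated subtraction and two comparisons
  perform the clamping, so that a single selection covers ranks at either bound and in
  between.\<close>

definition pick :: "nat \<Rightarrow> com" where
  "pick x = NAssign 11 (NAdd (NReg x) (NConst 1)) ;; NAssign 11 (NSub (NReg 11) (NReg 9)) ;;
    Cond (NLess (NReg 11) (NConst 1)) (NAssign 11 (NConst 1)) Skip ;;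
    Cond (NLess (NReg 10) (NReg 11)) (NAssign 11 (NReg 10)) Skip ;; select"

lemma wp_pick:
  assumes "x < 9" "S 4 = L" "S 5 = []" "S 6 = []" "n 10 = length L" "2 \<le> length L" "T 10 = []"
    and Q: "\<And>t n' r'. t \<le> 900 * length L + 8 \<Longrightarrow> agree 10 n' n \<Longrightarrow>
      agree 3 r' r \<Longrightarrow>
      kth (max 1 (min (n x + 1 - n 9) (length L))) (mset L) (r' 3) \<Longrightarrow> Q t n' r' (S(4 := [])) T"
  shows "wp (pick x) Q n r S T"
proof -
  let ?k = "max 1 (min (n x + 1 - n 9) (length L))"
  have select: "wp select (\<lambda>t'. Q (t + t')) (n(11 := k)) r S T" if "t \<le> 6" "k = ?k" for t k
  proof (rule wp_select)
    show "S 4 = L @ []" "(n(11 := k)) 10 = length L" using assms by auto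
    show "1 \<le> k" "k \<le> length L" using that assms(6) by auto
    fix t1 n1 r1
    assume "t1 \<le> 900 * length L + 2" "agree 10 n1 (n(11 := k))"
      "agree 3 r1 r" "kth k (mset L) (r1 3)"
    then show "Q (t + t1) n1 r1 (S(4 := [])) T" using that by (intro Q) auto
  qed (use assms in auto)
  let ?m = "n x + 1 - n 9"
  have "wp (Cond (NLess (NReg 11) (NConst 1)) (NAssign 11 (NConst 1)) Skip ;;
    Cond (NLess (NReg 10) (NReg 11)) (NAssign 11 (NReg 10)) Skip ;; select) (\<lambda>t. Q (1 + (1 + t))) (n(11 := ?m)) r S T"
  proof (rule wp_Seq, rule wp_Cond; (intro wp_NAssign wp_Skip)?)
    have 2: "wp (Cond (NLess (NReg 10) (NReg 11)) (NAssign 11 (NReg 10)) Skip ;; select) (\<lambda>t. Q (4 + t)) (n(11 := m)) r S T"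
      if m: "m = max 1 ?m" for m
    proof (rule wp_Seq, rule wp_Cond; (intro wp_NAssign wp_Skip)?)
      assume "bval (NLess (NReg 10) (NReg 11)) (view (n(11 := m)) r S T)"
      then have "length L = ?k" using m assms(5,6) by (simp add: regv_def)
      from select[OF _ this, of 6]
      show "wp select (\<lambda>t'. Q (4 + (1 + 1 + t'))) ((n(11 := m))(11 := nval (NReg 10) (view (n(11 := m)) r S T))) r S T"
        using assms(5) by (simp add: regv_def numeral_eq_Suc)
    next
      assume "\<not> bval (NLess (NReg 10) (NReg 11)) (view (n(11 := m)) r S T)"
      then have "m = ?k" using m assms(5,6) by (simp add: regv_def)
      from select[OF _ this, of 6]
      show "wp select (\<lambda>t'. Q (4 + (1 + 1 + t'))) (n(11 := m)) r S T"
        by (simp add: numeral_eq_Suc)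
    qed simp_all
    {
      assume "bval (NLess (NReg 11) (NConst 1)) (view (n(11 := ?m)) r S T)"
      then have "1 = max 1 ?m" by (simp add: regv_def)
      from 2[OF this]
      show "wp (Cond (NLess (NReg 10) (NReg 11)) (NAssign 11 (NReg 10)) Skip ;; select) (\<lambda>t. Q (1 + (1 + (1 + 1 + t))))
          ((n(11 := ?m))(11 := nval (NConst 1) (view (n(11 := ?m)) r S T))) r S T"
        by (simp add: numeral_eq_Suc)
    next
      assume "\<not> bval (NLess (NReg 11) (NConst 1)) (view (n(11 := ?m)) r S T)"
      then have "?m = max 1 ?m" by (simp add: regv_def)
      from 2[OF this]
      show "wp (Cond (NLess (NReg 10) (NReg 11)) (NAssign 11 (NReg 10)) Skip ;; select) (\<lambda>t. Q (1 + (1 + (1 + 1 + t))))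
          (n(11 := ?m)) r S T"
        by (simp add: numeral_eq_Suc)
    }
  qed simp_all
  then show ?thesis
    unfolding pick_def using assms(1)
    by - (rule wp_Seq, rule wp_NAssign, simp, simp, rule wp_Seq, rule wp_NAssign, simp, simp,
        simp add: regv_def)
qed

text \<open>The first rank of the sample is no longer on a stack, so it is recomputed to see whether
  it was 0. In that case register 0 holds no useful bound and gets the sum of the two stack tops,
  the smallest entry.\<close>

definition lower_bound :: com where
  "lower_bound = NAssign 16 (NAdd (NReg 7) (NConst 3)) ;; NAssign 16 (NDiv (NReg 16) (NConst 4)) ;;
    NAssign 16 (NSub (NReg 16) (NReg 5)) ;;
    Cond (NLess (NReg 16) (NConst 1))
      (rpop 2 3 ;; rpush 2 3 ;; rpop 3 11 ;; rpush 3 11 ;; RAssign 0 (RAdd (RReg 3) (RReg 11))) Skip"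

lemma wp_lower_bound:
  assumes "S 2 \<noteq> []" "S 3 \<noteq> []"
    and Q: "\<And>t n' r'. t \<le> 9 \<Longrightarrow> agree 9 n' n \<Longrightarrow>
      (\<And>x. 1 \<le> x \<Longrightarrow> x < 3 \<Longrightarrow> r' x = r x) \<Longrightarrow>
      r' 0 = (if (n 7 + 3) div 4 - n 5 = 0 then hd (S 2) + hd (S 3) else r 0) \<Longrightarrow> Q t n' r' S T"
  shows "wp lower_bound Q n r S T"
proof -
  have Q: "Q t n' r' S' T" if "t \<le> 9" "agree 9 n' n" "\<forall>x. 1 \<le> x \<and> x < 3 \<longrightarrow> r' x = r x"
    "r' 0 = (if (n 7 + 3) div 4 - n 5 = 0 then hd (S 2) + hd (S 3) else r 0)" "S' = S" for t n' r' S'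
    unfolding that(5) using that by (intro Q) auto
  show ?thesis
    unfolding lower_bound_def
    by (intro wp_intros; (intro Q)?) (use assms in \<open>auto simp: regv_def fun_eq_iff\<close>)
qed

definition finish :: com where
  "finish = pick 8 ;; RAssign 1 (RReg 3)"

definition level :: com where
  "level = npop 11 8 ;; npop 11 7 ;; double 5 ;; lower_bound ;; walk ;;
    pick 7 ;; RAssign 0 (RReg 3) ;; NAssign 10 (height 7) ;; move_all 7 4 10 ;; finish"

text \<open>The time is dominated by two selections, each taking about 900 steps for each of at most
  \<open>32 * m + 2\<close> elements.\<close>

lemma wp_level:
  assumes S: "S 2 = X @ XR" "S 3 = Y @ YR" "\<And>i. 4 \<le> i \<Longrightarrow> i < 10 \<Longrightarrow> S i = []"
    and T: "T 10 = []" "T 11 = k2 # k1 # ks"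
    and m: "n 5 = m" "1 \<le> m" "length X = 2 * m" "length Y = 2 * m" "sorted X" "sorted Y"
    and k: "k1 \<le> k2" "1 \<le> k2" "k2 \<le> k1 + 16 * m"
    and r1: "1 \<le> (k1 + 3) div 4 - 2 * m \<Longrightarrow> kth ((k1 + 3) div 4 - 2 * m) (all_sums (odds X) (odds Y)) (r 0)"
    and r2: "kth ((k2 + 3) div 4) (all_sums (odds X) (odds Y)) (r 1)"
    and Q: "\<And>t n' r'. t \<le> 70000 * m \<Longrightarrow> n' 5 = 2 * m \<Longrightarrow> (1 \<le> k1 \<Longrightarrow> kth k1 (all_sums X Y) (r' 0)) \<Longrightarrow>
      kth k2 (all_sums X Y) (r' 1) \<Longrightarrow> Q t n' r' (S(2 := XR, 3 := YR)) (T(11 := ks))"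
  shows "wp level Q n r S T"
proof -
  let ?n = "n(8 := k2, 7 := k1, 5 := 2 * m)" and ?T = "T(11 := ks)"
  let ?C = "RAssign 0 (RReg 3) ;; NAssign 10 (height 7) ;; move_all 7 4 10 ;; finish"
  let ?B = "walk ;; pick 7 ;; ?C"
  have "wp (lower_bound ;; ?B) (\<lambda>t. Q (1 + (1 + (1 + m + t)))) ?n r S ?T"
  proof (rule wp_Seq, rule wp_lower_bound)
    have ne: "X \<noteq> []" "Y \<noteq> []" using m by auto
    then show "S 2 \<noteq> []" "S 3 \<noteq> []" using S by auto
    fix t1 :: nat and n1 :: nregs and rx :: rregs
    let ?a = "rx 0" and ?b = "rx 1"
    assume 1: "t1 \<le> 9" "agree 9 n1 ?n" "\<And>x. 1 \<le> x \<Longrightarrow> x < 3 \<Longrightarrow> rx x = r x"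
      "?a = (if (?n 7 + 3) div 4 - ?n 5 = 0 then hd (S 2) + hd (S 3) else r 0)"
    interpret sample X Y m k1 k2 "(k1 + 3) div 4 - 2 * m" "(k2 + 3) div 4" ?a ?b
      using m k r1 r2 1(3)[of 1] 1(4) S(1,2) ne by unfold_locales (auto simp: hd_conv_nth nth_append)
    let ?A = "all_sums X Y"
    show "wp ?B (\<lambda>t. Q (1 + (1 + (1 + m + (t1 + t))))) n1 rx S ?T"
    proof (rule wp_Seq, rule wp_walk[OF S(1,2)])
      show "S 4 = []" "S 7 = []" "S 8 = []" "S 9 = []" using S(3) by auto
      fix t2 :: nat and n2 :: nregs and r2 :: rregs and L :: "real list"
      assume 2: "mset L = {#?a, ?b#} + {#z \<in># ?A. ?a < z \<and> z < ?b#}"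
        "t2 \<le> 33 * n1 5 + 11 * length L + 20" "agree 9 n2 n1" "agree 3 r2 rx"
        "?a < ?b \<Longrightarrow> n2 9 = size {#z \<in># ?A. z \<le> ?a#}" "n2 10 = length L"
      have len: "length L = size {#z \<in># ?A. ?a < z \<and> z < ?b#} + 2" using 2(1) size_mset[of L] by simp
      then have L: "2 \<le> length L" "length L \<le> 32 * m + 2" using size_between by linarith+
      \<comment> \<open>The same pair of bounds encloses every rank from \<open>max 1 k1\<close> to
        \<open>k2\<close>, so one walk suffices for both selections.\<close>
      have sel: "kth j ?A v" if "max 1 k1 \<le> j" "j \<le> k2" "kth (max 1 (min (j + 1 - n2 9) (length L))) (mset L) v" for j v
      proof (rule kth_between[OF a_le_b])
        show "size {#x \<in># ?A. x < ?a#} < j" using lower that(1) by linarith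
        show "j \<le> size {#x \<in># ?A. x \<le> ?b#}" using upper that(2) by linarith
        show "kth (max 1 (min (j + 1 - n2 9) (size (mset L)))) (mset L) v" using that(3) by simp
      qed (use 2 in auto)
      let ?S2 = "S(2 := XR, 3 := YR, 4 := L, 7 := L)"
      show "wp (pick 7 ;; ?C) (\<lambda>t. Q (1 + (1 + (1 + m + (t1 + (t2 + t)))))) n2 r2 ?S2 ?T"
      proof (rule wp_Seq, rule wp_pick)
        show "?S2 4 = L" "?S2 5 = []" "?S2 6 = []" "?T 10 = []" "2 \<le> length L" "n2 10 = length L"
          using S(3) T L 2 by auto
        fix t3 :: nat and n3 :: nregs and r3 :: rregs
        assume 3: "t3 \<le> 900 * length L + 8" "agree 10 n3 n2" "agree 3 r3 r2"
          "kth (max 1 (min (n2 7 + 1 - n2 9) (length L))) (mset L) (r3 3)"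
        have k1: "kth k1 ?A (r3 3)" if "1 \<le> k1"
          by (rule sel) (use that k 3(4) 2(3) 1(2) in auto)
        let ?S3 = "?S2(4 := [])" and ?n3 = "n3(10 := length L)" and ?r3 = "r3(0 := r3 3)"
        have "wp (move_all 7 4 10 ;; finish)
          (\<lambda>t. Q (1 + (1 + (1 + m + (t1 + (t2 + (t3 + (1 + (1 + t))))))))) ?n3 ?r3 ?S3 ?T"
        proof (rule wp_Seq, rule wp_move_list[where xs = L])
          show "L \<noteq> []" using L by auto
          fix t4 :: nat
          let ?S4 = "?S3(7 := [], 4 := rev L @ ?S3 4)"
          assume 4: "t4 \<le> 3 * length L + 1"
          show "wp finish (\<lambda>t. Q (1 + (1 + (1 + m + (t1 + (t2 + (t3 + (1 + (1 + (t4 + t))))))))))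
              ?n3 (?r3(10 := last L)) ?S4 ?T"
            unfolding finish_def
          proof (rule wp_Seq, rule wp_pick)
            show "?S4 4 = rev L" "?S4 5 = []" "?S4 6 = []" "?T 10 = []" "2 \<le> length (rev L)" "?n3 10 = length (rev L)"
              using S(3) T L by auto
            fix t5 :: nat and n5 :: nregs and r5 :: rregs
            assume 5: "t5 \<le> 900 * length (rev L) + 8" "agree 10 n5 ?n3"
              "agree 3 r5 (?r3(10 := last L))"
              "kth (max 1 (min (?n3 8 + 1 - ?n3 9) (length (rev L)))) (mset (rev L)) (r5 3)"
            have k2: "kth k2 ?A (r5 3)"
              by (rule sel) (use k 5(4) 3(2) 2(3) 1(2) in auto)
            have eq: "?S4(4 := []) = S(2 := XR, 3 := YR)" using S(3) by (auto simp: fun_eq_iff)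
            show "wp (RAssign 1 (RReg 3)) (\<lambda>t. Q (1 + (1 + (1 + m + (t1 + (t2 + (t3 + (1 + (1 + (t4 + (t5 + t)))))))))))
                n5 r5 (?S4(4 := [])) ?T"
              unfolding eq
            proof (rule wp_RAssign, simp, rule Q)
              have "n1 5 = 2 * m" using 1(2) by simp
              then show "1 + (1 + (1 + m + (t1 + (t2 + (t3 + (1 + (1 + (t4 + (t5 + 1))))))))) \<le> 70000 * m"
                using 1(1) 2(2) 3(1) 4 5(1) L(2) m(2) by simp
            qed (use 1(2) 2(3) 3(2) 5(2,3) k1 k2 in auto)
          qed simp_all
        qed simp_all
        then show "wp (?C) (\<lambda>t. Q (1 + (1 + (1 + m + (t1 + (t2 + (t3 + t))))))) n3 r3 ?S3 ?T"
          by - (rule wp_Seq, rule wp_RAssign, simp, rule wp_Seq, rule wp_NAssign, simp, simp, simp add: eval_simps)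
      qed simp_all
    qed (use m 1 in auto)
  qed
  then show ?thesis
    unfolding level_def using T m(1)
    by - (rule wp_Seq, rule wp_npop, simp, simp, simp, simp, rule wp_Seq, rule wp_npop, simp, simp, simp, simp,
      rule wp_Seq, rule wp_double, simp, simp)
qed

section \<open>The recursion over the samples\<close>

text \<open>The samples of the arrays are on stacks 2 and 3, the smallest one on top, and the pairs of
  ranks of the larger samples are on stack 11.\<close>

fun layers :: "nat \<Rightarrow> real list \<Rightarrow> real list \<Rightarrow> real list" where
  "layers 0 X R = X @ R"
| "layers (Suc h) X R = layers h (odds X) (X @ R)"

fun rank_stack :: "nat \<Rightarrow> nat \<Rightarrow> nat \<Rightarrow> nat list \<Rightarrow> nat list" where
  "rank_stack 0 k1 k2 ks = ks"
| "rank_stack (Suc h) k1 k2 ks =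
    rank_stack h ((k1 + 3) div 4 - 2 ^ Suc h) ((k2 + 3) div 4) (k2 # k1 # ks)"

definition up :: com where
  "up = While (nonempty 11) level"

definition bottom :: com where
  "bottom = rpop 2 3 ;; rpop 3 11 ;; RAssign 0 (RAdd (RReg 3) (RReg 11)) ;; RAssign 1 (RReg 0)"

text \<open>The induction splits off the largest matrix, whose iteration of the loop comes last. The
  rule therefore leaves the loop running in its final premise, and the induction hypothesis is used
  with one more iteration to follow.\<close>

lemma wp_up:
  assumes "S 2 = layers h X XR" "S 3 = layers h Y YR" "\<And>i. 4 \<le> i \<Longrightarrow> i < 10 \<Longrightarrow> S i = []"
    and "T 10 = []" "T 11 = rank_stack h k1 k2 ks" "n 5 = 1"
    and "length X = 2 ^ h" "length Y = 2 ^ h" "sorted X" "sorted Y"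
    and "k1 \<le> k2" "1 \<le> k2" "k2 \<le> 2 ^ h * 2 ^ h" "k2 \<le> k1 + 8 * 2 ^ h"
    and "\<And>t n' r'. t \<le> 80000 * 2 ^ h \<Longrightarrow> n' 5 = 2 ^ h \<Longrightarrow>
      (1 \<le> k1 \<Longrightarrow> kth k1 (all_sums X Y) (r' 0)) \<Longrightarrow> kth k2 (all_sums X Y) (r' 1) \<Longrightarrow>
      wp up (\<lambda>t'. Q (t + t')) n' r' (S(2 := XR, 3 := YR)) (T(11 := ks))"
  shows "wp bottom (\<lambda>t. wp up (\<lambda>t'. Q (t + t'))) n r S T"
  using assms
proof (induction h arbitrary: X Y XR YR k1 k2 ks)
  case 0
  note Q = 0(15)
  obtain x y where xy: "X = [x]" "Y = [y]" using 0(7,8) by (auto simp: length_Suc_conv)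
  have k2: "k2 = 1" using 0(12,13) by simp
  have "kth 1 (all_sums X Y) (x + y)" by (simp add: xy kth_def)
  then have Q: "wp up (\<lambda>t'. Q (1 + (1 + (1 + 1)) + t')) n r' S' T'"
    if "r' 0 = x + y" "r' 1 = x + y" "T' = T" "S' = S(2 := XR, 3 := YR)" for r' S' T'
  proof -
    have eq: "T(11 := ks) = T" using 0(5) by (auto simp: fun_eq_iff)
    have "k1 = 0 \<or> k1 = 1" using 0(11) k2 by linarith
    then have "wp up (\<lambda>t'. Q (4 + t')) n r' (S(2 := XR, 3 := YR)) (T(11 := ks))"
      using that 0(6) k2 \<open>kth 1 _ _\<close> by (intro Q) auto
    moreover have "4 + t' = 1 + (1 + (1 + 1)) + t'" for t' :: nat by simp
    ultimately show ?thesis unfolding eq that(3,4) by (simp only:)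
  qed
  show ?case
    unfolding bottom_def
    by (intro wp_intros; (rule Q)?) (use 0(1,2) xy in \<open>auto simp: fun_eq_iff\<close>)
next
  case (Suc h)
  note Q = Suc.prems(15)
  let ?m = "2 ^ h :: nat"
  let ?r1 = "(k1 + 3) div 4 - 2 ^ Suc h" and ?r2 = "(k2 + 3) div 4"
  show ?case
  proof (rule Suc.IH)
    show "S 2 = layers h (odds X) (X @ XR)" "S 3 = layers h (odds Y) (Y @ YR)"
      "T 11 = rank_stack h ?r1 ?r2 (k2 # k1 # ks)"
      using Suc.prems by simp_all
    show "length (odds X) = ?m" "length (odds Y) = ?m" using Suc.prems by (simp_all add: length_odds)
    show "sorted (odds X)" "sorted (odds Y)" using Suc.prems by (simp_all add: sorted_odds)
    have "1 \<le> ?m" by simp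
    show "?r1 \<le> ?r2" using Suc.prems(11) by (intro le_trans[OF diff_le_self] div_le_mono) simp
    show "1 \<le> ?r2" using Suc.prems(12) by linarith
    have "k2 \<le> 4 * (?m * ?m)" using Suc.prems(13) by simp
    then show "?r2 \<le> ?m * ?m" by linarith
    \<comment> \<open>The gap stays within 8 times the side. Truncating the first rank at 0 can only
      narrow it.\<close>
    have "k2 \<le> k1 + 16 * ?m" using Suc.prems(14) by simp
    then have "?r2 \<le> (k1 + 3) div 4 + 4 * ?m" by linarith
    then show "?r2 \<le> ?r1 + 8 * ?m" by simp
    fix t1 :: nat and n1 :: nregs and r1 :: rregs
    let ?S1 = "S(2 := X @ XR, 3 := Y @ YR)" and ?T1 = "T(11 := k2 # k1 # ks)"
    assume 1: "t1 \<le> 80000 * 2 ^ h" "n1 5 = 2 ^ h" "1 \<le> ?r1 \<Longrightarrow> kth ?r1 (all_sums (odds X) (odds Y)) (r1 0)"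
      "kth ?r2 (all_sums (odds X) (odds Y)) (r1 1)"
    have "wp level (\<lambda>t. wp up (\<lambda>t'. Q (t1 + (t + t' + 1)))) n1 r1 ?S1 ?T1"
    proof (rule wp_level)
      show "?S1 2 = X @ XR" "?S1 3 = Y @ YR" "?T1 10 = []" "?T1 11 = k2 # k1 # ks" "n1 5 = ?m" "1 \<le> ?m"
        "length X = 2 * ?m" "length Y = 2 * ?m" "sorted X" "sorted Y" "k1 \<le> k2" "1 \<le> k2" "k2 \<le> k1 + 16 * ?m"
        using Suc.prems 1 by simp_all
      show "?S1 i = []" if "4 \<le> i" "i < 10" for i using Suc.prems(3)[OF that] that by simp
      show "kth ((k1 + 3) div 4 - 2 * ?m) (all_sums (odds X) (odds Y)) (r1 0)" if "1 \<le> (k1 + 3) div 4 - 2 * ?m"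
        using 1(3) that by simp
      show "kth ?r2 (all_sums (odds X) (odds Y)) (r1 1)" by (rule 1(4))
      fix t2 :: nat and n2 :: nregs and r2 :: rregs
      assume 2: "t2 \<le> 70000 * ?m" "n2 5 = 2 * ?m" "1 \<le> k1 \<Longrightarrow> kth k1 (all_sums X Y) (r2 0)"
        "kth k2 (all_sums X Y) (r2 1)"
      have e: "?S1(2 := XR, 3 := YR) = S(2 := XR, 3 := YR)" "?T1(11 := ks) = T(11 := ks)"
        by (auto simp: fun_eq_iff)
      have "wp up (\<lambda>t'. Q (t1 + t2 + 1 + t')) n2 r2 (S(2 := XR, 3 := YR)) (T(11 := ks))"
      proof (rule Q)
        \<comment> \<open>A geometric sum: \<open>80000 * ?m + 70000 * ?m + 1\<close> is at most
          \<open>160000 * ?m\<close>.\<close>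
        show "t1 + t2 + 1 \<le> 80000 * 2 ^ Suc h"
          using 1(1) 2(1) \<open>1 \<le> ?m\<close> unfolding power_Suc by linarith
      qed (use 2 in auto)
      moreover have "t1 + (t2 + t' + 1) = t1 + t2 + 1 + t'" for t' by simp
      ultimately show "wp up (\<lambda>t'. Q (t1 + (t2 + t' + 1))) n2 r2 (?S1(2 := XR, 3 := YR)) (?T1(11 := ks))"
        unfolding e by (simp only:)
    qed
    then show "wp up (\<lambda>t'. Q (t1 + t')) n1 r1 ?S1 ?T1"
      unfolding up_def by - (rule wp_While, auto simp: eval_simps)
  qed (use Suc.prems in auto)
qed

section \<open>Building the samples\<close>

definition split_loop :: "nat \<Rightarrow> com" where
  "split_loop i = While (NLess (NConst 0) (NReg 13))
    (rpop i 10 ;; rpush 5 10 ;; rpop i 10 ;; rpush 5 10 ;; rpush 6 10 ;; decr 13)"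

text \<open>Stack 5 collects everything and stack 6 the second element of each pair. Stack 5 is
  moved back first, so that the sample ends up on top of the list it was taken from.\<close>

definition take_odds :: "nat \<Rightarrow> com" where
  "take_odds i = NAssign 13 (NReg 5) ;; split_loop i ;; move_all 5 i 10 ;; move_all 6 i 10"

lemma wp_take_odds:
  assumes "2 \<le> i" "i < 4" "S i = X @ R" "length X = 2 * n 5" "1 \<le> n 5" "S 5 = []" "S 6 = []"
    and Q: "\<And>t v. t \<le> 17 * n 5 + 4 \<Longrightarrow> Q t (n(13 := 0)) (r(10 := v)) (S(i := odds X @ X @ R)) T"
  shows "wp (take_odds i) Q n r S T"
proof -
  have loop: "wp (split_loop i) Q n r S T"
    if "S i = X @ R" "length X = 2 * n 13" "\<And>t v. t \<le> 7 * n 13 + 1 \<Longrightarrow>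
      Q t (n(13 := 0)) (r(10 := v)) (S(i := R, 5 := rev X @ S 5, 6 := rev (odds X) @ S 6)) T" for Q n r S
    using that
  proof (induction X arbitrary: Q n r S rule: odds.induct)
    case (1 x y X)
    let ?S = "S(i := X @ R, 5 := y # x # S 5, 6 := y # S 6)" and ?n = "n(13 := n 13 - 1)" and ?r = "r(10 := y)"
    have "wp (split_loop i) (\<lambda>t. Q (Suc (Suc (Suc (Suc (Suc (Suc (Suc t)))))))) ?n ?r ?S T"
    proof (rule 1(1))
      show "?S i = X @ R" "length X = 2 * ?n 13" using assms(1,2) 1 by auto
      fix t v assume t: "t \<le> 7 * ?n 13 + 1"
      have eq: "?S(i := R, 5 := rev X @ ?S 5, 6 := rev (odds X) @ ?S 6) =
        S(i := R, 5 := rev (x # y # X) @ S 5, 6 := rev (odds (x # y # X)) @ S 6)"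
        using assms(1,2) by (auto simp: fun_eq_iff)
      have "Q (Suc (Suc (Suc (Suc (Suc (Suc (Suc t))))))) (n(13 := 0)) (r(10 := v))
        (S(i := R, 5 := rev (x # y # X) @ S 5, 6 := rev (odds (x # y # X)) @ S 6)) T"
        using t 1(3) by (intro 1(4)) auto
      then show "Q (Suc (Suc (Suc (Suc (Suc (Suc (Suc t))))))) (?n(13 := 0)) (?r(10 := v))
        (?S(i := R, 5 := rev X @ ?S 5, 6 := rev (odds X) @ ?S 6)) T" unfolding eq unfolding fun_upd_upd .
    qed
    then show ?case unfolding split_loop_def using assms(1,2) 1(2,3)
      by - ((rule wp_While; (intro wp_intros)?), (auto simp: eval_simps fun_upd_twist numeral_eq_Suc))
  next
    case "2_1"
    have eq: "n(13 := 0) = n" "S(i := R, 5 := rev [] @ S 5, 6 := rev (odds []) @ S 6) = S"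
      using "2_1" by (auto simp: fun_eq_iff)
    have "Q 1 n r S T" using "2_1"(3)[of 1 "r 10"] unfolding eq by simp
    then show ?case using "2_1" unfolding split_loop_def by - (rule wp_While, auto simp: regv_def)
  next
    case ("2_2" x)
    have "Suc 0 = 2 * n 13" using "2_2"(2) by simp
    then have False by presburger
    then show ?case ..
  qed
  show ?thesis
    unfolding take_odds_def
  proof (rule wp_Seq, rule wp_NAssign, simp, simp, rule wp_Seq, rule loop)
    let ?n = "n(13 := nval (NReg 5) (view n r S T))"
    show "S i = X @ R" "length X = 2 * ?n 13" using assms by (auto simp: regv_def)
    fix t1 v1
    let ?S1 = "S(i := R, 5 := rev X @ S 5, 6 := rev (odds X) @ S 6)"
    let ?S2 = "?S1(5 := [], i := rev (rev X) @ ?S1 i)"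
    let ?S3 = "?S2(6 := [], i := rev (rev (odds X)) @ ?S2 i)"
    assume t1: "t1 \<le> 7 * ?n 13 + 1"
    have ne: "X \<noteq> []" "odds X \<noteq> []" using assms(4,5) length_odds[of X] by auto
    have eq: "?S3 = S(i := odds X @ X @ R)" using assms by (auto simp: fun_eq_iff)
    show "wp (move_all 5 i 10 ;; move_all 6 i 10) (\<lambda>t. Q (1 + (t1 + t))) (?n(13 := 0)) (r(10 := v1)) ?S1 T"
    proof (rule wp_Seq, rule wp_move_list[where xs = "rev X"])
      fix t2 assume t2: "t2 \<le> 3 * length (rev X) + 1"
      show "wp (move_all 6 i 10) (\<lambda>t. Q (1 + (t1 + (t2 + t)))) (?n(13 := 0)) (r(10 := v1, 10 := last (rev X))) ?S2 T"
      proof (rule wp_move_list[where xs = "rev (odds X)"])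
        fix t3 assume t3: "t3 \<le> 3 * length (rev (odds X)) + 1"
        have "Q (1 + (t1 + (t2 + t3))) (n(13 := 0)) (r(10 := last (rev (odds X)))) (S(i := odds X @ X @ R)) T"
          using t1 t2 t3 assms by (intro Q) (auto simp: length_odds regv_def)
        then show "Q (1 + (t1 + (t2 + t3))) (?n(13 := 0)) (r(10 := v1, 10 := last (rev X), 10 := last (rev (odds X)))) ?S3 T"
          unfolding eq unfolding fun_upd_upd .
      qed (use assms ne in auto)
    qed (use assms ne in auto)
  qed
qed

definition next_ranks :: com where
  "next_ranks = npush 11 7 ;; npush 11 8 ;;
    NAssign 7 (NAdd (NReg 7) (NConst 3)) ;; NAssign 7 (NDiv (NReg 7) (NConst 4)) ;; NAssign 7 (NSub (NReg 7) (NReg 5)) ;;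
    NAssign 8 (NAdd (NReg 8) (NConst 3)) ;; NAssign 8 (NDiv (NReg 8) (NConst 4)) ;;
    NAssign 5 (NDiv (NReg 5) (NConst 2))"

lemma wp_next_ranks:
  assumes "\<And>n'. n' 7 = (n 7 + 3) div 4 - n 5 \<Longrightarrow> n' 8 = (n 8 + 3) div 4 \<Longrightarrow> n' 5 = n 5 div 2 \<Longrightarrow>
    Q 8 n' r S (T(11 := n 8 # n 7 # T 11))"
  shows "wp next_ranks Q n r S T"
proof -
  have Q: "Q t n' r S T'" if "n' 7 = (n 7 + 3) div 4 - n 5" "n' 8 = (n 8 + 3) div 4" "n' 5 = n 5 div 2" "t = 8"
    "T' = T(11 := n 8 # n 7 # T 11)" for t n' T' using assms that by simp
  show ?thesis
    unfolding next_ranks_def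
    by (intro wp_intros; (intro Q)?) (auto simp: regv_def fun_eq_iff)
qed

definition down :: com where
  "down = While (NLess (NConst 1) (NReg 5)) (next_ranks ;; take_odds 2 ;; take_odds 3)"

lemma wp_down:
  assumes "S 2 = X @ XR" "S 3 = Y @ YR" "S 5 = []" "S 6 = []" "n 5 = 2 ^ h" "n 7 = k1" "n 8 = k2"
    and "length X = 2 ^ h" "length Y = 2 ^ h"
    and "\<And>t n' r'. t \<le> 100 * 2 ^ h \<Longrightarrow> n' 5 = 1 \<Longrightarrow>
      Q t n' r' (S(2 := layers h X XR, 3 := layers h Y YR)) (T(11 := rank_stack h k1 k2 (T 11)))"
  shows "wp down Q n r S T"
  using assms
proof (induction h arbitrary: X Y XR YR k1 k2 S T n r Q)
  case 0
  have eq: "S(2 := layers 0 X XR, 3 := layers 0 Y YR) = S" "T(11 := rank_stack 0 k1 k2 (T 11)) = T"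
    using 0 by (auto simp: fun_eq_iff)
  have "Q 1 n r S T" using 0(10)[of 1 n r] 0(5) unfolding eq by simp
  then show ?case using 0(5) unfolding down_def by - (rule wp_While, auto simp: regv_def)
next
  case (Suc h)
  note Q = Suc.prems(10)
  let ?m = "2 ^ h :: nat"
  let ?T = "T(11 := k2 # k1 # T 11)"
  have "wp (next_ranks ;; take_odds 2 ;; take_odds 3) (\<lambda>t. wp down (\<lambda>t'. Q (t + t' + 1))) n r S T"
  proof (rule wp_Seq, rule wp_next_ranks)
    fix n1 :: nregs
    assume n1: "n1 7 = (n 7 + 3) div 4 - n 5" "n1 8 = (n 8 + 3) div 4" "n1 5 = n 5 div 2"
    have m: "n1 5 = ?m" using n1 Suc.prems(5) by simp
    show "wp (take_odds 2 ;; take_odds 3) (\<lambda>t. wp down (\<lambda>t'. Q (8 + t + t' + 1))) n1 r S (T(11 := n 8 # n 7 # T 11))"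
    proof (rule wp_Seq, rule wp_take_odds)
      fix t1 v1
      let ?S1 = "S(2 := odds X @ X @ XR)"
      assume t1: "t1 \<le> 17 * n1 5 + 4"
      show "wp (take_odds 3) (\<lambda>t. wp down (\<lambda>t'. Q (8 + (t1 + t) + t' + 1))) (n1(13 := 0)) (r(10 := v1)) ?S1 (T(11 := n 8 # n 7 # T 11))"
      proof (rule wp_take_odds)
        fix t2 v2
        let ?S2 = "?S1(3 := odds Y @ Y @ YR)" and ?n2 = "n1(13 := 0, 13 := 0)"
        assume t2: "t2 \<le> 17 * (n1(13 := 0)) 5 + 4"
        show "wp down (\<lambda>t'. Q (8 + (t1 + t2) + t' + 1)) ?n2 (r(10 := v1, 10 := v2)) ?S2 (T(11 := n 8 # n 7 # T 11))"
        proof (rule Suc.IH)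
          show "?S2 2 = odds X @ (X @ XR)" "?S2 3 = odds Y @ (Y @ YR)" "?S2 5 = []" "?S2 6 = []"
            using Suc.prems by auto
          show "?n2 5 = ?m" "?n2 7 = (k1 + 3) div 4 - 2 ^ Suc h" "?n2 8 = (k2 + 3) div 4"
            using m n1 Suc.prems by auto
          show "length (odds X) = ?m" "length (odds Y) = ?m" using Suc.prems by (auto simp: length_odds)
          fix t3 :: nat and n3 :: nregs and r3
          let ?T3 = "T(11 := n 8 # n 7 # T 11)"
          assume 3: "t3 \<le> 100 * 2 ^ h" "n3 5 = (1 :: nat)"
          have e: "?S2(2 := layers h (odds X) (X @ XR), 3 := layers h (odds Y) (Y @ YR)) =
            S(2 := layers (Suc h) X XR, 3 := layers (Suc h) Y YR)"
            "?T3(11 := rank_stack h ((k1 + 3) div 4 - 2 ^ Suc h) ((k2 + 3) div 4) (?T3 11)) =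
            T(11 := rank_stack (Suc h) k1 k2 (T 11))"
            using Suc.prems by (auto simp: fun_eq_iff)
          have "1 \<le> ?m" "t2 \<le> 17 * n1 5 + 4" using t2 by simp_all
          then have "8 + (t1 + t2) + t3 + 1 \<le> 100 * 2 ^ Suc h"
            using 3(1) t1 m unfolding power_Suc by linarith
          then show "Q (8 + (t1 + t2) + t3 + 1) n3 r3
            (?S2(2 := layers h (odds X) (X @ XR), 3 := layers h (odds Y) (Y @ YR)))
            (?T3(11 := rank_stack h ((k1 + 3) div 4 - 2 ^ Suc h) ((k2 + 3) div 4) (?T3 11)))"
            unfolding e using 3(2) by (intro Q)
        qed
      qed (use Suc.prems m in auto)
    qed (use Suc.prems m in auto)
  qed
  moreover have "1 < n 5" unfolding Suc.prems(5) by (rule one_less_power) simp_all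
  ultimately show ?case unfolding down_def by - (rule wp_While, auto simp: regv_def)
qed

definition grow_to :: "nat \<Rightarrow> com" where
  "grow_to x = While (NLess (NReg 5) (NReg x)) (double 5)"

text \<open>A doubling is charged its operand, so the powers of two are summed; the inner induction
  carries the potential \<open>3 * 2 ^ h\<close> for this. The maximum in the bound allows for a
  side length that is already large enough, as may happen for the second array.\<close>

lemma wp_grow_to:
  assumes "x < 5" "n 5 = 2 ^ h"
    and "\<And>t h'. t \<le> 4 * 2 ^ h' \<Longrightarrow> h \<le> h' \<Longrightarrow> n x \<le> 2 ^ h' \<Longrightarrow> 2 ^ h' \<le> max (2 ^ h) (2 * n x) \<Longrightarrow>
      Q t (n(5 := 2 ^ h')) r S T"
  shows "wp (grow_to x) Q n r S T"
proof -
  have "wp (grow_to x) Q n r S T"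
    if "n 5 = 2 ^ h" "\<And>t h'. t + 3 * 2 ^ h \<le> 4 * 2 ^ h' \<Longrightarrow> h \<le> h' \<Longrightarrow> n x \<le> 2 ^ h' \<Longrightarrow> 2 ^ h' \<le> max (2 ^ h) (2 * n x) \<Longrightarrow>
      Q t (n(5 := 2 ^ h')) r S T" for Q n h
    using that
  proof (induction "n x - 2 ^ h" arbitrary: h n Q rule: less_induct)
    case less
    show ?case
    proof (cases "n 5 < n x")
      case True
      let ?n = "n(5 := 2 ^ Suc h)"
      have "wp (grow_to x) (\<lambda>t. Q (1 + 2 ^ h + t + 1)) ?n r S T"
      proof (rule less(1))
        have "n x - 2 ^ Suc h < n x - 2 ^ h" using True less(2) by (intro diff_less_mono2) auto
        then show "?n x - 2 ^ Suc h < n x - 2 ^ h" using assms(1) by simp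
        fix t h' :: nat
        assume a: "t + 3 * 2 ^ Suc h \<le> 4 * 2 ^ h'" "Suc h \<le> h'" "?n x \<le> 2 ^ h'" "2 ^ h' \<le> max (2 ^ Suc h) (2 * ?n x)"
        have "1 \<le> (2::nat) ^ h" by simp
        have "Q (1 + 2 ^ h + t + 1) (n(5 := 2 ^ h')) r S T"
        proof (rule less(3))
          show "1 + 2 ^ h + t + 1 + 3 * 2 ^ h \<le> 4 * 2 ^ h'" using a(1) \<open>1 \<le> 2 ^ h\<close> unfolding power_Suc by linarith
        qed (use a True less(2) assms(1) in auto)
        then show "Q (1 + 2 ^ h + t + 1) (?n(5 := 2 ^ h')) r S T" by simp
      qed simp
      then show ?thesis using True less(2) assms(1) unfolding grow_to_def
        by - (rule wp_While, simp, simp, rule wp_double, auto simp: regv_def)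
    next
      case False
      have "(1::nat) \<le> 2 ^ h" by simp
      then have "Q 1 (n(5 := 2 ^ h)) r S T" using False less(2) by (intro less(3)) auto
      moreover have "n(5 := 2 ^ h) = n" using less(2) by (auto simp: fun_eq_iff)
      ultimately show ?thesis using False assms(1) unfolding grow_to_def
        by - (rule wp_While, auto simp: regv_def)
    qed
  qed
  then show ?thesis using assms(2,3) by (metis add_leD1)
qed

definition fill :: "nat \<Rightarrow> nat \<Rightarrow> com" where
  "fill i x = While (NLess (NConst 0) (NReg 13)) (rpush i x ;; decr 13)"

lemma wp_fill:
  assumes "2 \<le> i" "i < 10"
    and "\<And>t. t \<le> 3 * n 13 + 1 \<Longrightarrow> Q t (n(13 := 0)) r (S(i := replicate (n 13) (r x) @ S i)) T"
  shows "wp (fill i x) Q n r S T"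
  using assms(3)
proof (induction "n 13" arbitrary: n S Q)
  case 0
  have eq: "n(13 := 0) = n" "S(i := replicate (n 13) (r x) @ S i) = S" using 0 by (auto simp: fun_eq_iff)
  have "Q 1 n r S T" using 0(2)[of 1] unfolding eq by simp
  then show ?case using 0(1) unfolding fill_def by - (rule wp_While, auto simp: regv_def)
next
  case (Suc m)
  note m = Suc.hyps(2)[symmetric]
  let ?n = "n(13 := m)" and ?S = "S(i := r x # S i)"
  have "wp (fill i x) (\<lambda>t. Q (Suc (Suc (Suc t)))) ?n r ?S T"
  proof (rule Suc.hyps(1))
    fix t assume t: "t \<le> 3 * ?n 13 + 1"
    have eq: "?S(i := replicate (?n 13) (r x) @ ?S i) = S(i := replicate (n 13) (r x) @ S i)"
      using m by (auto simp: fun_eq_iff replicate_app_Cons_same)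
    have "Q (Suc (Suc (Suc t))) (n(13 := 0)) r (S(i := replicate (n 13) (r x) @ S i)) T"
      using t m by (intro Suc.prems) simp
    then show "Q (Suc (Suc (Suc t))) (?n(13 := 0)) r (?S(i := replicate (?n 13) (r x) @ ?S i)) T"
      unfolding eq unfolding fun_upd_upd .
  qed simp
  then show ?case using m assms(1,2) unfolding fill_def
    by - ((rule wp_While; (intro wp_intros)?), (auto simp: regv_def))
qed

section \<open>The whole program\<close>

text \<open>The side length is in register 5 and the two ranks are in registers 7 and 8. The arrays
  are padded with entries that are so large that no sum with them is smaller than
  one of the original matrix.\<close>

definition load :: com where
  "load = move_all 0 5 4 ;; move_all 5 6 3 ;; move_all 1 7 6 ;; move_all 7 8 5 ;;
    RAssign 7 (RAdd (RReg 3) (RSub (RReg 5) (RReg 6))) ;;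
    RAssign 8 (RAdd (RReg 5) (RSub (RReg 3) (RReg 4))) ;;
    NAssign 13 (NSub (NReg 5) (NReg 0)) ;; fill 2 7 ;; move_all 6 2 10 ;;
    NAssign 13 (NSub (NReg 5) (NReg 1)) ;; fill 3 8 ;; move_all 8 3 10 ;;
    NAssign 7 (NReg 2) ;; NAssign 8 (NReg 2)"

text \<open>Each array is moved twice before the padding, which leaves its first and its last entry
  in registers; only then are the padding values known. The padding is pushed before the array, so
  that it lies below it.\<close>

lemma wp_load:
  assumes S: "S 0 = rev X" "S 1 = rev Y" "\<And>i. 2 \<le> i \<Longrightarrow> i < 10 \<Longrightarrow> S i = []"
    and n: "n 0 = length X" "n 1 = length Y" "n 2 = k" "n 5 = N" "length X \<le> N" "length Y \<le> N"
    and ne: "X \<noteq> []" "Y \<noteq> []"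
    and Q: "\<And>t n' r'. t \<le> 40 * N \<Longrightarrow> n' 5 = N \<Longrightarrow> n' 7 = k \<Longrightarrow> n' 8 = k \<Longrightarrow>
      Q t n' r' (S(0 := [], 1 := [], 2 := X @ replicate (N - length X) (last X + (last Y - hd Y)),
        3 := Y @ replicate (N - length Y) (last Y + (last X - hd X)))) T"
  shows "wp load Q n r S T"
proof -
  have Q: "Q t n' r' S' T" if "t \<le> 24 * N + 16" "n' 5 = N" "n' 7 = k" "n' 8 = k"
    "S' = S(0 := [], 1 := [], 2 := X @ replicate (N - length X) (last X + (last Y - hd Y)),
        3 := Y @ replicate (N - length Y) (last Y + (last X - hd X)))" for t n' r' S'
  proof -
    have "1 \<le> length X" using ne by (cases X) auto
    then show ?thesis unfolding that(5) using that n by (intro Q) auto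
  qed
  let ?a = "last X + (last Y - hd Y)" and ?b = "last Y + (last X - hd X)"
  have S0: "S i = []" if "i \<in> {2, 3, 5, 6, 7, 8}" for i using S(3) that by auto
  let ?S1 = "S(0 := [], 1 := [], 6 := rev X, 8 := rev Y)"
  let ?fill = "fill 2 7 ;; move_all 6 2 10 ;; NAssign 13 (NSub (NReg 5) (NReg 1)) ;; fill 3 8 ;;
    move_all 8 3 10 ;; NAssign 7 (NReg 2) ;; NAssign 8 (NReg 2)"
  have fill: "wp ?fill (\<lambda>t'. Q (t + t')) n' r' S' T"
    if t: "t \<le> 6 * length X + 6 * length Y + 7" and S': "S' = ?S1" and r': "r' 7 = ?a" "r' 8 = ?b"
      and n': "n' 13 = N - length X" "agree 13 n' n" for t n' r' S'
  proof (rule wp_Seq, rule wp_fill, simp, simp, rule wp_Seq,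
      rule wp_move_list[where xs = "rev X"], simp, simp, simp, simp, simp add: S', simp add: ne,
      rule wp_Seq, rule wp_NAssign, simp, simp, rule wp_Seq, rule wp_fill, simp, simp, rule wp_Seq,
      rule wp_move_list[where xs = "rev Y"], simp, simp, simp, simp, simp add: S', simp add: ne,
      rule wp_Seq, rule wp_NAssign, simp, simp, rule wp_NAssign, simp, simp, rule Q, goal_cases)
    case (1 t1 t2 t3 t4)
    then show ?case using t n n' by (simp add: regv_def)
  next
    case (5 t1 t2 t3 t4)
    then show ?case using n n' S' r' S0 by (auto simp: fun_eq_iff regv_def)
  qed (use n n' in \<open>simp_all add: regv_def\<close>)
  show ?thesis
    unfolding load_def
  proof (rule wp_Seq, rule wp_move_list[where xs = "rev X"], simp, simp, simp, simp, simp add: S, simp add: ne,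
      rule wp_Seq, rule wp_move_list[where xs = X], simp, simp, simp, simp, simp add: S0, simp add: ne,
      rule wp_Seq, rule wp_move_list[where xs = "rev Y"], simp, simp, simp, simp, simp add: S[unfolded One_nat_def], simp add: ne,
      rule wp_Seq, rule wp_move_list[where xs = Y], simp, simp, simp, simp, simp add: S0, simp add: ne,
      rule wp_Seq, rule wp_RAssign, simp, rule wp_Seq, rule wp_RAssign, simp,
      rule wp_Seq, rule wp_NAssign, simp, simp, goal_cases)
    case (1 t1 t2 t3 t4)
    let ?t = "t1 + (t2 + (t3 + (t4 + (1 + (1 + 1)))))"
    have "wp ?fill (\<lambda>t'. Q (?t + t')) n' r' S' T"
      if "S' = ?S1" "r' 7 = ?a" "r' 8 = ?b" "n' 13 = N - length X" "agree 13 n' n" for n' r' S'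
      using 1 that by (intro fill) auto
    moreover have "?t + t' = t1 + (t2 + (t3 + (t4 + (1 + (1 + (1 + t'))))))" for t' by simp
    ultimately have *: "wp ?fill (\<lambda>t'. Q (t1 + (t2 + (t3 + (t4 + (1 + (1 + (1 + t')))))))) n' r' S' T"
      if "S' = ?S1" "r' 7 = ?a" "r' 8 = ?b" "n' 13 = N - length X" "agree 13 n' n" for n' r' S'
      using that by (simp only:)
    show ?case
      by (rule *) (use n S S0 ne in \<open>auto simp: fun_eq_iff regv_def last_rev\<close>)
  qed
qed

definition main :: com where
  "main = NAssign 5 (NConst 1) ;; grow_to 0 ;; grow_to 1 ;; load ;; down ;; (bottom ;; up) ;; RAssign 0 (RReg 1)"

lemma sorted_hd_last:
  assumes "sorted (xs :: real list)" "xs \<noteq> []"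
  shows "\<forall>x\<in>set xs. hd xs \<le> x" "\<forall>x\<in>set xs. x \<le> last xs" "hd xs \<le> last xs"
  using assms by (auto simp: in_set_conv_nth hd_conv_nth last_conv_nth intro!: sorted_nth_mono)

text \<open>The machine has no infinite real, so the padding is made of sums and differences. It
  exceeds the last entry of \<open>X\<close> by the spread of \<open>Y\<close> and vice versa; hence
  even with the smallest partner it reaches \<open>last X + last Y\<close>, the largest original
  sum.\<close>

lemma kth_padded_sums:
  assumes XY: "sorted X" "sorted Y" "X \<noteq> []" "Y \<noteq> []" and k: "k \<le> length X * length Y"
    and v: "kth k (all_sums (X @ replicate i (last X + (last Y - hd Y))) (Y @ replicate j (last Y + (last X - hd X)))) v"
  shows "kth k (all_sums X Y) v"
proof -
  let ?P = "replicate i (last X + (last Y - hd Y))" and ?P' = "replicate j (last Y + (last X - hd X))"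
  let ?R = "all_sums X ?P' + all_sums ?P (Y @ ?P')"
  note ends = sorted_hd_last[OF XY(1,3)] sorted_hd_last[OF XY(2,4)]
  show ?thesis
  proof (rule kth_padded)
    show "kth k (all_sums X Y + ?R) v" using v by (simp add: all_sums_append add_ac)
    show "k \<le> size (all_sums X Y)" using k by (simp add: size_all_sums)
    fix z w assume zw: "z \<in># all_sums X Y" "w \<in># ?R"
    then have "z \<le> last X + last Y" using ends by (auto simp: in_all_sums intro: add_mono)
    moreover have "last X + last Y \<le> w"
      using zw(2) ends by (fastforce simp: in_all_sums)
    ultimately show "z \<le> w" by linarith
  qed
qed

lemma wp_main:
  assumes S: "S 0 = rev X" "S 1 = rev Y" "\<And>i. 2 \<le> i \<Longrightarrow> i < 10 \<Longrightarrow> S i = []" and T: "T 10 = []" "T 11 = []"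
    and n: "n 0 = length X" "n 1 = length Y" "n 2 = k"
    and XY: "sorted X" "sorted Y" and k: "1 \<le> k" "k \<le> length X * length Y"
  shows "wp main (\<lambda>t n r S T. t \<le> 170000 * max (length X) (length Y) \<and> kth k (all_sums X Y) (r 0)) n r S T"
proof -
  let ?A = "RAssign 0 (RReg 1)"
  let ?B = "down ;; (bottom ;; up) ;; ?A"
  let ?N = "max (length X) (length Y)"
  let ?Q = "\<lambda>(t :: nat) (n :: nregs) (r :: rregs) (S :: rstacks) (T :: nstacks). t \<le> 170000 * ?N \<and> kth k (all_sums X Y) (r 0)"
  have ne: "X \<noteq> []" "Y \<noteq> []" using k by auto
  have pos: "1 \<le> length X" "1 \<le> length Y" using ne by (simp_all add: Suc_le_eq)
  show ?thesis
    unfolding main_def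
  proof (rule wp_Seq, rule wp_NAssign, simp, simp, rule wp_Seq, rule wp_grow_to[where h = 0], simp, simp)
    fix t1 h1 :: nat
    let ?n1 = "n(5 := nval (NConst 1) (view n r S T), 5 := 2 ^ h1)"
    assume 1: "t1 \<le> 4 * 2 ^ h1" "0 \<le> h1" "(n(5 := nval (NConst 1) (view n r S T))) 0 \<le> 2 ^ h1"
      "2 ^ h1 \<le> max (2 ^ 0) (2 * (n(5 := nval (NConst 1) (view n r S T))) 0)"
    show "wp (grow_to 1 ;; load ;; ?B) (\<lambda>t. ?Q (1 + (t1 + t))) ?n1 r S T"
    proof (rule wp_Seq, rule wp_grow_to[where h = h1], simp, simp)
      fix t2 h :: nat
      let ?n2 = "?n1(5 := 2 ^ h)"
      assume 2: "t2 \<le> 4 * 2 ^ h" "h1 \<le> h" "?n1 1 \<le> 2 ^ h" "2 ^ h \<le> max (2 ^ h1) (2 * ?n1 1)"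
      have le: "(2::nat) ^ h1 \<le> 2 ^ h" using 2(2) by (intro power_increasing) auto
      have N: "length X \<le> 2 ^ h" "length Y \<le> 2 ^ h" "2 ^ h \<le> 2 * ?N"
      proof -
        have "length X \<le> 2 ^ h1" "2 ^ h1 \<le> max 1 (2 * length X)" "length Y \<le> 2 ^ h"
          "2 ^ h \<le> max (2 ^ h1) (2 * length Y)" using 1 2 n by simp_all
        then show "length X \<le> 2 ^ h" "length Y \<le> 2 ^ h" "2 ^ h \<le> 2 * ?N" using le pos by linarith+
      qed
      let ?P = "replicate (2 ^ h - length X) (last X + (last Y - hd Y))"
      let ?P' = "replicate (2 ^ h - length Y) (last Y + (last X - hd X))"
      let ?S1 = "S(0 := [], 1 := [], 2 := X @ ?P, 3 := Y @ ?P')"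
      show "wp (load ;; ?B) (\<lambda>t. ?Q (1 + (t1 + (t2 + t)))) ?n2 r S T"
      proof (rule wp_Seq, rule wp_load[where k = k, OF S])
        fix t3 :: nat and n3 :: nregs and r3 :: rregs
        assume 3: "t3 \<le> 40 * 2 ^ h" "n3 5 = (2 :: nat) ^ h" "n3 7 = k" "n3 8 = k"
        show "wp (?B) (\<lambda>t. ?Q (1 + (t1 + (t2 + (t3 + t))))) n3 r3 ?S1 T"
        proof (rule wp_Seq, rule wp_down[where X = "X @ ?P" and Y = "Y @ ?P'" and XR = "[]" and YR = "[]"
              and h = h and S = "?S1" and n = n3])
          fix t4 :: nat and n4 :: nregs and r4 :: rregs
          let ?S2 = "?S1(2 := layers h (X @ ?P) [], 3 := layers h (Y @ ?P') [])"
          let ?T2 = "T(11 := rank_stack h k k (T 11))"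
          assume 4: "t4 \<le> 100 * 2 ^ h" "n4 5 = (1 :: nat)"
          show "wp ((bottom ;; up) ;; ?A) (\<lambda>t. ?Q (1 + (t1 + (t2 + (t3 + (t4 + t)))))) n4 r4 ?S2 ?T2"
          \<comment> \<open>A single rank is wanted, so both ranks are \<open>k\<close>; they come
            apart only in the samples.\<close>
          proof (intro wp_Seq, rule wp_up[where X = "X @ ?P" and Y = "Y @ ?P'" and XR = "[]" and YR = "[]"
                and h = h and ?k1.0 = k and ?k2.0 = k and ks = "T 11" and S = "?S2" and T = "?T2"])
            show "sorted (X @ ?P)" "sorted (Y @ ?P')"
              using XY sorted_hd_last[OF XY(1) ne(1)] sorted_hd_last[OF XY(2) ne(2)]
              by (fastforce simp: sorted_append)+
            have "length X * length Y \<le> 2 ^ h * 2 ^ h" using N by (intro mult_mono) auto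
            then show "k \<le> 2 ^ h * 2 ^ h" using k(2) by (rule le_trans[rotated])
            fix t5 :: nat and n5 :: nregs and r5 :: rregs
            assume 5: "t5 \<le> 80000 * 2 ^ h" "kth k (all_sums (X @ ?P) (Y @ ?P')) (r5 1)"
            have "kth k (all_sums X Y) (r5 1)" using 5(2) by (rule kth_padded_sums[OF XY ne k(2)])
            \<comment> \<open>The phases add up to at most \<open>80148 * 2 ^ h + 3\<close>, and the
              padded side is at most \<open>2 * ?N\<close>.\<close>
            moreover have "1 + (t1 + (t2 + (t3 + (t4 + (t5 + 1 + 1))))) \<le> 170000 * ?N"
              using 1(1) 2(1) 3(1) 4(1) 5(1) N(3) le pos by linarith
            ultimately show "wp up (\<lambda>t'. wp ?A (\<lambda>t''. ?Q (1 + (t1 + (t2 + (t3 + (t4 + (t5 + t' + t'')))))))) n5 r5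
                (?S2(2 := [], 3 := [])) (?T2(11 := T 11))"
              unfolding up_def using T
              by - (rule wp_While, simp, simp, simp add: eval_simps, rule wp_RAssign, simp_all)
          qed (use S T N k 4 in auto)
        qed (use S N 3 in auto)
      qed (use n N ne in auto)
    qed
  qed
qed

section \<open>Initial state and final constants\<close>

definition zero :: "nat list \<Rightarrow> com \<Rightarrow> com" where
  "zero xs c = foldr (\<lambda>x. Seq (NAssign x (NConst 0))) xs c"

lemma exec_NAssign_Seq:
  assumes "nfits W e s" "exec W c (s\<lparr>nreg := (nreg s)(x := nval e s)\<rparr>) t tr s'"
  shows "exec W (NAssign x e ;; c) s (t + ncost e + 2) tr s'"
  using exec.Seq[OF exec.NAssign[OF assms(1), of x] assms(2)] by (simp add: add_ac)

lemma exec_zero: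
  assumes "exec W c (s\<lparr>nreg := \<lambda>x. if x \<in> set xs then 0 else nreg s x\<rparr>) t tr s'"
  shows "exec W (zero xs c) s (t + 3 * length xs) tr s'"
  using assms
proof (induction xs arbitrary: s)
  case Nil
  then show ?case by (simp add: zero_def)
next
  case (Cons x xs)
  let ?s = "s\<lparr>nreg := (nreg s)(x := 0)\<rparr>"
  have "(\<lambda>y. if y \<in> set xs then 0 else nreg ?s y) = (\<lambda>y. if y \<in> set (x # xs) then 0 else nreg s y)"
    by (auto simp: fun_eq_iff)
  then have "exec W (zero xs c) ?s (t + 3 * length xs) tr s'"
    using Cons.prems by (intro Cons.IH) simp
  then have "exec W (zero (x # xs) c) s (t + 3 * length xs + ncost (NConst 0) + 2) tr s'"
    unfolding zero_def foldr.simps o_apply by (intro exec_NAssign_Seq) simp_all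
  moreover have "t + 3 * length xs + ncost (NConst 0) + 2 = t + 3 * length (x # xs)" by simp
  ultimately show ?case by (simp only:)
qed

text \<open>The two arrays become full stacks by setting their heights to the lengths. The base of
  the other stacks is the sum of both addresses and lengths, which lies beyond both arrays in
  whatever order they are stored. The other heights and registers may contain arbitrarily large
  values and are cleared.\<close>

definition setup_registers :: "com \<Rightarrow> com" where
  "setup_registers c = NAssign 20 (NReg 0) ;; NAssign 21 (NReg 1) ;; NAssign 32 (NReg 3) ;; NAssign 33 (NReg 4) ;;
    NAssign 34 (NAdd (NAdd (NReg 3) (NReg 4)) (NAdd (NReg 0) (NReg 1))) ;;
    zero ([5..<20] @ [22..<32]) c"

lemma exec_setup_registers:
  assumes "nreg s 3 + nreg s 4 + (nreg s 0 + nreg s 1) \<le> W"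
    and "exec W c (s\<lparr>nreg := \<lambda>x. if x \<in> set ([5..<20] @ [22..<32]) then 0 else
      ((nreg s)(20 := nreg s 0, 21 := nreg s 1, 32 := nreg s 3, 33 := nreg s 4,
        34 := nreg s 3 + nreg s 4 + (nreg s 0 + nreg s 1))) x\<rparr>) t tr s'"
  shows "exec W (setup_registers c) s (t + 96) tr s'"
proof -
  let ?t = "t + 3 * length ([5..<20] @ [22..<32]) +
      ncost (NAdd (NAdd (NReg 3) (NReg 4)) (NAdd (NReg 0) (NReg 1))) + 2 + ncost (NReg 4) + 2 + ncost (NReg 3) + 2 +
      ncost (NReg 1) + 2 + ncost (NReg 0) + 2"
  have "exec W (setup_registers c) s ?t tr s'"
    unfolding setup_registers_def
    by (intro exec_NAssign_Seq exec_zero; (rule back_subst[of "\<lambda>s. exec W c s t tr s'", OF assms(2)])?)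
      (use assms(1) in \<open>simp_all add: fun_eq_iff\<close>)
  moreover have "?t = t + 96" by simp
  ultimately show ?thesis by (simp only:)
qed

lemma exec_main:
  assumes XY: "sorted X" "sorted Y" and k: "1 \<le> k" "k \<le> length X * length Y"
    and st: "stored_at s pX X" "stored_at s pY Y"
    and s: "nreg s 0 = length X" "nreg s 1 = length Y" "nreg s 2 = k" "nreg s 3 = pX" "nreg s 4 = pY"
  defines "N \<equiv> max (length X) (length Y)"
  shows "\<exists>t tr s'. exec ((N + pX + pY + 2) ^ 30) (setup_registers main) s t tr s' \<and>
    is_kth_smallest k (entries (length Y) (length X) (sum_matrix X Y)) (rreg s' 0) \<and> t \<le> 3400096 * N \<and>
    (\<forall>M B. 1 \<le> B \<and> 36 * B \<le> M \<longrightarrow> io_cost M B tr \<le> enat 244800072 * Scan M B N)"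
proof -
  let ?W = "(N + pX + pY + 2) ^ 30" and ?b = "pX + pY + (length X + length Y)"
  let ?f = "\<lambda>x. if x \<in> set ([5..<20] @ [22..<32]) then 0 else
      ((nreg s)(20 := nreg s 0, 21 := nreg s 1, 32 := nreg s 3, 33 := nreg s 4,
        34 := nreg s 3 + nreg s 4 + (nreg s 0 + nreg s 1))) x"
  let ?s = "s\<lparr>nreg := ?f\<rparr>" and ?p = "(pX, pY, ?b)"
  let ?S = "(\<lambda>_. [])(0 := rev X, 1 := rev Y)" and ?T = "\<lambda>_. []"
  have "X \<noteq> []" "Y \<noteq> []" using k by auto
  then have N: "length X \<le> N" "length Y \<le> N" "1 \<le> N" by (auto simp: N_def Suc_le_eq less_max_iff_disj)
  have "wp main (\<lambda>t n r S T. t \<le> 170000 * N \<and> kth k (all_sums X Y) (r 0)) ?f (rreg s) ?S ?T"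
    unfolding N_def by (rule wp_main) (use XY k s in auto)
  then obtain t n r S T where run: "runs main ?f (rreg s) ?S ?T t n r S T"
    and t: "t \<le> 170000 * N" and res: "kth k (all_sums X Y) (r 0)"
    unfolding wp_def by blast
  have contents: "contents ?S ?T j = (if j = 0 then map RealW (rev X) else if j = 1 then map RealW (rev Y) else [])" for j
    by (simp add: contents_def)
  have "represents ?p ?f (rreg s) ?S ?T ?s"
  proof -
    have "?f (20 + j) = length (contents ?S ?T j)" if "j < 12" for j
    proof -
      consider "j = 0" | "j = 1" | "2 \<le> j" by linarith
      then show ?thesis
        unfolding contents
      proof cases
        case 3
        then have "20 + j \<in> set ([5..<20] @ [22..<32])"
          using that by (simp only: set_append set_upt Un_iff atLeastLessThan_iff) linarith
        then have "?f (20 + j) = 0" by (simp only: if_True)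
        with 3 show "?f (20 + j) = length (if j = 0 then map RealW (rev X) else if j = 1 then map RealW (rev Y) else [])"
          by simp
      qed (use s in auto)
    qed
    moreover have "mem ?s (slot ?p j i) = rev (contents ?S ?T j) ! i" if "i < length (contents ?S ?T j)" for i j
      using that st unfolding contents stored_at_def by (auto simp: slot_def rev_map split: if_splits)
    moreover have "length (contents ?S ?T 0) = length X" "length (contents ?S ?T 1) = length Y"
      unfolding contents by simp_all
    ultimately show ?thesis
      using s unfolding represents_def layout_def by simp
  qed
  moreover have "bounded ?f ?S ?T N (N * N + pX + pY)"
  proof -
    have le: "N \<le> N * N" using N(3) by simp
    have len: "length X \<le> N * N" "length Y \<le> N * N" using le N by linarith+
    have "length X * length Y \<le> N * N" using N by (intro mult_mono) auto
    then have kN: "k \<le> N * N" using k by linarith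
    have "?f x \<le> N * N + pX + pY" if "x < 20" for x
    proof -
      consider "x = 0" | "x = 1" | "x = 2" | "x = 3" | "x = 4" | "5 \<le> x" by linarith
      then show ?thesis
      proof cases
        case 6
        then have "x \<in> set ([5..<20] @ [22..<32])"
          using that by (simp only: set_append set_upt Un_iff atLeastLessThan_iff) simp
        then have "?f x = 0" by (simp only: if_True)
        then show ?thesis by linarith
      qed (use s len kN in auto)
    qed
    then show ?thesis using N unfolding bounded_def contents by simp
  qed
  moreover have W: "room ?W ?p N (N * N + pX + pY) t"
  proof -
    define m where "m = N + pX + pY + 2"
    have m: "N \<le> m" "pX + pY \<le> m" "3 \<le> m" "?b \<le> 2 * m" using N by (auto simp: m_def)
    have mm: "m \<le> m * m" by simp
    have "t * (N + t + 64) \<le> (170000 * m) * (170065 * m)"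
      using t N(3) m by (intro mult_mono) linarith+
    also have "\<dots> = 28911050000 * (m * m)" by simp
    finally have a: "t * (N + t + 64) \<le> 28911050000 * (m * m)" .
    have b: "N * N \<le> m * m" using m by (intro mult_mono) auto
    \<comment> \<open>The quadratic bounds have huge constants. As \<open>m\<close> is at least 3,
      all but two of the 30 factors of the word bound together contribute at least
      \<open>3 ^ 28\<close>, which exceeds them.\<close>
    have "(3::nat) ^ 28 * (m * m) \<le> m ^ 28 * (m * m)" using m(3) by (intro mult_le_mono1 power_mono) auto
    also have "\<dots> = m ^ 30" by (simp flip: power_add power2_eq_square)
    finally have c: "22876792454961 * (m * m) \<le> ?W" unfolding m_def[symmetric] by simp
    have tm: "t \<le> 170000 * m" using t mult_le_mono2[OF m(1), of 170000] by (rule le_trans)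
    have "?b + 12 * (N + t) + 12 \<le> 2 * m + 12 * (m + 170000 * m) + 12 * m"
      using m(1,3,4) tm by (intro add_mono mult_le_mono2) auto
    also have "\<dots> = 2040026 * m" by simp
    also have "\<dots> \<le> 22876792454961 * (m * m)" using mm by (intro mult_le_mono) auto
    also note c
    finally have "?b + 12 * (N + t) + 12 \<le> ?W" .
    moreover have "64 + (N * N + pX + pY + t * (N + t + 64)) \<le> ?W"
    proof -
      have "64 + (N * N + pX + pY + t * (N + t + 64)) \<le> 64 * (m * m) + (m * m + m * m + 28911050000 * (m * m))"
      proof -
        have x: "N * N + pX + pY \<le> m * m + m * m" using b m(2) mm by linarith
        have y: "64 \<le> 64 * (m * m)" using m(3) by simp
        show ?thesis by (rule add_mono[OF y add_mono[OF x a]])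
      qed
      also have "\<dots> = 28911050066 * (m * m)" by simp
      also have "\<dots> \<le> 22876792454961 * (m * m)" by (intro mult_le_mono1) simp
      also note c
      finally show ?thesis .
    qed
    ultimately show ?thesis by (simp add: room_def grow_def)
  qed
  ultimately obtain u tr s' d where ex: "exec ?W main ?s u tr s'" "u < 20 * t" "represents ?p n r S T s'"
    "fingers 12 tr (pos ?p ?S ?T) (pos ?p S T) d" "d \<le> 20 * t"
    using run unfolding runs_def serves_def by blast
  have "nreg s 3 + nreg s 4 + (nreg s 0 + nreg s 1) \<le> ?W"
    using W s by (simp add: room_def)
  from exec_setup_registers[OF this ex(1)] have "exec ?W (setup_registers main) s (u + 96) tr s'" .
  moreover have "u + 96 \<le> 3400096 * N" and d: "d \<le> 3400000 * N" using ex(2,5) t N(3) by linarith+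
  moreover have "kth k (entries (length Y) (length X) (sum_matrix X Y)) (rreg s' 0)"
    using res ex(3) by (simp add: represents_def kth_def size_filter_entries)
  \<comment> \<open>A stack machine step moves the fingers by at most 20 words in total, so
    \<open>20 * 170000 = 3400000\<close> words per item; with 12 fingers the factor is
    \<open>6 * 12 * 3400001\<close>.\<close>
  moreover have "io_cost M B tr \<le> enat 244800072 * Scan M B N" if "1 \<le> B" "36 * B \<le> M" for M B
    using io_cost_le_Scan[OF ex(4), of 3400000 N B M] that N(3) d by simp
  ultimately show ?thesis using kth_imp_is_kth_smallest k(1) by blast
qed

theorem theorem2:
  "\<exists>(P :: com) (c_time :: nat) (c_io :: nat) (c_cache :: nat) (c_word :: nat).
    \<forall>(X :: real list) (Y :: real list) (k :: nat) (pX :: nat) (pY :: nat) (s :: state).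
      sorted X \<and> sorted Y \<and> 1 \<le> k \<and> k \<le> length X * length Y \<and>
      stored_at s pX X \<and> stored_at s pY Y \<and>
      nreg s 0 = length X \<and> nreg s 1 = length Y \<and> nreg s 2 = k \<and>
      nreg s 3 = pX \<and> nreg s 4 = pY \<longrightarrow>
      (let n = max (length X) (length Y) in
        \<exists>t tr s'.
          exec ((n + pX + pY + 2) ^ c_word) P s t tr s' \<and>
          is_kth_smallest k (entries (length Y) (length X) (sum_matrix X Y)) (rreg s' 0) \<and>
          t \<le> c_time * n \<and>
          (\<forall>M B. 1 \<le> B \<and> c_cache * B \<le> M \<longrightarrow>
            io_cost M B tr \<le> enat c_io * Scan M B n))"
  by (rule exI[of _ "setup_registers main"], rule exI[of _ 3400096], rule exI[of _ 244800072],
    rule exI[of _ 36], rule exI[of _ 30], intro allI impI, elim conjE, unfold Let_def, rule exec_main)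

end
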